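(* Let $p,n\ge 1$ be integers, $N=n+p-1$, and let $I_p(L_N)\subseteq R=\Bbbk[x_1,\dots,x_N]$ be the $p$-path ideal of the path on $N$ vertices. Then $I_p(L_N)$ is bridge-friendly, and its Barile–Macchia resolution (with respect to the total order $m_1\succ m_2\succ\cdots\succ m_n$ on its minimal generators) is a minimal free resolution of $R/I_p(L_N)$.
   Context: $\Bbbk$ is any field. For $1\le i\le n$ let $m_i=x_ix_{i+1}\cdots x_{i+p-1}$; $I_p(L_N)=(m_1,\dots,m_n)$, with minimal generating set $\mathcal G=\{m_1,\dots,m_n\}$. The following notions are for a monomial ideal $I$ with minimal generating set $\mathcal G(I)$ and a total order $\succ$ on $\mathcal G(I)$. A cell is a subset of $\mathcal G(I)$; $\operatorname{lcm}(\emptyset)=1$. A bridge of a cell $\sigma$ is $m\in\sigma$ with $\operatorname{lcm}(\sigma\setminus m)=\operatorname{lcm}(\sigma)$; $\operatorname{sb}(\sigma)$ is the smallest bridge of $\sigma$ with respect to $\succ$ ($\operatorname{sb}(\sigma)=\emptyset$ if there is none). Barile–Macchia algorithm: start with $A=\emptyset$ and $\Omega=\{\text{cells of cardinality}\ge 3\}$. While $\Omega\ne\emptyset$, pick $\sigma\in\Omega$ of maximal cardinality, remove $\sigma$ and $\sigma\setminus\operatorname{sb}(\sigma)$ from $\Omega$, and, if $\sigma$ has a bridge, add the directed edge $(\sigma,\sigma\setminus\operatorname{sb}(\sigma))$ to $A$; such $\sigma$ is called potentially-type-2. Afterwards, whenever two distinct edges $(\sigma,\tau),(\sigma',\tau)$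 of $A$ have the same target and $\operatorname{sb}(\sigma')\succ\operatorname{sb}(\sigma)$, delete $(\sigma',\tau)$. The final $A$ is the Barile–Macchia matching of $I$ with respect to $\succ$. A cell $\sigma$ is type-2 if it is the source of an edge $(\sigma,\tau)$ in the final $A$. A cell is $A$-critical if it appears in no edge of the final $A$. $I$ is bridge-friendly if for some total order $\succ$ on $\mathcal G(I)$ every potentially-type-2 cell is type-2. Let $G_X$ be the directed graph whose vertices are all cells and whose edges are $(\sigma,\sigma')$ with $\sigma'\subseteq\sigma$, $|\sigma'|=|\sigma|-1$; let $G_X^A$ be obtained by reversing the edges in $A$. Let $[\sigma:\sigma']=\pm1$ be the coefficient of $\sigma'$ in the simplicial boundary of $\sigma$. For an edge $(\sigma,\sigma')$ of $G_X^A$ put $m(\sigma,\sigma')=-[\sigma':\sigma]$ if $(\sigma',\sigma)\in A$ and $m(\sigma,\sigma')=[\sigma:\sigma']$ otherwise; for a directed path $\mathcal P$ in $G_X^A$ (a gradient path, possibly of length $0$) let $m(\mathcal P)$ be the product over its edges. The Barile–Macchia resolution of $R/I$ with respect to $\succ$ is the free resolution $\mathcal F_A$ in which $(\mathcal F_A)_r$ is the free $R$-module on the $A$-critical cells of cardinality $r$, with $$\partial^A_r(\sigma)=\sum_{\sigma'\subseteq\sigma,\ |\sigma'|=r-1}[\sigma:\sigma']\sum_{\sigma''\text{ critical},\ |\sigma''|=r-1}\ \sum_{\mathcal P:\sigma'\to\sigma''\text{ gradient path}} m(\mathcal P)\frac{\operatorname{lcm}(\sigma)}{\operatorname{lcm}(\sigma'')}\sigma''.$$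 *)

theory Defs
  imports
    "HOL-Library.Poly_Mapping"
    "HOL-Library.While_Combinator"
    "HOL-Algebra.QuotRing"
    "HOL-Algebra.Module"
begin

section \<open>Polynomial rings and monomial ideals\<close>

text \<open>A monomial is its exponent vector, so the product, the quotient and the identity of monomials
  are \<open>+\<close>, \<open>-\<close> and \<open>0\<close>; multiplication on \<open>'k mpoly\<close> is the convolution
  product of \<^theory>\<open>HOL-Library.Poly_Mapping\<close>.\<close>

type_synonym mon = "nat \<Rightarrow>\<^sub>0 nat"
type_synonym 'k mpoly = "mon \<Rightarrow>\<^sub>0 'k"

abbreviation mono_poly :: "mon \<Rightarrow> 'k::field mpoly" where
  "mono_poly m \<equiv> Poly_Mapping.single m 1"

text \<open>The ring \<open>k[x\<^sub>1, \<dots>, x\<^sub>N]\<close>.\<close>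

definition poly_ring :: "nat \<Rightarrow> 'k::field mpoly ring" where
  "poly_ring N =
    \<lparr>carrier = {f. \<forall>m \<in> Poly_Mapping.keys f. Poly_Mapping.keys m \<subseteq> {1..N}},
     mult = (*), one = 1, zero = 0, add = (+)\<rparr>"

definition irrelevant_ideal :: "nat \<Rightarrow> 'k::field mpoly set" where
  "irrelevant_ideal N =
    genideal (poly_ring N) ((\<lambda>i. mono_poly (Poly_Mapping.single i 1)) ` {1..N})"

definition min_gen_set :: "nat \<Rightarrow> 'k::field mpoly set \<Rightarrow> mon set \<Rightarrow> bool" where
  "min_gen_set N I G \<longleftrightarrow>
    mono_poly ` G \<subseteq> carrier (poly_ring N :: 'k mpoly ring) \<and>
    genideal (poly_ring N) (mono_poly ` G) = I \<and>
    (\<forall>G'. G' \<subset> G \<longrightarrow> genideal (poly_ring N) (mono_poly ` G') \<noteq> I)"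

text \<open>A monomial ideal has exactly one minimal set of monomial generators.\<close>

definition min_gens :: "nat \<Rightarrow> 'k::field mpoly set \<Rightarrow> mon set" where
  "min_gens N I = (THE G. min_gen_set N I G)"

definition path_mon :: "nat \<Rightarrow> nat \<Rightarrow> mon" where
  "path_mon p i = (\<Sum>j = i..<i + p. Poly_Mapping.single j 1)"

text \<open>The generators correspond to the paths \<open>i, \<dots>, i + p - 1\<close> on \<open>p\<close> vertices inside \<open>1, \<dots>, N\<close>.\<close>

definition path_ideal :: "nat \<Rightarrow> nat \<Rightarrow> 'k::field mpoly set" where
  "path_ideal p N =
    genideal (poly_ring N) {mono_poly (path_mon p i) | i. 1 \<le> i \<and> i + p - 1 \<le> N}"


section \<open>Barile--Macchia matchings\<close>

text \<open>A total order is a reflexive relation \<open>r\<close> with \<open>linear_order_on G r\<close>, and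
  \<open>(a, b) \<in> r\<close> means that \<open>b = a\<close> or \<open>b \<succ> a\<close>.\<close>

type_synonym cell = "mon set"

text \<open>Only used for finite cells; \<open>mon_lcm {} = 0\<close> is the monomial 1.\<close>

definition mon_lcm :: "cell \<Rightarrow> mon" where
  "mon_lcm \<sigma> =
    Poly_Mapping.Abs_poly_mapping
      (\<lambda>i. Max (insert 0 ((\<lambda>m. Poly_Mapping.lookup m i) ` \<sigma>)))"

definition bridge :: "cell \<Rightarrow> mon \<Rightarrow> bool" where
  "bridge \<sigma> m \<longleftrightarrow> m \<in> \<sigma> \<and> mon_lcm (\<sigma> - {m}) = mon_lcm \<sigma>"

text \<open>The smallest bridge as a set: a singleton if \<open>\<sigma>\<close> (finite) has a bridge, and empty otherwise.\<close>

definition sb :: "mon rel \<Rightarrow> cell \<Rightarrow> mon set" where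
  "sb r \<sigma> = {m. bridge \<sigma> m \<and> (\<forall>m'. bridge \<sigma> m' \<longrightarrow> (m, m') \<in> r)}"

definition sb_greater :: "mon rel \<Rightarrow> cell \<Rightarrow> cell \<Rightarrow> bool" where
  "sb_greater r \<sigma>' \<sigma> \<longleftrightarrow> (\<exists>m' \<in> sb r \<sigma>'. \<exists>m \<in> sb r \<sigma>. m' \<noteq> m \<and> (m, m') \<in> r)"

text \<open>One round of the loop on the state \<open>(\<Omega>, A)\<close>. Since a round only removes cells of cardinality
  \<open>card \<sigma>\<close> (namely \<open>\<sigma>\<close>) and \<open>card \<sigma> - 1\<close>, the resulting \<open>A\<close> does not depend on which
  cells of maximal cardinality are picked.\<close>

definition bm_round :: "mon rel \<Rightarrow> cell set \<times> cell rel \<Rightarrow> cell set \<times> cell rel" where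
  "bm_round r = (\<lambda>(\<Omega>, A).
    let \<sigma> = (SOME \<sigma>. \<sigma> \<in> \<Omega> \<and> (\<forall>\<tau> \<in> \<Omega>. card \<tau> \<le> card \<sigma>)); \<tau> = \<sigma> - sb r \<sigma>
    in (\<Omega> - {\<sigma>, \<tau>}, if \<exists>m. bridge \<sigma> m then insert (\<sigma>, \<tau>) A else A))"

definition bm_edges :: "mon set \<Rightarrow> mon rel \<Rightarrow> cell rel" where
  "bm_edges G r =
    snd (while (\<lambda>(\<Omega>, A). \<Omega> \<noteq> {}) (bm_round r) ({\<sigma>. \<sigma> \<subseteq> G \<and> 3 \<le> card \<sigma>}, {}))"

definition bm_matching :: "mon set \<Rightarrow> mon rel \<Rightarrow> cell rel" where
  "bm_matching G r =
    {(\<sigma>', \<tau>) \<in> bm_edges G r.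
      \<not> (\<exists>\<sigma>. \<sigma> \<noteq> \<sigma>' \<and> (\<sigma>, \<tau>) \<in> bm_edges G r \<and> sb_greater r \<sigma>' \<sigma>)}"

definition potentially_type2 :: "mon set \<Rightarrow> mon rel \<Rightarrow> cell \<Rightarrow> bool" where
  "potentially_type2 G r \<sigma> \<longleftrightarrow> (\<exists>\<tau>. (\<sigma>, \<tau>) \<in> bm_edges G r)"

definition type2 :: "mon set \<Rightarrow> mon rel \<Rightarrow> cell \<Rightarrow> bool" where
  "type2 G r \<sigma> \<longleftrightarrow> (\<exists>\<tau>. (\<sigma>, \<tau>) \<in> bm_matching G r)"

definition bridge_friendly :: "nat \<Rightarrow> 'k::field mpoly set \<Rightarrow> bool" where
  "bridge_friendly N I \<longleftrightarrow>
    (\<exists>r. linear_order_on (min_gens N I) r \<and>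
      (\<forall>\<sigma>. potentially_type2 (min_gens N I) r \<sigma> \<longrightarrow> type2 (min_gens N I) r \<sigma>))"

definition critical :: "mon set \<Rightarrow> cell rel \<Rightarrow> cell \<Rightarrow> bool" where
  "critical G A \<sigma> \<longleftrightarrow> \<sigma> \<subseteq> G \<and> (\<forall>\<tau>. (\<sigma>, \<tau>) \<notin> A \<and> (\<tau>, \<sigma>) \<notin> A)"


section \<open>The Barile--Macchia resolution\<close>

definition facet :: "cell \<Rightarrow> cell \<Rightarrow> bool" where
  "facet \<sigma> \<sigma>' \<longleftrightarrow> \<sigma>' \<subseteq> \<sigma> \<and> card \<sigma> = Suc (card \<sigma>')"

text \<open>Cells are oriented by listing their elements in decreasing order, so the sign of the facet
  omitting \<open>v\<close> is \<open>- 1\<close> to the number of elements \<open>w \<succ> v\<close>; in particular \<open>[{v} : {}] = 1\<close>.\<close>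

definition incidence :: "mon rel \<Rightarrow> cell \<Rightarrow> cell \<Rightarrow> int" where
  "incidence r \<sigma> \<sigma>' =
    (if facet \<sigma> \<sigma>' then (- 1) ^ card {w \<in> \<sigma>'. \<exists>v \<in> \<sigma> - \<sigma>'. (v, w) \<in> r} else 0)"

definition morse_graph :: "mon set \<Rightarrow> cell rel \<Rightarrow> cell rel" where
  "morse_graph G A = ({(\<sigma>, \<sigma>'). \<sigma> \<subseteq> G \<and> facet \<sigma> \<sigma>'} - A) \<union> A\<inverse>"

definition edge_weight :: "mon rel \<Rightarrow> cell rel \<Rightarrow> cell \<Rightarrow> cell \<Rightarrow> int" where
  "edge_weight r A \<sigma> \<sigma>' =
    (if (\<sigma>', \<sigma>) \<in> A then - incidence r \<sigma>' \<sigma> else incidence r \<sigma> \<sigma>')"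

text \<open>Directed paths, given by their vertices. Barile--Macchia matchings are acyclic, so that requiring
  distinct vertices excludes nothing; it makes the set of paths finite by definition.\<close>

definition gradient_paths :: "mon set \<Rightarrow> cell rel \<Rightarrow> cell \<Rightarrow> cell \<Rightarrow> cell list set" where
  "gradient_paths G A \<sigma> \<tau> =
    {P. P \<noteq> [] \<and> hd P = \<sigma> \<and> last P = \<tau> \<and> set P \<subseteq> Pow G \<and> distinct P \<and>
        successively (\<lambda>a b. (a, b) \<in> morse_graph G A) P}"

definition path_weight :: "mon rel \<Rightarrow> cell rel \<Rightarrow> cell list \<Rightarrow> int" where
  "path_weight r A P = prod_list (map2 (edge_weight r A) P (tl P))"

definition bm_basis :: "mon set \<Rightarrow> mon rel \<Rightarrow> nat \<Rightarrow> cell set" where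
  "bm_basis G r k = {\<sigma>. critical G (bm_matching G r) \<sigma> \<and> card \<sigma> = k}"

definition bm_coeff :: "mon set \<Rightarrow> mon rel \<Rightarrow> cell \<Rightarrow> cell \<Rightarrow> 'k::field mpoly" where
  "bm_coeff G r \<sigma> \<sigma>'' =
    (\<Sum>\<sigma>' | facet \<sigma> \<sigma>'. of_int (incidence r \<sigma> \<sigma>') *
      (\<Sum>P \<in> gradient_paths G (bm_matching G r) \<sigma>' \<sigma>''.
        of_int (path_weight r (bm_matching G r) P) * mono_poly (mon_lcm \<sigma> - mon_lcm \<sigma>'')))"

text \<open>The differential in degree \<open>k\<close>; an element of a free module is its family of coordinates.\<close>

definition bm_diff ::
  "mon set \<Rightarrow> mon rel \<Rightarrow> nat \<Rightarrow> (cell \<Rightarrow> 'k::field mpoly) \<Rightarrow> (cell \<Rightarrow> 'k mpoly)" where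
  "bm_diff G r k f =
    (\<lambda>\<sigma>''. if \<sigma>'' \<in> bm_basis G r (k - 1)
           then \<Sum>\<sigma> \<in> bm_basis G r k. f \<sigma> * bm_coeff G r \<sigma> \<sigma>'' else 0)"


section \<open>Minimal free resolutions\<close>

text \<open>The type of module records extends that of ring records; the fields \<open>mult\<close> and \<open>one\<close> play
  no role for modules.\<close>

definition free_module :: "('a, 'm) ring_scheme \<Rightarrow> 'b set \<Rightarrow> ('a, 'b \<Rightarrow> 'a) module" where
  "free_module R B =
    \<lparr>carrier = {f. (\<forall>b \<in> B. f b \<in> carrier R) \<and> (\<forall>b. b \<notin> B \<longrightarrow> f b = \<zero>\<^bsub>R\<^esub>) \<and>
                   finite {b. f b \<noteq> \<zero>\<^bsub>R\<^esub>}},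
     mult = undefined, one = undefined,
     zero = (\<lambda>b. \<zero>\<^bsub>R\<^esub>), add = (\<lambda>f g b. f b \<oplus>\<^bsub>R\<^esub> g b),
     smult = (\<lambda>a f b. a \<otimes>\<^bsub>R\<^esub> f b)\<rparr>"

definition quotient_module :: "('a, 'm) ring_scheme \<Rightarrow> 'a set \<Rightarrow> ('a, 'a set) module" where
  "quotient_module R I =
    \<lparr>carrier = carrier (R Quot I),
     mult = mult (R Quot I), one = one (R Quot I),
     zero = zero (R Quot I), add = add (R Quot I),
     smult = (\<lambda>a X. (I +>\<^bsub>R\<^esub> a) \<otimes>\<^bsub>R Quot I\<^esub> X)\<rparr>"

definition module_homs ::
  "('a, 'm) ring_scheme \<Rightarrow> ('a, 'b) module \<Rightarrow> ('a, 'c) module \<Rightarrow> ('b \<Rightarrow> 'c) set" where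
  "module_homs R M M' =
    {h \<in> carrier M \<rightarrow> carrier M'.
      (\<forall>x \<in> carrier M. \<forall>y \<in> carrier M. h (x \<oplus>\<^bsub>M\<^esub> y) = h x \<oplus>\<^bsub>M'\<^esub> h y) \<and>
      (\<forall>a \<in> carrier R. \<forall>x \<in> carrier M. h (a \<odot>\<^bsub>M\<^esub> x) = a \<odot>\<^bsub>M'\<^esub> h x)}"

definition module_ker :: "('a, 'b) module \<Rightarrow> ('a, 'c) module \<Rightarrow> ('b \<Rightarrow> 'c) \<Rightarrow> 'b set" where
  "module_ker M M' h = {x \<in> carrier M. h x = \<zero>\<^bsub>M'\<^esub>}"

text \<open>\<open>\<dots> \<rightarrow> F\<^sub>1 \<rightarrow> F\<^sub>0 \<rightarrow> M \<rightarrow> 0\<close> is exact, where \<open>F\<^sub>k\<close> is the free module with basis \<open>B k\<close>,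
  \<open>d k\<close> is the map \<open>F\<^sub>k \<rightarrow> F\<^bsub>k-1\<^esub>\<close> for \<open>k \<ge> 1\<close>, and \<open>d 0\<close> is ignored.\<close>

definition free_resolution ::
  "('a, 'm) ring_scheme \<Rightarrow> (nat \<Rightarrow> 'b set) \<Rightarrow> (nat \<Rightarrow> ('b \<Rightarrow> 'a) \<Rightarrow> ('b \<Rightarrow> 'a)) \<Rightarrow>
    ('a, 'c) module \<Rightarrow> bool" where
  "free_resolution R B d M \<longleftrightarrow>
    (\<forall>k \<ge> 1. d k \<in> module_homs R (free_module R (B k)) (free_module R (B (k - 1)))) \<and>
    (\<forall>k \<ge> 1. d (k + 1) ` carrier (free_module R (B (k + 1))) =
             module_ker (free_module R (B k)) (free_module R (B (k - 1))) (d k)) \<and>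
    (\<exists>\<epsilon> \<in> module_homs R (free_module R (B 0)) M.
      \<epsilon> ` carrier (free_module R (B 0)) = carrier M \<and>
      d 1 ` carrier (free_module R (B 1)) = module_ker (free_module R (B 0)) M \<epsilon>)"

text \<open>Minimality is \<open>d (F\<^sub>k) \<subseteq> (x\<^sub>1, \<dots>, x\<^sub>N) F\<^bsub>k-1\<^esub>\<close>, that is, all coordinates of
  elements of the image lie in the ideal.\<close>

definition minimal_free_resolution ::
  "nat \<Rightarrow> (nat \<Rightarrow> 'b set) \<Rightarrow> (nat \<Rightarrow> ('b \<Rightarrow> 'k::field mpoly) \<Rightarrow> ('b \<Rightarrow> 'k mpoly)) \<Rightarrow>
    ('k mpoly, 'c) module \<Rightarrow> bool" where
  "minimal_free_resolution N B d M \<longleftrightarrow>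
    free_resolution (poly_ring N) B d M \<and>
    (\<forall>k \<ge> 1. \<forall>f \<in> carrier (free_module (poly_ring N) (B k)).
      \<forall>b \<in> B (k - 1). d k f b \<in> irrelevant_ideal N)"

text \<open>The order \<open>m\<^sub>1 \<succ> m\<^sub>2 \<succ> \<dots> \<succ> m\<^sub>n\<close>.\<close>

definition path_order :: "nat \<Rightarrow> nat \<Rightarrow> mon rel" where
  "path_order p n = {(path_mon p j, path_mon p i) | i j. 1 \<le> i \<and> i \<le> j \<and> j \<le> n}"

end

(*
  Encode a cell {m_i : i in S} by its index set S. The generator m_a is a bridge of S iff the
  neighbours x < a < y of a in S satisfy y <= x + p. Scan S from its largest element b: if S meets
  [b - p, b - 2], the pivot is b - 1; otherwise continue with the elements below b - p. Whether S
  contains its pivot q changes neither the pivot nor the lcm, and if q is in S, it is the smallest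
  bridge; a set without pivot has no bridge. Hence the Barile--Macchia edges are exactly the pairs
  (S, S - {q}); no two have the same target, so nothing is deleted and the ideal is
  bridge-friendly. The critical cells are disjoint unions of blocks {b} or {b - 1, b} with
  nonadjacent windows, so they are determined by their lcm, which makes the resolution minimal.

  For exactness, multiply the coordinate at a cell by its lcm. Every multidegree w then gives the
  Morse complex of the full simplex on the generators dividing w, with constant coefficients. The
  path sums define a chain map from the simplicial chains to the critical cells that kills the
  sources of matched pairs and their boundaries, and triangularity of the matching reduces
  exactness to that of the simplex.
*)
theory Submission
  imports Defs
begin

section \<open>Discrete Morse theory on a simplex\<close>


text \<open>A target of an edge may have bridges of its own; the algorithm passes over it only
  because its source has one element more and is picked earlier. So the matching is given in closed
  form, by a rule that both cells of a pair obey, and only then compared with the loop. The pivot is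
  such a rule: it can be computed from the smaller set as well, where it is not an element.

  Restricting to the generators dividing w changes the cells, the paths and the matching. No path
  sums are compared for different w: their values on critical cells, on sources and on boundaries of
  sources determine them for an acyclic matching, and these linear conditions pass to every set of
  generators that separates no matched pair. The generators dividing w form such a set since matched
  cells have equal lcm.

  If no generator divides w, the simplex shrinks to the empty cell and exactness fails; these w are
  exactly the multidegrees that survive in R/I. Acyclicity enters only through a rank of the
  targets.\<close>

lemma facetE:
  assumes "facet \<sigma> \<tau>" "finite \<sigma>"
  obtains v where "v \<in> \<sigma>" "\<tau> = \<sigma> - {v}"
proof -
  have "\<tau> \<subseteq> \<sigma>" "card \<sigma> = Suc (card \<tau>)" using assms by (auto simp: facet_def)
  then have "card (\<sigma> - \<tau>) = 1"
    using assms(2) by (simp add: card_Diff_subset finite_subset)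
  then obtain v where "\<sigma> - \<tau> = {v}" by (auto simp: card_1_singleton_iff)
  then show ?thesis using that[of v] \<open>\<tau> \<subseteq> \<sigma>\<close> by auto
qed

lemma facet_remove: "finite \<sigma> \<Longrightarrow> v \<in> \<sigma> \<Longrightarrow> facet \<sigma> (\<sigma> - {v})"
  unfolding facet_def by (intro conjI card.remove) auto

lemma facet_insert: "finite \<tau> \<Longrightarrow> u \<notin> \<tau> \<Longrightarrow> facet (insert u \<tau>) \<tau>"
  by (auto simp: facet_def)

lemma facets_eq: "finite \<sigma> \<Longrightarrow> {\<tau>. facet \<sigma> \<tau>} = (\<lambda>v. \<sigma> - {v}) ` \<sigma>"
  by (auto intro: facet_remove elim: facetE)

lemma finite_facets: "finite \<sigma> \<Longrightarrow> finite {\<tau>. facet \<sigma> \<tau>}"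
  by (simp add: facets_eq)

lemma sum_facets: "finite \<sigma> \<Longrightarrow> (\<Sum>\<tau> | facet \<sigma> \<tau>. f \<tau>) = (\<Sum>v\<in>\<sigma>. f (\<sigma> - {v}))"
  unfolding facets_eq by (subst sum.reindex) (auto simp: inj_on_def)

lemma incidence_not_facet: "\<not> facet \<sigma> \<tau> \<Longrightarrow> incidence r \<sigma> \<tau> = 0"
  by (simp add: incidence_def)

lemma incidence_insert:
  assumes "finite \<tau>" "u \<notin> \<tau>"
  shows "incidence r (insert u \<tau>) \<tau> = (- 1) ^ card {w \<in> \<tau>. (u, w) \<in> r}"
proof -
  have "insert u \<tau> - \<tau> = {u}" using assms by auto
  then show ?thesis using facet_insert[OF assms] by (simp add: incidence_def)
qed

lemma incidence_remove:
  assumes "finite \<sigma>" "v \<in> \<sigma>"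
  shows "incidence r \<sigma> (\<sigma> - {v}) = (- 1) ^ card {w \<in> \<sigma> - {v}. (v, w) \<in> r}"
  using incidence_insert[of "\<sigma> - {v}" v r] assms by (simp add: insert_absorb)

lemma incidence_mult_self: "facet \<sigma> \<tau> \<Longrightarrow> incidence r \<sigma> \<tau> * incidence r \<sigma> \<tau> = 1"
  by (simp add: incidence_def flip: power_add)

text \<open>Removing two vertices in either order gives opposite signs: the larger vertex counts in
  the sign of the smaller one only while it is still present, and the smaller one never counts for
  the larger. All other terms vanish.\<close>

lemma incidence_square:
  assumes "finite \<sigma>" "antisym r" "total_on \<sigma> r"
  shows "(\<Sum>\<tau> | facet \<sigma> \<tau>. incidence r \<sigma> \<tau> * incidence r \<tau> e) = 0"
proof (cases "\<exists>\<tau>. facet \<sigma> \<tau> \<and> facet \<tau> e")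
  case False
  then show ?thesis by (auto intro!: sum.neutral simp: incidence_not_facet)
next
  case True
  then obtain \<tau> where \<tau>: "facet \<sigma> \<tau>" "facet \<tau> e" by blast
  obtain a where a: "a \<in> \<sigma>" "\<tau> = \<sigma> - {a}" using facetE[OF \<tau>(1) assms(1)] .
  obtain b where b: "b \<in> \<tau>" "e = \<tau> - {b}" using facetE[OF \<tau>(2)] assms(1) a by blast
  have "\<exists>u v. u \<in> \<sigma> \<and> v \<in> \<sigma> \<and> u \<noteq> v \<and> e = \<sigma> - {u} - {v} \<and> (u, v) \<in> r"
  proof (cases "(a, b) \<in> r")
    case True
    then show ?thesis using a b by blast
  next
    case False
    then have "(b, a) \<in> r" using assms(3) a b by (auto simp: total_on_def)
    moreover have "e = \<sigma> - {b} - {a}" using a b by auto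
    ultimately show ?thesis using a b by blast
  qed
  then obtain u v where uv: "u \<in> \<sigma>" "v \<in> \<sigma>" "u \<noteq> v" "e = \<sigma> - {u} - {v}" "(u, v) \<in> r"
    by blast
  have vu: "(v, u) \<notin> r" using uv assms(2) by (auto dest: antisymD)
  have fe: "finite e" using uv assms(1) by auto
  have eq1: "{w \<in> \<sigma> - {u}. (u, w) \<in> r} = insert v {w \<in> e. (u, w) \<in> r}" using uv by auto
  have eq2: "{w \<in> \<sigma> - {v}. (v, w) \<in> r} = {w \<in> e. (v, w) \<in> r}" using uv vu by auto
  have e': "\<sigma> - {v} - {u} = e" using uv by auto
  have s1: "incidence r \<sigma> (\<sigma> - {u}) = - ((- 1) ^ card {w \<in> e. (u, w) \<in> r})"
    unfolding incidence_remove[OF assms(1) uv(1)] eq1 using uv(4) fe by simp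
  have s2: "incidence r \<sigma> (\<sigma> - {v}) = (- 1) ^ card {w \<in> e. (v, w) \<in> r}"
    unfolding incidence_remove[OF assms(1) uv(2)] eq2 ..
  have s3: "incidence r (\<sigma> - {u}) e = (- 1) ^ card {w \<in> e. (v, w) \<in> r}"
    using incidence_remove[of "\<sigma> - {u}" v r] uv assms(1) by simp
  have s4: "incidence r (\<sigma> - {v}) e = (- 1) ^ card {w \<in> e. (u, w) \<in> r}"
    using incidence_remove[of "\<sigma> - {v}" u r] uv(1,3) assms(1) by (simp add: e')
  have "(\<Sum>\<tau> | facet \<sigma> \<tau>. incidence r \<sigma> \<tau> * incidence r \<tau> e)
      = (\<Sum>w\<in>\<sigma>. incidence r \<sigma> (\<sigma> - {w}) * incidence r (\<sigma> - {w}) e)"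
    by (rule sum_facets[OF assms(1)])
  also have "\<dots> = (\<Sum>w\<in>{u, v}. incidence r \<sigma> (\<sigma> - {w}) * incidence r (\<sigma> - {w}) e)"
  proof (rule sum.mono_neutral_right)
    show "\<forall>w\<in>\<sigma> - {u, v}. incidence r \<sigma> (\<sigma> - {w}) * incidence r (\<sigma> - {w}) e = 0"
    proof
      fix w assume "w \<in> \<sigma> - {u, v}"
      then have "w \<in> e" "w \<notin> \<sigma> - {w}" using uv by auto
      then have "\<not> facet (\<sigma> - {w}) e" by (auto simp: facet_def)
      then show "incidence r \<sigma> (\<sigma> - {w}) * incidence r (\<sigma> - {w}) e = 0"
        by (simp add: incidence_not_facet)
    qed
  qed (use uv assms in auto)
  also have "\<dots> = 0" using uv(3) s1 s2 s3 s4 by simp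
  finally show ?thesis .
qed

text \<open>The cone vertex \<open>v\<close> lies above \<open>u\<close>, so its presence adds one
  to the exponent of the sign. This is the anticommutation behind the contraction of the
  simplex.\<close>

lemma incidence_cone:
  assumes fin: "finite \<tau>" and v: "v \<in> \<tau>" "\<And>w. w \<in> \<tau> \<Longrightarrow> (w, v) \<in> r" and u: "u \<notin> \<tau>" "(u, v) \<in> r"
  shows "incidence r (insert u \<tau>) \<tau> = - incidence r (insert u (\<tau> - {v})) (\<tau> - {v})"
proof -
  have "{w \<in> \<tau>. (u, w) \<in> r} = insert v {w \<in> \<tau> - {v}. (u, w) \<in> r}" using v u by auto
  then show ?thesis
    using fin u by (subst (1 2) incidence_insert) auto
qed

text \<open>\<open>\<mu>\<close> certifies acyclicity: a gradient path goes from a target up to its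
  source and down to another facet, and it can go up again only if that facet is a target too. Hence
  only targets have to be compared.\<close>

locale morse_matching =
  fixes H :: "mon set" and r :: "mon rel" and M :: "cell rel" and \<mu> :: "cell \<Rightarrow> nat"
  assumes fin: "finite H"
    and antisym: "antisym r" and total: "total_on H r" and trans: "trans r" and refl: "refl_on H r"
    and M_sub: "(\<sigma>, \<tau>) \<in> M \<Longrightarrow> \<sigma> \<subseteq> H"
    and M_facet: "(\<sigma>, \<tau>) \<in> M \<Longrightarrow> facet \<sigma> \<tau>"
    and M_fun: "(\<sigma>, \<tau>) \<in> M \<Longrightarrow> (\<sigma>, \<tau>') \<in> M \<Longrightarrow> \<tau> = \<tau>'"
    and M_inj: "(\<sigma>, \<tau>) \<in> M \<Longrightarrow> (\<sigma>', \<tau>) \<in> M \<Longrightarrow> \<sigma> = \<sigma>'"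
    and M_alt: "(\<sigma>, \<tau>) \<in> M \<Longrightarrow> (\<tau>, \<tau>') \<notin> M"
    and M_less: "(\<sigma>, \<tau>) \<in> M \<Longrightarrow> facet \<sigma> \<tau>' \<Longrightarrow> \<tau>' \<noteq> \<tau> \<Longrightarrow> (\<sigma>', \<tau>') \<in> M \<Longrightarrow> \<mu> \<tau>' < \<mu> \<tau>"
begin

abbreviation "crit \<equiv> critical H M"

lemma fin_sub: "\<sigma> \<subseteq> H \<Longrightarrow> finite \<sigma>" using fin finite_subset by blast

lemma facet_sub: "facet \<sigma> \<tau> \<Longrightarrow> \<sigma> \<subseteq> H \<Longrightarrow> \<tau> \<subseteq> H" by (auto simp: facet_def)

lemma M_sub2: "(\<sigma>, \<tau>) \<in> M \<Longrightarrow> \<tau> \<subseteq> H"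
  using M_sub M_facet facet_sub by blast

lemma finite_crit: "finite {c. crit c}"
  by (rule finite_subset[of _ "Pow H"]) (auto simp: critical_def fin)

lemma crit_sub: "crit c \<Longrightarrow> c \<subseteq> H" by (simp add: critical_def)

lemma cell_cases:
  assumes "c \<subseteq> H"
  obtains "crit c" | \<tau> where "(c, \<tau>) \<in> M" | \<sigma> where "(\<sigma>, c) \<in> M"
  using assms by (auto simp: critical_def)

lemma facets_square: "\<sigma> \<subseteq> H \<Longrightarrow> (\<Sum>\<tau> | facet \<sigma> \<tau>. incidence r \<sigma> \<tau> * incidence r \<tau> e) = 0"
  using total by (intro incidence_square) (auto simp: fin_sub antisym total_on_def)

lemma sum_facets_Pow:
  fixes f :: "cell \<Rightarrow> 'k::comm_ring_1"
  assumes "\<sigma> \<subseteq> H"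
  shows "(\<Sum>\<tau>\<in>Pow H. of_int (incidence r \<sigma> \<tau>) * f \<tau>)
    = (\<Sum>\<tau> | facet \<sigma> \<tau>. of_int (incidence r \<sigma> \<tau>) * f \<tau>)"
  using assms facet_sub
  by (intro sum.mono_neutral_right) (auto simp: fin incidence_not_facet)

text \<open>Uniqueness principle for flows. At a target \<open>c\<close> with source
  \<open>\<sigma>\<close>, the equation for the boundary of \<open>\<sigma>\<close> expresses
  \<open>E c\<close> up to sign by the values at the other facets, and these are critical, sources,
  or targets of smaller rank.\<close>

lemma vanish:
  fixes E :: "cell \<Rightarrow> int"
  assumes crit: "\<And>c. crit c \<Longrightarrow> E c = 0" and src: "\<And>\<sigma> \<tau>. (\<sigma>, \<tau>) \<in> M \<Longrightarrow> E \<sigma> = 0"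
    and bd: "\<And>\<sigma> \<tau>. (\<sigma>, \<tau>) \<in> M \<Longrightarrow> (\<Sum>c | facet \<sigma> c. incidence r \<sigma> c * E c) = 0"
  shows "c \<subseteq> H \<Longrightarrow> E c = 0"
proof (induction "\<mu> c" arbitrary: c rule: less_induct)
  case less
  from less.prems show ?case
  proof (cases rule: cell_cases)
    case (3 \<sigma>)
    note \<sigma> = M_sub[OF 3] M_facet[OF 3]
    have "E c' = 0" if c': "facet \<sigma> c'" "c' \<noteq> c" for c'
    proof -
      have "c' \<subseteq> H" using c' \<sigma> facet_sub by blast
      then show ?thesis
      proof (cases rule: cell_cases)
        case (3 \<sigma>')
        show ?thesis using less.hyps[OF M_less[OF \<open>(\<sigma>, c) \<in> M\<close> c' 3]] \<open>c' \<subseteq> H\<close> by blast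
      qed (use crit src in auto)
    qed
    then have "(\<Sum>c' | facet \<sigma> c'. incidence r \<sigma> c' * E c') = (\<Sum>c'\<in>{c}. incidence r \<sigma> c' * E c')"
      using \<sigma> by (intro sum.mono_neutral_right) (auto simp: finite_facets fin_sub)
    then have "incidence r \<sigma> c * E c = 0" using bd[OF 3] by simp
    then show ?thesis using incidence_mult_self[OF \<sigma>(2), of r] by auto
  qed (use crit src in auto)
qed

text \<open>Chains of all dimensions are mixed and the empty cell takes part, so this is the
  boundary of the augmented complex, and the simplex is exact everywhere.\<close>

definition bd :: "(cell \<Rightarrow> 'k::comm_ring_1) \<Rightarrow> cell \<Rightarrow> 'k" where
  "bd \<phi> \<tau> = (\<Sum>\<sigma>\<in>Pow H. \<phi> \<sigma> * of_int (incidence r \<sigma> \<tau>))"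

lemma bd_bd: "bd (bd \<phi>) e = (0::'k::comm_ring_1)"
proof -
  have "bd (bd \<phi>) e = (\<Sum>\<tau>\<in>Pow H. \<Sum>\<sigma>\<in>Pow H. \<phi> \<sigma> * of_int (incidence r \<sigma> \<tau> * incidence r \<tau> e))"
    by (simp add: bd_def sum_distrib_left sum_distrib_right mult_ac)
  also have "\<dots> = (\<Sum>\<sigma>\<in>Pow H. \<phi> \<sigma> * (\<Sum>\<tau>\<in>Pow H. of_int (incidence r \<sigma> \<tau> * incidence r \<tau> e)))"
    by (subst sum.swap) (simp add: sum_distrib_left)
  also have "\<dots> = 0"
  proof (rule sum.neutral, rule ballI)
    fix \<sigma> assume "\<sigma> \<in> Pow H"
    then show "\<phi> \<sigma> * (\<Sum>\<tau>\<in>Pow H. of_int (incidence r \<sigma> \<tau> * incidence r \<tau> e)) = 0"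
      using sum_facets_Pow[of \<sigma> "\<lambda>\<tau>. incidence r \<tau> e"] facets_square[of \<sigma> e]
      by (simp add: of_int_sum[symmetric] del: of_int_sum of_int_mult)
  qed
  finally show ?thesis .
qed

lemma bd_diff: "bd (\<lambda>\<sigma>. f \<sigma> - h \<sigma>) \<tau> = bd f \<tau> - bd h \<tau>"
  by (simp add: bd_def left_diff_distrib sum_subtractf)

lemma bd_insert:
  assumes "\<tau> \<subseteq> H"
  shows "bd \<phi> \<tau> = (\<Sum>u\<in>H - \<tau>. \<phi> (insert u \<tau>) * of_int (incidence r (insert u \<tau>) \<tau>))"
proof -
  have "bd \<phi> \<tau> = (\<Sum>\<sigma>\<in>(\<lambda>u. insert u \<tau>) ` (H - \<tau>). \<phi> \<sigma> * of_int (incidence r \<sigma> \<tau>))"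
    unfolding bd_def
  proof (rule sum.mono_neutral_right)
    show "\<forall>\<sigma>\<in>Pow H - (\<lambda>u. insert u \<tau>) ` (H - \<tau>). \<phi> \<sigma> * of_int (incidence r \<sigma> \<tau>) = 0"
    proof
      fix \<sigma> assume \<sigma>: "\<sigma> \<in> Pow H - (\<lambda>u. insert u \<tau>) ` (H - \<tau>)"
      have "\<not> facet \<sigma> \<tau>"
      proof
        assume "facet \<sigma> \<tau>"
        then obtain v where "v \<in> \<sigma>" "\<tau> = \<sigma> - {v}" using facetE fin_sub \<sigma> by blast
        then have "\<sigma> = insert v \<tau>" "v \<in> H - \<tau>" using \<sigma> by auto
        then show False using \<sigma> by blast
      qed
      then show "\<phi> \<sigma> * of_int (incidence r \<sigma> \<tau>) = 0" by (simp add: incidence_not_facet)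
    qed
  qed (use assms fin in auto)
  also have "\<dots> = (\<Sum>u\<in>H - \<tau>. \<phi> (insert u \<tau>) * of_int (incidence r (insert u \<tau>) \<tau>))"
    by (subst sum.reindex) (auto simp: inj_on_def)
  finally show ?thesis .
qed

lemma max_vertex:
  assumes "H \<noteq> {}"
  obtains v where "v \<in> H" "\<And>w. w \<in> H \<Longrightarrow> (w, v) \<in> r"
proof -
  have "\<exists>v\<in>F. \<forall>w\<in>F. (w, v) \<in> r" if "finite F" "F \<noteq> {}" "F \<subseteq> H" for F
    using that
  proof (induction F rule: finite_ne_induct)
    case (singleton x)
    then show ?case using refl by (auto simp: refl_on_def)
  next
    case (insert x F)
    then obtain v where v: "v \<in> F" "\<forall>w\<in>F. (w, v) \<in> r" by auto
    have xx: "(x, x) \<in> r" using refl insert.prems by (auto simp: refl_on_def)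
    have "x \<in> H" "v \<in> H" "x \<noteq> v" using v(1) insert by auto
    then consider "(x, v) \<in> r" | "(v, x) \<in> r"
      using total unfolding total_on_def by blast
    then show ?case
    proof cases
      case 1
      then show ?thesis using v by auto
    next
      case 2
      then show ?thesis using v xx trans by (metis insert_iff transD)
    qed
  qed
  from this[OF fin assms] show ?thesis using that by auto
qed

text \<open>The full simplex is contracted by coning with its largest vertex, which enters every cell with
  sign \<open>+\<close>.\<close>

lemma simplex_exact:
  fixes \<phi> :: "cell \<Rightarrow> 'k::comm_ring_1"
  assumes "H \<noteq> {}" and bd0: "\<And>\<tau>. \<tau> \<subseteq> H \<Longrightarrow> bd \<phi> \<tau> = 0"
  obtains y where "\<And>\<tau>. \<tau> \<subseteq> H \<Longrightarrow> bd y \<tau> = \<phi> \<tau>"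
proof -
  obtain v where v: "v \<in> H" "\<And>w. w \<in> H \<Longrightarrow> (w, v) \<in> r" using max_vertex assms(1) by blast
  define y where "y \<sigma> = (if v \<in> \<sigma> then \<phi> (\<sigma> - {v}) else 0)" for \<sigma>
  have "bd y \<tau> = \<phi> \<tau>" if \<tau>: "\<tau> \<subseteq> H" for \<tau>
  proof (cases "v \<in> \<tau>")
    case False
    have "bd y \<tau> = (\<Sum>u\<in>{v}. y (insert u \<tau>) * of_int (incidence r (insert u \<tau>) \<tau>))"
      unfolding bd_insert[OF \<tau>] using v False
      by (intro sum.mono_neutral_right) (auto simp: fin y_def)
    also have "\<dots> = \<phi> \<tau>"
    proof -
      have "{w \<in> \<tau>. (v, w) \<in> r} = {}"
        using v False \<tau> antisym by (auto dest!: antisymD)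
      then have "incidence r (insert v \<tau>) \<tau> = 1"
        by (simp only: incidence_insert[OF fin_sub[OF \<tau>] False] card.empty power_0)
      then show ?thesis using False by (simp add: y_def)
    qed
    finally show ?thesis .
  next
    case True
    \<comment> \<open>All cofaces of \<open>\<tau>\<close> contain \<open>v\<close>, so
      \<open>bd y \<tau>\<close> is minus the sum \<open>S\<close> over the cells obtained from
      \<open>?t\<close> by adding some \<open>u\<close> outside \<open>\<tau>\<close>. In the cycle
      condition at \<open>?t\<close> the only further term is \<open>\<phi> \<tau>\<close>.\<close>
    let ?t = "\<tau> - {v}"
    let ?f = "\<lambda>u. \<phi> (insert u ?t) * of_int (incidence r (insert u ?t) ?t)"
    define S where "S = (\<Sum>u\<in>H - \<tau>. ?f u)"
    have "bd y \<tau> = (\<Sum>u\<in>H - \<tau>. - ?f u)"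
      unfolding bd_insert[OF \<tau>]
    proof (rule sum.cong)
      fix u assume u: "u \<in> H - \<tau>"
      have "insert u \<tau> - {v} = insert u ?t" using u True by auto
      moreover have "incidence r (insert u \<tau>) \<tau> = - incidence r (insert u ?t) ?t"
        using u v \<tau> True fin_sub[OF \<tau>] by (intro incidence_cone) auto
      ultimately show "y (insert u \<tau>) * of_int (incidence r (insert u \<tau>) \<tau>) = - ?f u"
        using True by (simp add: y_def)
    qed simp
    then have "bd y \<tau> = - S" by (simp add: S_def sum_negf)
    moreover have "bd \<phi> ?t = ?f v + S"
    proof -
      have "H - ?t = insert v (H - \<tau>)" using v True by auto
      moreover have "?t \<subseteq> H" using \<tau> by auto
      ultimately show ?thesis using True by (simp add: S_def bd_insert fin)
    qed
    moreover have "?f v = \<phi> \<tau>"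
    proof -
      have "{w \<in> ?t. (v, w) \<in> r} = {}"
        using v \<tau> antisym by (auto dest!: antisymD)
      moreover have t: "finite ?t" "v \<notin> ?t" using fin_sub[OF \<tau>] by auto
      ultimately have "incidence r (insert v ?t) ?t = 1"
        by (simp only: incidence_insert[OF t] card.empty power_0)
      then show ?thesis using True by (simp add: insert_absorb)
    qed
    moreover have "bd \<phi> ?t = 0" using \<tau> by (intro bd0) auto
    ultimately show ?thesis by (metis add.commute neg_eq_iff_add_eq_0)
  qed
  then show ?thesis using that by blast
qed

lemma \<mu>_bounded: obtains m where "\<And>\<tau>. \<tau> \<subseteq> H \<Longrightarrow> \<mu> \<tau> < m"
proof -
  have "\<forall>\<tau>\<in>Pow H. \<mu> \<tau> < Suc (Max (\<mu> ` Pow H))"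
    by (simp add: fin le_imp_less_Suc)
  then show ?thesis using that by blast
qed

text \<open>The boundary map from sources to targets is triangular with diagonal entries 1 or -1:
  besides its own source, a target \<open>\<tau>\<close> is a facet only of sources whose targets
  have larger rank. The induction therefore descends from the largest rank.\<close>

lemma sources_inject:
  fixes x :: "cell \<Rightarrow> 'k::comm_ring_1"
  assumes supp: "\<And>\<sigma>. x \<sigma> \<noteq> 0 \<Longrightarrow> \<exists>\<tau>. (\<sigma>, \<tau>) \<in> M"
    and bd0: "\<And>\<tau>. \<tau> \<subseteq> H \<Longrightarrow> bd x \<tau> = 0"
  shows "x \<sigma> = 0"
proof -
  obtain m where m: "\<And>\<tau>. \<tau> \<subseteq> H \<Longrightarrow> \<mu> \<tau> < m" using \<mu>_bounded by blast
  have "x \<sigma> = 0" if "(\<sigma>, \<tau>) \<in> M" for \<sigma> \<tau>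
    using that
  proof (induction "m - \<mu> \<tau>" arbitrary: \<sigma> \<tau> rule: less_induct)
    case less
    have other: "x \<sigma>' * of_int (incidence r \<sigma>' \<tau>) = 0" if "\<sigma>' \<noteq> \<sigma>" for \<sigma>'
    proof (rule ccontr)
      assume *: "x \<sigma>' * of_int (incidence r \<sigma>' \<tau>) \<noteq> 0"
      then have "x \<sigma>' \<noteq> 0" "facet \<sigma>' \<tau>" using incidence_not_facet by fastforce+
      then obtain \<tau>' where \<tau>': "(\<sigma>', \<tau>') \<in> M" using supp by blast
      have "\<tau>' \<noteq> \<tau>" using M_inj less.prems \<tau>' that by blast
      then have "\<mu> \<tau> < \<mu> \<tau>'" using M_less[OF \<tau>' \<open>facet \<sigma>' \<tau>\<close>] less.prems by blast
      then have "m - \<mu> \<tau>' < m - \<mu> \<tau>" using m[OF M_sub2[OF \<tau>']] by simp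
      then show False using less.hyps[OF _ \<tau>'] \<open>x \<sigma>' \<noteq> 0\<close> by blast
    qed
    have "bd x \<tau> = (\<Sum>\<sigma>'\<in>{\<sigma>}. x \<sigma>' * of_int (incidence r \<sigma>' \<tau>))"
      unfolding bd_def using other M_sub[OF less.prems]
      by (intro sum.mono_neutral_right) (auto simp: fin)
    then have "x \<sigma> * of_int (incidence r \<sigma> \<tau>) = 0"
      using bd0[OF M_sub2[OF less.prems]] by simp
    then have "x \<sigma> * of_int (incidence r \<sigma> \<tau> * incidence r \<sigma> \<tau>) = 0"
      by (metis mult.assoc mult_zero_left of_int_mult)
    then show ?case by (simp add: incidence_mult_self[OF M_facet[OF less.prems]])
  qed
  then show ?thesis using supp by blast
qed

text \<open>The same triangular system, now solved for an arbitrary right-hand side. Together with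
  \<open>sources_inject\<close> this says that the matrix from sources to targets is invertible over
  any commutative ring.\<close>

lemma sources_eliminate:
  fixes z :: "cell \<Rightarrow> 'k::comm_ring_1"
  obtains s where "\<And>\<sigma>. s \<sigma> \<noteq> 0 \<Longrightarrow> \<exists>\<tau>. (\<sigma>, \<tau>) \<in> M"
    "\<And>\<sigma> \<tau>. (\<sigma>, \<tau>) \<in> M \<Longrightarrow> bd s \<tau> = z \<tau>"
proof -
  obtain m where m: "\<And>\<tau>. \<tau> \<subseteq> H \<Longrightarrow> \<mu> \<tau> < m" using \<mu>_bounded by blast
  \<comment> \<open>\<open>j\<close> counts the ranks treated so far, starting from the bound
    \<open>m\<close> and going down; at \<open>j = m\<close> all targets are covered.\<close>
  have "\<exists>s. (\<forall>\<sigma>. s \<sigma> \<noteq> 0 \<longrightarrow> (\<exists>\<tau>. (\<sigma>, \<tau>) \<in> M)) \<and>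
    (\<forall>\<sigma> \<tau>. (\<sigma>, \<tau>) \<in> M \<longrightarrow> m \<le> \<mu> \<tau> + j \<longrightarrow> bd s \<tau> = z \<tau>)" for j
  proof (induction j)
    case 0
    have "\<not> m \<le> \<mu> \<tau> + 0" if "(\<sigma>, \<tau>) \<in> M" for \<sigma> \<tau>
      using m[OF M_sub2[OF that]] by simp
    then show ?case by (intro exI[of _ "\<lambda>_. 0"]) auto
  next
    case (Suc j)
    then obtain s where s: "\<And>\<sigma>. s \<sigma> \<noteq> 0 \<Longrightarrow> \<exists>\<tau>. (\<sigma>, \<tau>) \<in> M"
      "\<And>\<sigma> \<tau>. (\<sigma>, \<tau>) \<in> M \<Longrightarrow> m \<le> \<mu> \<tau> + j \<Longrightarrow> bd s \<tau> = z \<tau>" by blast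
    \<comment> \<open>The correction \<open>t\<close> lives on the sources whose targets have
      exactly the next rank. It is invisible at targets of larger rank, so the equations already
      solved survive. An incidence is its own inverse, which explains the factor in
      \<open>t\<close>.\<close>
    define P where "P \<sigma> \<tau> \<longleftrightarrow> (\<sigma>, \<tau>) \<in> M \<and> m = \<mu> \<tau> + Suc j" for \<sigma> \<tau>
    define t where "t \<sigma> = (if \<exists>\<tau>. P \<sigma> \<tau> then
        let \<tau> = (THE \<tau>. P \<sigma> \<tau>) in of_int (incidence r \<sigma> \<tau>) * (z \<tau> - bd s \<tau>) else 0)" for \<sigma>
    have t: "t \<sigma> = of_int (incidence r \<sigma> \<tau>) * (z \<tau> - bd s \<tau>)" if "P \<sigma> \<tau>" for \<sigma> \<tau>
    proof -
      have "(THE \<tau>. P \<sigma> \<tau>) = \<tau>"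
        using that M_fun unfolding P_def by (intro the_equality) blast+
      then show ?thesis using that by (auto simp: t_def)
    qed
    have t0: "\<exists>\<tau>. P \<sigma> \<tau>" if "t \<sigma> \<noteq> 0" for \<sigma> using that by (auto simp: t_def split: if_splits)
    have bdt: "bd t \<tau> = (if m = \<mu> \<tau> + Suc j then z \<tau> - bd s \<tau> else 0)"
      if M: "(\<sigma>, \<tau>) \<in> M" and j: "m \<le> \<mu> \<tau> + Suc j" for \<sigma> \<tau>
    proof -
      have other: "t \<sigma>' * of_int (incidence r \<sigma>' \<tau>) = 0" if "\<sigma>' \<noteq> \<sigma>" for \<sigma>'
      proof (rule ccontr)
        assume *: "t \<sigma>' * of_int (incidence r \<sigma>' \<tau>) \<noteq> 0"
        then have "t \<sigma>' \<noteq> 0" and f: "facet \<sigma>' \<tau>" using incidence_not_facet by fastforce+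
        then obtain \<tau>' where \<tau>': "(\<sigma>', \<tau>') \<in> M" "m = \<mu> \<tau>' + Suc j" using t0 P_def by blast
        have "\<tau>' \<noteq> \<tau>" using M_inj M \<tau>' that by blast
        then have "\<mu> \<tau> < \<mu> \<tau>'" using M_less[OF \<tau>'(1) f] M by blast
        then show False using \<tau>' j by simp
      qed
      have "bd t \<tau> = (\<Sum>\<sigma>'\<in>{\<sigma>}. t \<sigma>' * of_int (incidence r \<sigma>' \<tau>))"
        unfolding bd_def using other M_sub[OF M]
        by (intro sum.mono_neutral_right) (auto simp: fin)
      then have *: "bd t \<tau> = t \<sigma> * of_int (incidence r \<sigma> \<tau>)" by simp
      show ?thesis
      proof (cases "m = \<mu> \<tau> + Suc j")
        case True
        then have "t \<sigma> = of_int (incidence r \<sigma> \<tau>) * (z \<tau> - bd s \<tau>)" using M by (intro t) (simp add: P_def)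
        then have "bd t \<tau> = of_int (incidence r \<sigma> \<tau> * incidence r \<sigma> \<tau>) * (z \<tau> - bd s \<tau>)"
          unfolding * by (simp add: mult_ac)
        then show ?thesis using True by (simp add: incidence_mult_self[OF M_facet[OF M]])
      next
        case False
        then have "t \<sigma> = 0" using t0[of \<sigma>] M_fun[OF M] unfolding P_def by blast
        then show ?thesis using * False by simp
      qed
    qed
    show ?case
    proof (intro exI[of _ "\<lambda>\<sigma>. s \<sigma> + t \<sigma>"] conjI allI impI)
      fix \<sigma> assume "s \<sigma> + t \<sigma> \<noteq> 0"
      then have "s \<sigma> \<noteq> 0 \<or> t \<sigma> \<noteq> 0" by auto
      then show "\<exists>\<tau>. (\<sigma>, \<tau>) \<in> M" using s(1) t0 P_def by blast
    next
      fix \<sigma> \<tau> assume M: "(\<sigma>, \<tau>) \<in> M" and j: "m \<le> \<mu> \<tau> + Suc j"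
      have "bd (\<lambda>\<sigma>. s \<sigma> + t \<sigma>) \<tau> = bd s \<tau> + bd t \<tau>"
        by (simp add: bd_def distrib_right sum.distrib)
      then show "bd (\<lambda>\<sigma>. s \<sigma> + t \<sigma>) \<tau> = z \<tau>"
        using bdt[OF M j] s(2)[OF M] j by (auto split: if_splits)
    qed
  qed
  from this[of m] show ?thesis using that by auto
qed

end

text \<open>The properties of the path sums that the exactness proof needs, without the paths. By
  \<open>vanish\<close> they determine \<open>g\<close> for critical \<open>s\<close>; in this form
  one \<open>g\<close> can serve a matching and its restrictions.\<close>

locale morse_flow = morse_matching +
  fixes g :: "cell \<Rightarrow> cell \<Rightarrow> int"
  assumes g_crit: "crit c \<Longrightarrow> crit s \<Longrightarrow> g c s = (if c = s then 1 else 0)"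
    and g_source: "(\<sigma>, \<tau>) \<in> M \<Longrightarrow> crit s \<Longrightarrow> g \<sigma> s = 0"
    and g_bd: "(\<sigma>, \<tau>) \<in> M \<Longrightarrow> crit s \<Longrightarrow> (\<Sum>c | facet \<sigma> c. incidence r \<sigma> c * g c s) = 0"
    and g_card: "g c s \<noteq> 0 \<Longrightarrow> card c = card s"
begin

text \<open>The Morse differential with constant coefficients: boundary first, flow second. The
  resolution attaches a monomial to these integers.\<close>

definition mdiff :: "cell \<Rightarrow> cell \<Rightarrow> int" where
  "mdiff \<sigma> s = (\<Sum>c | facet \<sigma> c. incidence r \<sigma> c * g c s)"

lemma mdiff_card:
  assumes "mdiff \<sigma> s \<noteq> 0"
  shows "card \<sigma> = Suc (card s)"
proof -
  obtain c where "c \<in> {c. facet \<sigma> c}" "incidence r \<sigma> c * g c s \<noteq> 0"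
    using assms unfolding mdiff_def by (rule sum.not_neutral_contains_not_neutral)
  then show ?thesis using g_card[of c s] by (auto simp: facet_def)
qed

lemma bd_mdiff:
  assumes "\<sigma> \<subseteq> H"
  shows "(\<Sum>c | facet \<sigma> c. incidence r \<sigma> c * mdiff c s) = 0"
proof -
  have inner: "mdiff c s = (\<Sum>e\<in>Pow H. incidence r c e * g e s)" if "c \<subseteq> H" for c
    using sum_facets_Pow[OF that, of "\<lambda>e. g e s"] by (simp add: mdiff_def)
  have "(\<Sum>c | facet \<sigma> c. incidence r \<sigma> c * mdiff c s)
    = (\<Sum>c | facet \<sigma> c. \<Sum>e\<in>Pow H. incidence r \<sigma> c * incidence r c e * g e s)"
    using assms facet_sub by (intro sum.cong) (auto simp: inner sum_distrib_left mult_ac)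
  also have "\<dots> = (\<Sum>e\<in>Pow H. (\<Sum>c | facet \<sigma> c. incidence r \<sigma> c * incidence r c e) * g e s)"
    by (subst sum.swap) (simp add: sum_distrib_right)
  also have "\<dots> = 0" by (simp add: facets_square[OF assms])
  finally show ?thesis .
qed

text \<open>The flow is a chain map. The difference of both sides satisfies the three conditions of
  \<open>vanish\<close>: the flow is the identity on critical cells, both sides are zero on sources,
  and on the boundary of a source one side dies by \<open>g_bd\<close>, the other because a boundary
  has no boundary.\<close>

lemma flow_mdiff:
  assumes "crit s" "c \<subseteq> H"
  shows "(\<Sum>c' | crit c'. g c c' * mdiff c' s) = mdiff c s"
proof -
  define E where "E c = (\<Sum>c' | crit c'. g c c' * mdiff c' s) - mdiff c s" for c
  have "E c = 0"
  proof (rule vanish[OF _ _ _ assms(2)])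
    fix c assume c: "crit c"
    have "(\<Sum>c' | crit c'. g c c' * mdiff c' s) = (\<Sum>c'\<in>{c}. g c c' * mdiff c' s)"
      using c by (intro sum.mono_neutral_right) (auto simp: finite_crit g_crit)
    then show "E c = 0" using c by (simp add: E_def g_crit)
  next
    fix \<sigma> \<tau> assume M: "(\<sigma>, \<tau>) \<in> M"
    show "E \<sigma> = 0" using g_bd[OF M assms(1)] g_source[OF M] by (simp add: E_def mdiff_def)
    have "(\<Sum>c | facet \<sigma> c. incidence r \<sigma> c * (\<Sum>c' | crit c'. g c c' * mdiff c' s))
      = (\<Sum>c' | crit c'. (\<Sum>c | facet \<sigma> c. incidence r \<sigma> c * g c c') * mdiff c' s)"
      unfolding sum_distrib_left sum_distrib_right by (subst sum.swap) (simp add: mult_ac)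
    also have "\<dots> = 0" using g_bd[OF M] by simp
    finally show "(\<Sum>c | facet \<sigma> c. incidence r \<sigma> c * E c) = 0"
      using bd_mdiff[OF M_sub[OF M], of s] by (simp add: E_def right_diff_distrib sum_subtractf)
  qed
  then show ?thesis by (simp add: E_def)
qed

lemma mdiff_mdiff:
  assumes "crit s" "c \<subseteq> H"
  shows "(\<Sum>c' | crit c'. mdiff c c' * mdiff c' s) = 0"
proof -
  have "(\<Sum>c' | crit c'. mdiff c c' * mdiff c' s)
    = (\<Sum>e | facet c e. incidence r c e * (\<Sum>c' | crit c'. g e c' * mdiff c' s))"
    unfolding mdiff_def[of c] sum_distrib_right sum_distrib_left
    by (subst sum.swap) (simp add: mult_ac)
  also have "\<dots> = (\<Sum>e | facet c e. incidence r c e * mdiff e s)"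
    using assms facet_sub by (intro sum.cong) (auto simp: flow_mdiff)
  also have "\<dots> = 0" using bd_mdiff assms by simp
  finally show ?thesis .
qed

section \<open>Flow and Morse differential on chains\<close>

definition flow :: "(cell \<Rightarrow> 'k::comm_ring_1) \<Rightarrow> cell \<Rightarrow> 'k" where
  "flow \<phi> s = (\<Sum>c\<in>Pow H. \<phi> c * of_int (g c s))"

definition cdiff :: "(cell \<Rightarrow> 'k::comm_ring_1) \<Rightarrow> cell \<Rightarrow> 'k" where
  "cdiff \<phi> s = (\<Sum>c | crit c. \<phi> c * of_int (mdiff c s))"

lemma cdiff_cdiff:
  fixes \<phi> :: "cell \<Rightarrow> 'k::comm_ring_1"
  assumes "crit s"
  shows "cdiff (cdiff \<phi>) s = 0"
proof -
  have "cdiff (cdiff \<phi>) s = (\<Sum>c | crit c. \<phi> c * of_int (\<Sum>c' | crit c'. mdiff c c' * mdiff c' s))"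
    unfolding cdiff_def sum_distrib_right by (subst sum.swap) (simp add: sum_distrib_left mult_ac)
  also have "\<dots> = 0" using mdiff_mdiff[OF assms] by (simp add: crit_sub)
  finally show ?thesis .
qed

lemma flow_bd_eq_mdiff: "flow (bd \<phi>) s = (\<Sum>\<sigma>\<in>Pow H. \<phi> \<sigma> * of_int (mdiff \<sigma> s))"
proof -
  have "flow (bd \<phi>) s
    = (\<Sum>\<sigma>\<in>Pow H. \<phi> \<sigma> * (\<Sum>c\<in>Pow H. of_int (incidence r \<sigma> c) * of_int (g c s)))"
    unfolding flow_def bd_def sum_distrib_right
    by (subst sum.swap) (simp add: sum_distrib_left mult_ac)
  also have "\<dots> = (\<Sum>\<sigma>\<in>Pow H. \<phi> \<sigma> * of_int (mdiff \<sigma> s))"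
    by (intro sum.cong) (auto simp: sum_facets_Pow mdiff_def)
  finally show ?thesis .
qed

lemma flow_bd:
  fixes \<phi> :: "cell \<Rightarrow> 'k::comm_ring_1"
  assumes "crit s"
  shows "flow (bd \<phi>) s = cdiff (flow \<phi>) s"
proof -
  have "flow (bd \<phi>) s = (\<Sum>\<sigma>\<in>Pow H. \<phi> \<sigma> * of_int (\<Sum>c' | crit c'. g \<sigma> c' * mdiff c' s))"
    unfolding flow_bd_eq_mdiff using assms by (intro sum.cong) (auto simp: flow_mdiff)
  also have "\<dots> = cdiff (flow \<phi>) s"
    unfolding cdiff_def flow_def sum_distrib_right
    by (subst sum.swap) (simp add: sum_distrib_left mult_ac)
  finally show ?thesis .
qed

lemma flow_sources:
  assumes "\<And>\<sigma>. \<phi> \<sigma> \<noteq> 0 \<Longrightarrow> \<exists>\<tau>. (\<sigma>, \<tau>) \<in> M" "crit s"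
  shows "flow \<phi> s = 0"
  unfolding flow_def
proof (rule sum.neutral, rule ballI)
  fix c show "\<phi> c * of_int (g c s) = 0"
    using assms(1)[of c] g_source[OF _ assms(2), of c] by (cases "\<phi> c = 0") auto
qed

lemma flow_crit:
  assumes "\<And>\<sigma>. \<sigma> \<subseteq> H \<Longrightarrow> \<phi> \<sigma> \<noteq> 0 \<Longrightarrow> crit \<sigma> \<or> (\<exists>\<tau>. (\<sigma>, \<tau>) \<in> M)" "crit s"
  shows "flow \<phi> s = \<phi> s"
proof -
  have "flow \<phi> s = (\<Sum>c\<in>{s}. \<phi> c * of_int (g c s))"
    unfolding flow_def
  proof (rule sum.mono_neutral_right)
    show "\<forall>i\<in>Pow H - {s}. \<phi> i * of_int (g i s) = 0"
    proof
      fix c assume c: "c \<in> Pow H - {s}"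
      show "\<phi> c * of_int (g c s) = 0"
      proof (cases "\<phi> c = 0")
        case False
        then have "crit c \<or> (\<exists>\<tau>. (c, \<tau>) \<in> M)" using assms(1) c by blast
        then have "g c s = 0" using g_crit[OF _ assms(2), of c] g_source[OF _ assms(2), of c] c by auto
        then show ?thesis by simp
      qed simp
    qed
  qed (use assms crit_sub fin in auto)
  then show ?thesis using assms by (simp add: g_crit)
qed

text \<open>A cycle of critical cells is corrected by a chain \<open>s\<close> of sources to a cycle
  of the simplex, which bounds some \<open>y\<close>; the flow carries \<open>y\<close> back to
  critical cells. The flow kills \<open>s\<close>, so the correction leaves no trace.\<close>

theorem morse_exact:
  fixes \<phi> :: "cell \<Rightarrow> 'k::comm_ring_1"
  assumes ne: "H \<noteq> {}" and supp: "\<And>c. \<phi> c \<noteq> 0 \<Longrightarrow> crit c \<and> card c = k"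
    and ker: "\<And>s. crit s \<Longrightarrow> cdiff \<phi> s = 0"
  obtains \<psi> where "\<And>c. \<psi> c \<noteq> 0 \<Longrightarrow> crit c \<and> card c = Suc k"
    "\<And>s. crit s \<Longrightarrow> cdiff \<psi> s = \<phi> s"
proof -
  obtain s where s: "\<And>\<sigma>. s \<sigma> \<noteq> 0 \<Longrightarrow> \<exists>\<tau>. (\<sigma>, \<tau>) \<in> M"
    and sbd: "\<And>\<sigma> \<tau>. (\<sigma>, \<tau>) \<in> M \<Longrightarrow> bd s \<tau> = bd \<phi> \<tau>"
    using sources_eliminate[of "bd \<phi>"] by blast
  define x where "x \<tau> = (if \<tau> \<subseteq> H then bd (\<lambda>\<sigma>. \<phi> \<sigma> - s \<sigma>) \<tau> else 0)" for \<tau>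
  have flow_\<phi>: "flow \<phi> c = \<phi> c" if "crit c" for c
    using flow_crit supp that by blast
  have xH: "flow x c = flow (bd (\<lambda>\<sigma>. \<phi> \<sigma> - s \<sigma>)) c" for c
    unfolding flow_def x_def by (intro sum.cong) auto
  have bdx: "bd x c = bd (bd (\<lambda>\<sigma>. \<phi> \<sigma> - s \<sigma>)) c" for c
    unfolding bd_def[of x] bd_def[of "bd _"] x_def by (intro sum.cong) auto
  have x_tgt: "x \<tau> = 0" if "(\<sigma>, \<tau>) \<in> M" for \<sigma> \<tau>
    using sbd[OF that] by (simp add: x_def bd_diff)
  have flow_x: "flow x c = 0" if "crit c" for c
  proof -
    have "flow x c = cdiff (flow (\<lambda>\<sigma>. \<phi> \<sigma> - s \<sigma>)) c" using xH flow_bd[OF that] by simp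
    also have "\<dots> = cdiff \<phi> c"
    proof -
      have "flow (\<lambda>\<sigma>. \<phi> \<sigma> - s \<sigma>) c' = \<phi> c'" if "crit c'" for c'
      proof -
        have "flow (\<lambda>\<sigma>. \<phi> \<sigma> - s \<sigma>) c' = flow \<phi> c' - flow s c'"
          by (simp add: flow_def left_diff_distrib sum_subtractf)
        then show ?thesis using flow_sources[of s c'] flow_\<phi> s that by simp
      qed
      then show ?thesis unfolding cdiff_def by (intro sum.cong) auto
    qed
    also have "\<dots> = 0" by (rule ker[OF that])
    finally show ?thesis .
  qed
  have x_cs: "crit \<sigma> \<or> (\<exists>\<tau>. (\<sigma>, \<tau>) \<in> M)" if "x \<sigma> \<noteq> 0" for \<sigma>
  proof -
    have "\<sigma> \<subseteq> H" using that by (auto simp: x_def split: if_splits)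
    then show ?thesis using that x_tgt by (cases rule: cell_cases) auto
  qed
  \<comment> \<open>\<open>x\<close> has no targets in its support, so its flow reads off its
    critical coefficients, and this flow is zero. Only sources remain, and as a boundary
    \<open>x\<close> is a cycle, so \<open>sources_inject\<close> gives
    \<open>x = 0\<close>.\<close>
  have "x c = 0" if "crit c" for c
    using flow_crit[of x c] x_cs that flow_x by auto
  then have x_src: "\<exists>\<tau>. (\<sigma>, \<tau>) \<in> M" if "x \<sigma> \<noteq> 0" for \<sigma> using x_cs that by blast
  have "x \<sigma> = 0" for \<sigma>
    by (rule sources_inject[OF x_src]) (auto simp: bdx bd_bd)
  then have cyc: "bd (\<lambda>\<sigma>. \<phi> \<sigma> - s \<sigma>) \<tau> = 0" if "\<tau> \<subseteq> H" for \<tau>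
    using that unfolding x_def by meson
  obtain y where y: "\<And>\<tau>. \<tau> \<subseteq> H \<Longrightarrow> bd y \<tau> = \<phi> \<tau> - s \<tau>"
    using simplex_exact[OF ne cyc] by blast
  \<comment> \<open>\<open>y\<close> may have components of every cardinality. \<open>mdiff\<close>
    lowers the cardinality by one, so the cut changes nothing at critical cells of cardinality
    \<open>k\<close>; at all others both sides are zero.\<close>
  define \<psi> where "\<psi> c = (if crit c \<and> card c = Suc k then flow y c else 0)" for c
  have "cdiff \<psi> c = \<phi> c" if c: "crit c" for c
  proof (cases "card c = k")
    case True
    have "cdiff \<psi> c = cdiff (flow y) c"
      unfolding cdiff_def
    proof (rule sum.cong)
      fix c' assume "c' \<in> {c'. crit c'}"
      then show "\<psi> c' * of_int (mdiff c' c) = flow y c' * of_int (mdiff c' c)"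
        using mdiff_card[of c' c] True by (cases "mdiff c' c = 0") (auto simp: \<psi>_def)
    qed simp
    also have "\<dots> = flow (bd y) c" by (rule flow_bd[OF c, symmetric])
    also have "\<dots> = flow \<phi> c - flow s c"
    proof -
      have "flow (bd y) c = (\<Sum>c'\<in>Pow H. (\<phi> c' - s c') * of_int (g c' c))"
        unfolding flow_def using y by (intro sum.cong) auto
      then show ?thesis by (simp add: flow_def left_diff_distrib sum_subtractf)
    qed
    also have "\<dots> = \<phi> c" using flow_sources[of s c] flow_\<phi> s c by simp
    finally show ?thesis .
  next
    case False
    then have "\<phi> c = 0" using supp by blast
    moreover have "cdiff \<psi> c = 0" unfolding cdiff_def
    proof (rule sum.neutral, rule ballI)
      fix c' show "\<psi> c' * of_int (mdiff c' c) = 0"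
        using mdiff_card[of c' c] False by (cases "mdiff c' c = 0") (auto simp: \<psi>_def)
    qed
    ultimately show ?thesis by simp
  qed
  moreover have "crit c \<and> card c = Suc k" if "\<psi> c \<noteq> 0" for c
    using that by (auto simp: \<psi>_def split: if_splits)
  ultimately show ?thesis using that by blast
qed

end

section \<open>Gradient paths\<close>


context morse_matching
begin

text \<open>The start and the distinctness are left out so that walks can be analysed by induction
  on tails. Distinctness is recovered from the rank when a path is extended.\<close>

definition walk :: "cell list \<Rightarrow> cell \<Rightarrow> bool" where
  "walk P s \<longleftrightarrow> P \<noteq> [] \<and> last P = s \<and> set P \<subseteq> Pow H \<and>
    successively (\<lambda>a b. (a, b) \<in> morse_graph H M) P"

lemma gradient_paths_eq: "gradient_paths H M c s = {P. walk P s \<and> hd P = c \<and> distinct P}"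
  by (auto simp: gradient_paths_def walk_def)

lemma walk_single [simp]: "walk [a] s \<longleftrightarrow> a = s \<and> a \<subseteq> H"
  by (auto simp: walk_def)

lemma walk_Cons2 [simp]:
  "walk (a # b # P) s \<longleftrightarrow> a \<subseteq> H \<and> (a, b) \<in> morse_graph H M \<and> walk (b # P) s"
  by (auto simp: walk_def)

lemma not_walk_Nil [simp]: "\<not> walk [] s"
  by (simp add: walk_def)

lemma morse_graph_iff:
  "(a, b) \<in> morse_graph H M \<longleftrightarrow> a \<subseteq> H \<and> facet a b \<and> (a, b) \<notin> M \<or> (b, a) \<in> M"
  by (auto simp: morse_graph_def)

lemma walk_up:
  assumes "walk (a # b # P) s" "(b, a) \<in> M" "crit s"
  obtains d P' where "P = d # P'" "facet b d" "d \<noteq> a" "walk P s"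
proof (cases P)
  case Nil
  then show ?thesis using assms by (auto simp: critical_def)
next
  case (Cons d P')
  then have "(b, d) \<in> morse_graph H M" "walk P s" using assms by auto
  moreover have "(d, b) \<notin> M" using M_alt assms(2) by blast
  ultimately show ?thesis using that[of d P'] Cons assms(2) by (auto simp: morse_graph_iff)
qed

text \<open>A step up ends in a source, which is never a target, and a critical cell cannot be the
  end of a matched edge; so every step up is followed by a step down and no cardinality is
  gained.\<close>

lemma walk_card_ge:
  assumes "crit s"
  shows "walk P s \<Longrightarrow> card s \<le> card (hd P)"
proof (induction P rule: induct_list012)
  case (3 a b P)
  show ?case
  proof (cases "(b, a) \<in> M")
    case True
    then obtain d P' where "P = d # P'" "facet b d" "walk P s"
      using walk_up[OF 3(3) True assms] by blast
    then show ?thesis using 3(1) M_facet[OF True] by (simp add: facet_def)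
  next
    case False
    then have "facet a b" using 3(3) by (auto simp: morse_graph_iff)
    then show ?thesis using 3 by (simp add: facet_def)
  qed
qed auto

text \<open>With equal cardinality at both ends, a step down from the start would lose one element
  for good. The walk is therefore a zigzag of matched steps up and steps down to a different
  facet.\<close>

lemma walk_cases [consumes 3, case_names single step]:
  assumes "walk P s" "crit s" "card (hd P) = card s"
  obtains "P = [s]" | c \<sigma> d P' where "P = c # \<sigma> # d # P'" "(\<sigma>, c) \<in> M" "facet \<sigma> d" "d \<noteq> c"
    "walk (d # P') s" "card d = card s"
proof (cases P rule: remdups_adj.cases)
  case 2
  then show ?thesis using assms that by auto
next
  case (3 a b P')
  have "(b, a) \<in> M"
  proof (rule ccontr)
    assume "(b, a) \<notin> M"
    then have "facet a b" using assms 3 by (auto simp: morse_graph_iff)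
    moreover have "card s \<le> card b" using walk_card_ge[OF assms(2), of "b # P'"] assms 3 by auto
    ultimately show False using assms 3 by (auto simp: facet_def)
  qed
  moreover from this obtain d Q where "P' = d # Q" "facet b d" "d \<noteq> a" "walk P' s"
    using walk_up[of a b P' s] assms 3 by auto
  ultimately show ?thesis using that(2)[of a b d Q] 3 M_facet[of b a] assms by (auto simp: facet_def)
qed (use assms in auto)

text \<open>This shows that prepending a matched pair keeps a path distinct: every pair that the
  path meets has rank at most that of its start, and the start has smaller rank than the new
  target.\<close>

lemma walk_bound:
  assumes "crit s"
  shows "walk P s \<Longrightarrow> card (hd P) = card s \<Longrightarrow> (\<sigma>', hd P) \<in> M \<Longrightarrow> (\<sigma>, \<tau>) \<in> M \<Longrightarrow>
    \<sigma> \<in> set P \<or> \<tau> \<in> set P \<Longrightarrow> \<mu> \<tau> \<le> \<mu> (hd P)"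
proof (induction P arbitrary: \<sigma>' rule: length_induct)
  case (1 P)
  from 1(2) assms 1(3) show ?case
  proof (cases rule: walk_cases)
    case single
    then show ?thesis using assms \<open>(\<sigma>', hd P) \<in> M\<close> by (simp add: critical_def)
  next
    case (step c \<rho> d P')
    note 2 = step
    show ?thesis
    proof (cases "\<sigma> \<in> {c, \<rho>} \<or> \<tau> \<in> {c, \<rho>}")
      case True
      then have "\<tau> = c" using 2(2) \<open>(\<sigma>, \<tau>) \<in> M\<close> M_alt M_fun by blast
      then show ?thesis using 2 by simp
    next
      case False
      then have mem: "\<sigma> \<in> set (d # P') \<or> \<tau> \<in> set (d # P')" using 1(6) 2 by auto
      have "d \<subseteq> H" using 2(5) by (simp add: walk_def)
      then have "\<mu> \<tau> \<le> \<mu> d \<and> \<mu> d < \<mu> c"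
      proof (cases rule: cell_cases)
        case 1
        have "card (hd (d # P')) = card s" by (simp add: step(6))
        with 2(5) assms have "d # P' = [s]"
        proof (cases rule: walk_cases)
          case (step c')
          then show ?thesis using 1 by (auto simp: critical_def)
        qed
        then show ?thesis using mem assms \<open>(\<sigma>, \<tau>) \<in> M\<close> by (auto simp: critical_def)
      next
        case (2 \<tau>')
        have "card (hd (d # P')) = card s" by (simp add: step(6))
        with step(5) assms have False
        proof (cases rule: walk_cases)
          case single
          then show ?thesis using 2 assms by (simp add: critical_def)
        next
          case (step c')
          then show ?thesis using 2 M_alt by auto
        qed
        then show ?thesis ..
      next
        case (3 \<sigma>'')
        have "\<mu> \<tau> \<le> \<mu> (hd (d # P'))"
          using 1(1)[rule_format, of "d # P'" \<sigma>''] 2 3 \<open>(\<sigma>, \<tau>) \<in> M\<close> mem by simp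
        moreover have "\<mu> d < \<mu> c" using M_less 2 3 by blast
        ultimately show ?thesis by simp
      qed
      then show ?thesis using 2(1) by simp
    qed
  qed
qed

text \<open>Paths in the modified graph may also lose cardinality. The differential uses only those
  from facets of a cell to critical cells of the same cardinality, and \<open>g_card\<close> demands
  the cut.\<close>

definition pflow :: "cell \<Rightarrow> cell \<Rightarrow> int" where
  "pflow c s =
    (if card c = card s then \<Sum>P\<in>gradient_paths H M c s. path_weight r M P else 0)"

lemma finite_gradient_paths: "finite (gradient_paths H M c s)"
proof (rule finite_subset)
  show "gradient_paths H M c s \<subseteq> {P. set P \<subseteq> Pow H \<and> distinct P}"
    by (auto simp: gradient_paths_def)
qed (simp add: fin finite_subset_distinct)

lemma gradient_paths_crit:
  assumes "crit c" "crit s" "card c = card s"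
  shows "gradient_paths H M c s = (if c = s then {[s]} else {})"
proof -
  have "P = [s] \<and> c = s" if "walk P s" "hd P = c" for P
  proof -
    have "card (hd P) = card s" using assms(3) that(2) by simp
    with that(1) assms(2) have "P = [s]"
    proof (cases rule: walk_cases)
      case (step c')
      then show ?thesis using assms(1) that(2) by (auto simp: critical_def)
    qed
    then show ?thesis using that by simp
  qed
  then show ?thesis using crit_sub[OF assms(1)] by (auto simp: gradient_paths_eq)
qed

lemma gradient_paths_source:
  assumes "(c, \<tau>) \<in> M" "crit s" "card c = card s"
  shows "gradient_paths H M c s = {}"
proof -
  have False if "walk P s" "hd P = c" for P
  proof -
    have "card (hd P) = card s" using assms(3) that(2) by simp
    from that(1) assms(2) this show False
    proof (cases rule: walk_cases)
      case single
      then show ?thesis using assms that(2) by (auto simp: critical_def)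
    next
      case (step c' \<sigma> d P')
      then show ?thesis using M_alt[OF step(2)] assms(1) that(2) by simp
    qed
  qed
  then show ?thesis by (auto simp: gradient_paths_eq)
qed

lemma gradient_paths_target:
  assumes M: "(\<sigma>, c) \<in> M" and s: "crit s" "card c = card s"
  shows "gradient_paths H M c s =
    (\<lambda>P. c # \<sigma> # P) ` (\<Union>d\<in>{d. facet \<sigma> d} - {c}. gradient_paths H M d s)"
    (is "?L = ?R")
proof
  show "?L \<subseteq> ?R"
  proof
    fix P assume P: "P \<in> ?L"
    then have "walk P s" "hd P = c" "distinct P" by (auto simp: gradient_paths_eq)
    then have "card (hd P) = card s" using s by simp
    with \<open>walk P s\<close> s(1) show "P \<in> ?R"
    proof (cases rule: walk_cases)
      case single
      then show ?thesis using M s(1) \<open>hd P = c\<close> by (simp add: critical_def)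
    next
      case (step c' \<sigma>' d P')
      note 2 = step
      then have "c' = c" "\<sigma>' = \<sigma>" using \<open>hd P = c\<close> M M_inj by auto
      then have "P = c # \<sigma> # (d # P')" "d # P' \<in> gradient_paths H M d s" "facet \<sigma> d" "d \<noteq> c"
        using 2 \<open>distinct P\<close> by (auto simp: gradient_paths_eq)
      then show ?thesis by blast
    qed
  qed
next
  show "?R \<subseteq> ?L"
  proof
    fix Q assume "Q \<in> ?R"
    then obtain d P where d: "facet \<sigma> d" "d \<noteq> c" and P: "P \<in> gradient_paths H M d s"
      and Q: "Q = c # \<sigma> # P" by auto
    then obtain P' where w: "walk P s" and dP: "hd P = d" "distinct P" "P = d # P'"
      by (cases P) (auto simp: gradient_paths_eq)
    have sub: "\<sigma> \<subseteq> H" "c \<subseteq> H" "d \<subseteq> H" using M_sub[OF M] M_sub2[OF M] d facet_sub by auto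
    have cd: "card d = card s" using d M_facet[OF M] s by (simp add: facet_def)
    have "(\<sigma>, d) \<notin> M" using d M_fun[OF M] by blast
    then have "walk Q s"
      unfolding Q dP(3) using w dP sub M d by (auto simp: morse_graph_iff)
    \<comment> \<open>The rest of the path starts at a critical cell, where it also ends, or at a
      target of rank below that of \<open>c\<close>; in neither case does it come back to the pair.
      From a source no such path starts.\<close>
    moreover have "c \<notin> set P \<and> \<sigma> \<notin> set P"
      using sub(3)
    proof (cases rule: cell_cases)
      case 1
      then have "P = [s]" using P gradient_paths_crit[OF 1 s(1) cd] by (auto split: if_splits)
      then show ?thesis using s(1) M by (auto simp: critical_def)
    next
      case (2 \<tau>)
      then show ?thesis using P gradient_paths_source[OF 2 s(1) cd] by auto
    next
      case (3 \<sigma>')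
      then have "\<mu> d < \<mu> c" using M_less[OF M] d by blast
      then show ?thesis using walk_bound[OF s(1) w _ _ M] dP cd 3 by force
    qed
    moreover have "c \<noteq> \<sigma>" using M M_alt by blast
    ultimately show "Q \<in> ?L" using Q dP by (auto simp: gradient_paths_eq)
  qed
qed

lemma path_weight_Cons2:
  "path_weight r M (c # \<sigma> # d # P) =
    edge_weight r M c \<sigma> * edge_weight r M \<sigma> d * path_weight r M (d # P)"
  by (simp add: path_weight_def mult.assoc)

text \<open>This is the equation that the flow of the boundary of \<open>\<sigma>\<close> is zero,
  solved for the term at \<open>c\<close>. The minus sign in the weight of a reversed edge is
  exactly what this requires.\<close>

lemma pflow_target:
  assumes M: "(\<sigma>, c) \<in> M" and s: "crit s"
  shows "pflow c s = (\<Sum>d\<in>{d. facet \<sigma> d} - {c}. - incidence r \<sigma> c * incidence r \<sigma> d * pflow d s)"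
proof (cases "card c = card s")
  case False
  have "card d \<noteq> card s" if "facet \<sigma> d" for d
    using that M_facet[OF M] False by (simp add: facet_def)
  then show ?thesis using False by (simp add: pflow_def)
next
  case True
  let ?D = "{d. facet \<sigma> d} - {c}"
  let ?G = "\<lambda>d. gradient_paths H M d s"
  have fD: "finite ?D" using fin_sub[OF M_sub[OF M]] by (simp add: finite_facets)
  have "pflow c s = (\<Sum>P\<in>(\<Union>d\<in>?D. ?G d). path_weight r M (c # \<sigma> # P))"
    using True by (simp add: pflow_def gradient_paths_target[OF M s True] sum.reindex inj_on_def)
  also have "\<dots> = (\<Sum>d\<in>?D. \<Sum>P\<in>?G d. path_weight r M (c # \<sigma> # P))"
    by (rule sum.UNION_disjoint[OF fD]) (intro ballI finite_gradient_paths, auto simp: gradient_paths_eq)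
  also have "\<dots> = (\<Sum>d\<in>?D. - incidence r \<sigma> c * incidence r \<sigma> d * pflow d s)"
  proof (rule sum.cong)
    fix d assume d: "d \<in> ?D"
    have "path_weight r M (c # \<sigma> # P) = - incidence r \<sigma> c * incidence r \<sigma> d * path_weight r M P"
      if P: "P \<in> ?G d" for P
    proof -
      obtain P' where "P = d # P'" using P by (cases P) (auto simp: gradient_paths_def)
      moreover have "(d, \<sigma>) \<notin> M" using M M_alt by blast
      ultimately show ?thesis using M by (simp add: path_weight_Cons2 edge_weight_def)
    qed
    moreover have "card d = card s" using d M_facet[OF M] True by (simp add: facet_def)
    ultimately show "(\<Sum>P\<in>?G d. path_weight r M (c # \<sigma> # P))
        = - incidence r \<sigma> c * incidence r \<sigma> d * pflow d s"
      by (simp add: pflow_def sum_distrib_left)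
  qed simp
  finally show ?thesis .
qed

lemma morse_flow_pflow: "morse_flow H r M \<mu> pflow"
proof unfold_locales
  fix c s assume "crit c" "crit s"
  then show "pflow c s = (if c = s then 1 else 0)"
    by (auto simp: pflow_def gradient_paths_crit path_weight_def)
next
  fix \<sigma> \<tau> s assume "(\<sigma>, \<tau>) \<in> M" "crit s"
  then show "pflow \<sigma> s = 0" by (simp add: pflow_def gradient_paths_source)
next
  fix \<sigma> c s assume M: "(\<sigma>, c) \<in> M" and s: "crit s"
  let ?D = "{d. facet \<sigma> d} - {c}"
  let ?S = "\<Sum>d\<in>?D. incidence r \<sigma> d * pflow d s"
  have "pflow c s = - incidence r \<sigma> c * ?S"
    unfolding pflow_target[OF M s] sum_distrib_left by (simp add: mult.assoc)
  then have "incidence r \<sigma> c * pflow c s = - (incidence r \<sigma> c * incidence r \<sigma> c) * ?S" by simp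
  then have "incidence r \<sigma> c * pflow c s = - ?S"
    by (simp add: incidence_mult_self[OF M_facet[OF M]])
  moreover have "(\<Sum>d | facet \<sigma> d. incidence r \<sigma> d * pflow d s) = incidence r \<sigma> c * pflow c s + ?S"
    using fin_sub[OF M_sub[OF M]] M_facet[OF M] by (intro sum.remove) (auto simp: finite_facets)
  ultimately show "(\<Sum>d | facet \<sigma> d. incidence r \<sigma> d * pflow d s) = 0" by simp
next
  fix c s assume "pflow c s \<noteq> 0"
  then show "card c = card s" by (auto simp: pflow_def split: if_splits)
qed

section \<open>Restriction to a subset of the vertices\<close>

lemma morse_matching_restrict:
  assumes "K \<subseteq> H"
  shows "morse_matching K r (M \<inter> Pow K \<times> Pow K) \<mu>"
proof
  show "finite K" using assms fin finite_subset by blast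
  show "total_on K r" "refl_on K r" using assms total refl by (auto simp: total_on_def refl_on_def)
  show "antisym r" "trans r" by (fact antisym, fact trans)
  fix \<sigma> \<tau> assume *: "(\<sigma>, \<tau>) \<in> M \<inter> Pow K \<times> Pow K"
  then have M: "(\<sigma>, \<tau>) \<in> M" by simp
  show "\<sigma> \<subseteq> K" using * by simp
  show "facet \<sigma> \<tau>" by (rule M_facet[OF M])
  show "\<tau> = \<tau>'" if "(\<sigma>, \<tau>') \<in> M \<inter> Pow K \<times> Pow K" for \<tau>' using M_fun[OF M] that by simp
  show "\<sigma> = \<sigma>'" if "(\<sigma>', \<tau>) \<in> M \<inter> Pow K \<times> Pow K" for \<sigma>' using M_inj[OF M] that by simp
  show "(\<tau>, \<tau>') \<notin> M \<inter> Pow K \<times> Pow K" for \<tau>' using M_alt[OF M] by simp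
  show "\<mu> \<tau>' < \<mu> \<tau>" if "facet \<sigma> \<tau>'" "\<tau>' \<noteq> \<tau>" "(\<sigma>', \<tau>') \<in> M \<inter> Pow K \<times> Pow K" for \<sigma>' \<tau>'
    using M_less[OF M that(1,2)] that(3) by blast
qed

text \<open>Sources in \<open>K\<close> bring their targets along, as these are smaller. The closure
  hypothesis is the converse; without it a target could lose its source and become critical in
  \<open>K\<close>.\<close>

lemma critical_restrict:
  assumes K: "K \<subseteq> H" and cl: "\<And>\<sigma> \<tau>. (\<sigma>, \<tau>) \<in> M \<Longrightarrow> \<tau> \<subseteq> K \<Longrightarrow> \<sigma> \<subseteq> K"
  shows "critical K (M \<inter> Pow K \<times> Pow K) s \<longleftrightarrow> crit s \<and> s \<subseteq> K"
proof -
  have "\<tau> \<subseteq> K" if "(s, \<tau>) \<in> M" "s \<subseteq> K" for \<tau>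
    using M_facet[OF that(1)] that(2) by (auto simp: facet_def)
  then show ?thesis using K cl unfolding critical_def by blast
qed

text \<open>The path sums of the whole simplex serve \<open>K\<close> unchanged, because each
  condition on \<open>K\<close> is an instance of the same condition on \<open>H\<close>. Paths
  inside \<open>K\<close> are never considered.\<close>

lemma morse_flow_restrict:
  assumes K: "K \<subseteq> H" and cl: "\<And>\<sigma> \<tau>. (\<sigma>, \<tau>) \<in> M \<Longrightarrow> \<tau> \<subseteq> K \<Longrightarrow> \<sigma> \<subseteq> K"
  shows "morse_flow K r (M \<inter> Pow K \<times> Pow K) \<mu> pflow"
proof -
  interpret K: morse_matching K r "M \<inter> Pow K \<times> Pow K" \<mu> by (rule morse_matching_restrict[OF K])
  interpret F: morse_flow H r M \<mu> pflow by (rule morse_flow_pflow)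
  show ?thesis
    by unfold_locales (use F.g_crit F.g_source F.g_bd F.g_card in \<open>auto simp: critical_restrict[OF K cl]\<close>)
qed

text \<open>For a fixed critical \<open>s\<close> outside \<open>K\<close>, the function
  \<open>c \<mapsto> pflow c s\<close> satisfies the conditions of \<open>vanish\<close> on
  \<open>K\<close>: no critical cell of \<open>K\<close> equals \<open>s\<close>.\<close>

lemma pflow_sub:
  assumes K: "K \<subseteq> H" and cl: "\<And>\<sigma> \<tau>. (\<sigma>, \<tau>) \<in> M \<Longrightarrow> \<tau> \<subseteq> K \<Longrightarrow> \<sigma> \<subseteq> K"
    and s: "crit s" and c: "c \<subseteq> K" "pflow c s \<noteq> 0"
  shows "s \<subseteq> K"
proof (rule ccontr)
  assume n: "\<not> s \<subseteq> K"
  interpret F: morse_flow H r M \<mu> pflow by (rule morse_flow_pflow)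
  interpret K: morse_matching K r "M \<inter> Pow K \<times> Pow K" \<mu> by (rule morse_matching_restrict[OF K])
  have "pflow c s = 0"
    by (rule K.vanish[OF _ _ _ c(1)])
      (use n s F.g_crit F.g_source F.g_bd in \<open>auto simp: critical_restrict[OF K cl]\<close>)
  then show False using c by simp
qed

end

section \<open>Path monomials and pivots\<close>


text \<open>The lcm of path monomials is squarefree; these are the indices of its variables.\<close>

definition cover :: "nat \<Rightarrow> nat set \<Rightarrow> nat set" where
  "cover p S = (\<Union>i\<in>S. {i..<i + p})"

lemma finite_cover: "finite S \<Longrightarrow> finite (cover p S)"
  by (simp add: cover_def)

text \<open>If the test fails at the maximum \<open>b\<close>, the only elements within distance
  \<open>p\<close> of \<open>b\<close> are \<open>b\<close> and possibly \<open>b - 1\<close>.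
  Neither is a bridge, and neither can be the upper neighbour of a bridge further below, so the scan
  may forget both.\<close>

function pivot :: "nat \<Rightarrow> nat set \<Rightarrow> nat option" where
  "pivot p S = (if finite S \<and> S \<noteq> {} then
     if \<exists>x\<in>S. x + 2 \<le> Max S \<and> Max S \<le> x + p then Some (Max S - 1)
     else pivot p {x \<in> S. x + p < Max S} else None)"
  by auto
termination
proof (relation "measure (\<lambda>(p, S). card S)")
  fix p :: nat and S :: "nat set"
  assume "finite S \<and> S \<noteq> {}"
  then have "Max S \<in> S" by simp
  moreover have "Max S \<notin> {x \<in> S. x + p < Max S}" by simp
  ultimately have "{x \<in> S. x + p < Max S} \<subset> S" by blast
  then show "((p, {x \<in> S. x + p < Max S}), p, S) \<in> measure (\<lambda>(p, S). card S)"
    using \<open>finite S \<and> S \<noteq> {}\<close> by (simp add: psubset_card_mono)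
qed simp

declare pivot.simps [simp del]

lemma pivot_empty [simp]: "pivot p {} = None"
  by (subst pivot.simps) simp

lemma
  assumes "finite S" "b \<in> S" "\<And>x. x \<in> S \<Longrightarrow> x \<le> b"
  shows pivot_found: "\<exists>x\<in>S. x + 2 \<le> b \<and> b \<le> x + p \<Longrightarrow> pivot p S = Some (b - 1)"
    and pivot_skip: "\<not> (\<exists>x\<in>S. x + 2 \<le> b \<and> b \<le> x + p) \<Longrightarrow>
      pivot p S = pivot p {x \<in> S. x + p < b}"
proof -
  have "Max S = b" using assms by (intro Max_eqI) auto
  moreover have "S \<noteq> {}" using assms(2) by auto
  ultimately show "\<exists>x\<in>S. x + 2 \<le> b \<and> b \<le> x + p \<Longrightarrow> pivot p S = Some (b - 1)"
    "\<not> (\<exists>x\<in>S. x + 2 \<le> b \<and> b \<le> x + p) \<Longrightarrow> pivot p S = pivot p {x \<in> S. x + p < b}"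
    using assms(1) by (simp_all only: pivot.simps[of p S] simp_thms if_True if_False)
qed

lemma finite_set_max_induct [consumes 1, case_names empty step]:
  fixes S :: "nat set"
  assumes "finite S" "P {}"
    "\<And>S b. finite S \<Longrightarrow> b \<in> S \<Longrightarrow> (\<And>x. x \<in> S \<Longrightarrow> x \<le> b) \<Longrightarrow>
      (\<And>T. T \<subseteq> S \<Longrightarrow> b \<notin> T \<Longrightarrow> P T) \<Longrightarrow> P S"
  shows "P S"
  using assms(1)
proof (induction "card S" arbitrary: S rule: less_induct)
  case less
  show ?case
  proof (cases "S = {}")
    case False
    show ?thesis
    proof (rule assms(3)[of S "Max S"])
      fix T assume "T \<subseteq> S" "Max S \<notin> T"
      moreover have "Max S \<in> S" using False less.prems by simp
      ultimately have "T \<subset> S" by blast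
      then show "P T" using less psubset_card_mono finite_subset by blast
    qed (use False less.prems in auto)
  qed (simp add: assms(2))
qed

text \<open>These neighbours make \<open>q\<close> a bridge as soon as it belongs to the set. They
  also enclose \<open>q\<close>, so inserting it does not leave the index range.\<close>

lemma pivot_neighbours:
  assumes "finite S" "pivot p S = Some q"
  obtains x where "x \<in> S" "x < q" "Suc q \<in> S" "Suc q \<le> x + p"
proof -
  have "pivot p S = Some q \<Longrightarrow> \<exists>x\<in>S. x < q \<and> Suc q \<in> S \<and> Suc q \<le> x + p"
    using assms(1)
  proof (induction S rule: finite_set_max_induct)
    case (step S b)
    show ?case
    proof (cases "\<exists>x\<in>S. x + 2 \<le> b \<and> b \<le> x + p")
      case True
      then obtain x where x: "x \<in> S" "x + 2 \<le> b" "b \<le> x + p" by blast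
      have "q = b - 1" using pivot_found[OF step(1-3) True] step(5) by simp
      then have "x < q" "Suc q = b" using x by auto
      then show ?thesis using x step(2) by metis
    next
      case False
      then have "pivot p {x \<in> S. x + p < b} = Some q"
        using pivot_skip[OF step(1-3) False] step(5) by simp
      then show ?thesis using step(4)[of "{x \<in> S. x + p < b}"] by auto
    qed
  qed simp
  then show ?thesis using that assms(2) by blast
qed

text \<open>For \<open>a \<in> S\<close> the hypothesis says that \<open>a\<close> is a bridge, so the pivot is an upper bound for all
  bridges.\<close>

lemma bridge_le_pivot:
  assumes "finite S" "x \<in> S" "a \<in> S" "y \<in> S" "x < a" "a < y" "y \<le> x + p"
  obtains q where "pivot p S = Some q" "a \<le> q"
proof -
  have "\<lbrakk>x \<in> S; a \<in> S; y \<in> S\<rbrakk> \<Longrightarrow> \<exists>q. pivot p S = Some q \<and> a \<le> q"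
    using assms(1)
  proof (induction S rule: finite_set_max_induct)
    case (step S b)
    show ?case
    proof (cases "\<exists>x\<in>S. x + 2 \<le> b \<and> b \<le> x + p")
      case True
      have "y \<le> b" using step by blast
      then have "a \<le> b - 1" using assms by simp
      then show ?thesis using pivot_found[OF step(1-3) True] by simp
    next
      case False
      have far: "z + p < b" if "z \<in> S" "z + 2 \<le> b" for z
        using False that by (meson not_le)
      have "y \<le> b" using step by blast
      \<comment> \<open>As the test failed at \<open>b\<close>, an element at distance at least 2
        from \<open>b\<close> has distance more than \<open>p\<close>. This is applied to
        \<open>x\<close>, \<open>a\<close> and \<open>y\<close> in turn, each bound giving the
        distance 2 that the next one needs; so all three survive into the remaining set.\<close>
      then have "x + p < b" using far[of x] step(5) assms(5,6) by linarith
      then have "a + p < b" using far[of a] step(6) assms(6,7) by linarith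
      then have "y + p < b" using far[of y] step(7) assms(5,7) by linarith
      then have "\<exists>q. pivot p {x \<in> S. x + p < b} = Some q \<and> a \<le> q"
        using step(4)[of "{x \<in> S. x + p < b}"] step(5-7) \<open>x + p < b\<close> \<open>a + p < b\<close> \<open>y + p < b\<close> by simp
      then show ?thesis using pivot_skip[OF step(1-3) False] by simp
    qed
  qed simp
  then show ?thesis using that assms by blast
qed

text \<open>No test of the scan depends on \<open>q\<close>: the maxima exceed \<open>q\<close>, in
  the final round the witness is at most \<open>b - 2\<close> while \<open>q = b - 1\<close>, and in
  the rounds before \<open>q\<close> is too far below \<open>b\<close> to be a witness.\<close>

lemma pivot_toggle:
  assumes "finite S" "pivot p S = Some q" "T - {q} = S - {q}"
  shows "pivot p T = Some q"
proof -
  have "pivot p S = Some q \<Longrightarrow> T - {q} = S - {q} \<Longrightarrow> pivot p T = Some q"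
    using assms(1)
  proof (induction S arbitrary: T rule: finite_set_max_induct)
    case (step S b)
    have finT: "finite T"
      by (rule finite_subset[of _ "insert q S"]) (use step in auto)
    obtain x where x: "x \<in> S" "x < q" "Suc q \<in> S" "Suc q \<le> x + p"
      using pivot_neighbours[OF step(1) step(5)] .
    have bq: "q < b" using x step(3) Suc_le_lessD by blast
    have mem: "z \<in> T \<longleftrightarrow> z \<in> S" if "z \<noteq> q" for z using step(6) that by blast
    have "b \<in> T" using mem[of b] step(2) bq by simp
    moreover have "z \<le> b" if "z \<in> T" for z
      using mem[of z] step(3)[of z] bq that by (cases "z = q") auto
    ultimately have T: "finite T" "b \<in> T" "\<And>z. z \<in> T \<Longrightarrow> z \<le> b" using finT by auto
    show ?case
    proof (cases "\<exists>x\<in>S. x + 2 \<le> b \<and> b \<le> x + p")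
      case True
      then obtain x where x: "x \<in> S" "x + 2 \<le> b" "b \<le> x + p" by blast
      have q: "q = b - 1" using pivot_found[OF step(1-3) True] step(5) by simp
      then have "x \<in> T" using x mem[of x] by simp
      then show ?thesis using pivot_found[OF T] x q by blast
    next
      case False
      let ?S = "{x \<in> S. x + p < b}" and ?T = "{x \<in> T. x + p < b}"
      have pS: "pivot p ?S = Some q" using pivot_skip[OF step(1-3) False] step(5) by simp
      then obtain x where "Suc q \<in> ?S"
        using pivot_neighbours[of ?S p q] step(1) by auto
      then have "q + p < b" by simp
      have "\<not> (\<exists>x\<in>T. x + 2 \<le> b \<and> b \<le> x + p)"
      proof
        assume "\<exists>x\<in>T. x + 2 \<le> b \<and> b \<le> x + p"
        then obtain x where x: "x \<in> T" "x + 2 \<le> b" "b \<le> x + p" by blast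
        then have "x \<in> S" using mem[of x] \<open>q + p < b\<close> by auto
        then show False using x False by blast
      qed
      moreover have "?T - {q} = ?S - {q}" using mem by blast
      then have "pivot p ?T = Some q" using step(4)[of ?S ?T] pS by simp
      ultimately show ?thesis using pivot_skip[OF T] by simp
    qed
  qed simp
  then show ?thesis using assms by blast
qed

text \<open>A set without pivot is a union of blocks \<open>{b}\<close> and \<open>{b - 1, b}\<close> whose windows are disjoint and
  nonadjacent, so the blocks can be read off from the cover.\<close>

lemma cover_inj:
  assumes "1 \<le> p" "finite S" "finite T" "pivot p S = None" "pivot p T = None"
    "cover p S = cover p T"
  shows "S = T"
proof -
  have "pivot p S = None \<Longrightarrow> pivot p T = None \<Longrightarrow> cover p S = cover p T \<Longrightarrow> S = T"
    using assms(2,3)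
  proof (induction S arbitrary: T rule: finite_set_max_induct)
    case empty
    then show ?case using assms(1) by (auto simp: cover_def)
  next
    case (step S b)
    have "T \<noteq> {}" using step assms(1) by (auto simp: cover_def)
    define c where "c = Max T"
    have c: "c \<in> T" "\<And>x. x \<in> T \<Longrightarrow> x \<le> c" using \<open>T \<noteq> {}\<close> step(8) by (auto simp: c_def)
    \<comment> \<open>The last covered position is the maximum plus \<open>p - 1\<close>, so equal
      covers force equal maxima.\<close>
    have max_cover: "u < d + p" if "u \<in> cover p U" "\<And>x. x \<in> U \<Longrightarrow> x \<le> d" for u d U
      using that by (fastforce simp: cover_def)
    have last: "d + p - 1 \<in> cover p U" if "d \<in> U" for d U
      using that assms(1) by (auto simp: cover_def intro!: bexI[of _ d])
    have "b + p - 1 < c + p" using max_cover[of _ T c] last[OF step(2)] step(7) c by simp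
    moreover have "c + p - 1 < b + p" using max_cover[of _ S b] last[OF c(1)] step(3,7) by simp
    ultimately have "c = b" by simp
    note c = c[unfolded \<open>c = b\<close>]
    \<comment> \<open>The lower windows end before position \<open>b - 1\<close>, so this position
      is covered only if \<open>b - 1\<close> is itself an element, and cutting the cover there
      removes exactly the top block. For \<open>b = 0\<close> the truncated \<open>b - 1\<close> is
      \<open>b\<close>, hence the extra disjunct.\<close>
    have block: "\<not> (\<exists>x\<in>U. x + 2 \<le> b \<and> b \<le> x + p) \<and> pivot p {x \<in> U. x + p < b} = None \<and>
        (b - 1 \<in> U \<longleftrightarrow> b - 1 \<in> cover p U \<or> b = 0) \<and>
        cover p {x \<in> U. x + p < b} = {u \<in> cover p U. Suc u < b} \<and>
        U = {x \<in> U. x + p < b} \<union> {b} \<union> ({b - 1} \<inter> U)"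
      if U: "finite U" "b \<in> U" "\<And>x. x \<in> U \<Longrightarrow> x \<le> b" "pivot p U = None" for U
    proof -
      have n: "\<not> (\<exists>x\<in>U. x + 2 \<le> b \<and> b \<le> x + p)" "pivot p {x \<in> U. x + p < b} = None"
        using pivot_found[OF U(1-3), of p] pivot_skip[OF U(1-3), of p] U(4) by (metis option.distinct(1))+
      have cases: "x = b \<or> Suc x = b \<or> x + p < b" if "x \<in> U" for x
        using U(3)[OF that] n(1) that by force
      have "b - 1 \<in> U \<longleftrightarrow> b - 1 \<in> cover p U \<or> b = 0"
      proof
        assume "b - 1 \<in> U"
        then show "b - 1 \<in> cover p U \<or> b = 0" using assms(1) by (auto simp: cover_def intro!: bexI[of _ "b - 1"])
      next
        assume *: "b - 1 \<in> cover p U \<or> b = 0"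
        show "b - 1 \<in> U"
        proof (cases "b = 0")
          case False
          then obtain x where "x \<in> U" "x \<le> b - 1" "b - 1 < x + p" using * by (auto simp: cover_def)
          then have "Suc x = b" using cases[of x] False by auto
          then show ?thesis using \<open>x \<in> U\<close> by auto
        qed (use U in auto)
      qed
      moreover have "cover p {x \<in> U. x + p < b} = {u \<in> cover p U. Suc u < b}"
      proof (intro subset_antisym subsetI)
        fix u assume "u \<in> {u \<in> cover p U. Suc u < b}"
        then obtain x where x: "x \<in> U" "x \<le> u" "u < x + p" "Suc u < b" by (auto simp: cover_def)
        then have "x + p < b" using cases[of x] by auto
        then show "u \<in> cover p {x \<in> U. x + p < b}" using x by (auto simp: cover_def)
      qed (force simp: cover_def)
      moreover have "U = {x \<in> U. x + p < b} \<union> {b} \<union> ({b - 1} \<inter> U)"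
        using cases U(2) by (auto, force)
      ultimately show ?thesis using n by blast
    qed
    note S = block[OF step(1-3) step(5)] and T = block[OF step(8) c step(6)]
    have "{x \<in> S. x + p < b} = {x \<in> T. x + p < b}"
      using step(4)[of "{x \<in> S. x + p < b}" "{x \<in> T. x + p < b}"] S T step(7,8) by auto
    moreover have "{b - 1} \<inter> S = {b - 1} \<inter> T" using S T step(7) by auto
    ultimately show ?case using S T by metis
  qed
  then show ?thesis using assms by blast
qed

section \<open>Lcms and bridges of path monomials\<close>

lemma lookup_path_mon: "Poly_Mapping.lookup (path_mon p i) j = (if i \<le> j \<and> j < i + p then 1 else 0)"
  by (simp add: path_mon_def lookup_sum lookup_single when_def)

lemma keys_path_mon: "Poly_Mapping.keys (path_mon p i) = {i..<i + p}"
  by (auto simp: in_keys_iff lookup_path_mon split: if_splits)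

lemma path_mon_inj:
  assumes "1 \<le> p" "path_mon p i = path_mon p j"
  shows "i = j"
proof -
  have "{i..<i + p} = {j..<j + p}" using assms(2) keys_path_mon by metis
  then show ?thesis using assms(1) by (simp add: Ico_eq_Ico)
qed

lemma lookup_mon_lcm:
  assumes "finite \<sigma>"
  shows "Poly_Mapping.lookup (mon_lcm \<sigma>) i = Max (insert 0 ((\<lambda>m. Poly_Mapping.lookup m i) ` \<sigma>))"
proof -
  have "{i. Max (insert 0 ((\<lambda>m. Poly_Mapping.lookup m i) ` \<sigma>)) \<noteq> 0}
      \<subseteq> (\<Union>m\<in>\<sigma>. Poly_Mapping.keys m)"
  proof
    fix i assume "i \<in> {i. Max (insert 0 ((\<lambda>m. Poly_Mapping.lookup m i) ` \<sigma>)) \<noteq> 0}"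
    then have "Max (insert 0 ((\<lambda>m. Poly_Mapping.lookup m i) ` \<sigma>)) \<noteq> 0" by simp
    moreover have "Max (insert 0 ((\<lambda>m. Poly_Mapping.lookup m i) ` \<sigma>))
        \<in> insert 0 ((\<lambda>m. Poly_Mapping.lookup m i) ` \<sigma>)"
      by (rule Max_in) (use assms in auto)
    ultimately show "i \<in> (\<Union>m\<in>\<sigma>. Poly_Mapping.keys m)" by (auto simp: in_keys_iff)
  qed
  then have "finite {i. Max (insert 0 ((\<lambda>m. Poly_Mapping.lookup m i) ` \<sigma>)) \<noteq> 0}"
    by (rule finite_subset) (use assms in auto)
  then show ?thesis unfolding mon_lcm_def by (subst lookup_Abs_poly_mapping) auto
qed

lemma mon_lcm_le_iff:
  assumes "finite \<sigma>"
  shows "Poly_Mapping.lookup (mon_lcm \<sigma>) i \<le> k \<longleftrightarrow> (\<forall>m\<in>\<sigma>. Poly_Mapping.lookup m i \<le> k)"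
  using assms by (subst lookup_mon_lcm) auto

lemma lookup_mon_lcm_path:
  assumes "finite S"
  shows "Poly_Mapping.lookup (mon_lcm (path_mon p ` S)) j = (if j \<in> cover p S then 1 else 0)"
proof (rule antisym)
  show "Poly_Mapping.lookup (mon_lcm (path_mon p ` S)) j \<le> (if j \<in> cover p S then 1 else 0)"
    using assms by (subst mon_lcm_le_iff) (auto simp: lookup_path_mon cover_def)
  show "(if j \<in> cover p S then 1 else 0) \<le> Poly_Mapping.lookup (mon_lcm (path_mon p ` S)) j"
  proof (cases "j \<in> cover p S")
    case True
    then obtain i where "i \<in> S" "i \<le> j" "j < i + p" by (auto simp: cover_def)
    then show ?thesis
      using assms mon_lcm_le_iff[of "path_mon p ` S" j 0] True by (auto simp: lookup_path_mon)
  qed simp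
qed

lemma mon_lcm_path_eq_iff:
  assumes "finite S" "finite T"
  shows "mon_lcm (path_mon p ` S) = mon_lcm (path_mon p ` T) \<longleftrightarrow> cover p S = cover p T"
proof
  assume "mon_lcm (path_mon p ` S) = mon_lcm (path_mon p ` T)"
  then have "(if j \<in> cover p S then 1 else 0 :: nat) = (if j \<in> cover p T then 1 else 0)" for j
    using lookup_mon_lcm_path assms by metis
  then have "j \<in> cover p S \<longleftrightarrow> j \<in> cover p T" for j by (metis zero_neq_one)
  then show "cover p S = cover p T" by blast
next
  assume "cover p S = cover p T"
  then show "mon_lcm (path_mon p ` S) = mon_lcm (path_mon p ` T)"
    using assms by (intro poly_mapping_eqI) (simp add: lookup_mon_lcm_path)
qed

text \<open>The window of \<open>a\<close> is redundant iff the windows of its two neighbours leave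
  no gap between them.\<close>

lemma cover_remove:
  assumes p: "1 \<le> p" and fin: "finite S" and a: "a \<in> S"
  shows "cover p (S - {a}) = cover p S \<longleftrightarrow> (\<exists>x\<in>S. \<exists>y\<in>S. x < a \<and> a < y \<and> y \<le> x + p)"
proof
  assume "\<exists>x\<in>S. \<exists>y\<in>S. x < a \<and> a < y \<and> y \<le> x + p"
  then obtain x y where xy: "x \<in> S" "y \<in> S" "x < a" "a < y" "y \<le> x + p" by blast
  have "{a..<a + p} \<subseteq> {x..<x + p} \<union> {y..<y + p}" using xy by auto
  also have "\<dots> \<subseteq> cover p (S - {a})" unfolding cover_def using xy by blast
  finally have "{a..<a + p} \<subseteq> cover p (S - {a})" .
  moreover have "cover p S = cover p (S - {a}) \<union> {a..<a + p}" using a by (auto simp: cover_def)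
  ultimately show "cover p (S - {a}) = cover p S" by blast
next
  assume eq: "cover p (S - {a}) = cover p S"
  then have sub: "u \<in> cover p (S - {a})" if "a \<le> u" "u < a + p" for u
    using that a by (auto simp: cover_def)
  have "a \<in> cover p (S - {a})" using p by (intro sub) auto
  then obtain x0 where x0: "x0 \<in> S" "x0 < a" "a < x0 + p" by (force simp: cover_def)
  define x where "x = Max {x \<in> S. x < a}"
  have fx: "finite {x \<in> S. x < a}" using fin by simp
  have "{x \<in> S. x < a} \<noteq> {}" using x0 by blast
  then have x: "x \<in> S" "x < a" using Max_in[OF fx] unfolding x_def by blast+
  have below: "z \<le> x" if "z \<in> S" "z < a" for z using Max_ge[OF fx] that by (auto simp: x_def)
  \<comment> \<open>Position \<open>x + p\<close> lies in the window of \<open>a\<close> but just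
    beyond all windows that start below \<open>a\<close>, so a window starting to the right of
    \<open>a\<close> must cover it.\<close>
  have "x + p \<in> cover p (S - {a})" using below[OF x0(1,2)] x0 x by (intro sub) auto
  then obtain y where y: "y \<in> S" "y \<noteq> a" "y \<le> x + p" "x + p < y + p" by (auto simp: cover_def)
  then have "a < y" using below[of y] by force
  then show "\<exists>x\<in>S. \<exists>y\<in>S. x < a \<and> a < y \<and> y \<le> x + p" using x y by blast
qed

lemma image_path_mon_remove:
  assumes "1 \<le> p"
  shows "path_mon p ` S - {path_mon p a} = path_mon p ` (S - {a})"
  using path_mon_inj[OF assms] by auto

lemma bridge_path_iff:
  assumes "1 \<le> p" "finite S"
  shows "bridge (path_mon p ` S) m \<longleftrightarrow>
    (\<exists>a\<in>S. m = path_mon p a \<and> (\<exists>x\<in>S. \<exists>y\<in>S. x < a \<and> a < y \<and> y \<le> x + p))"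
proof -
  have "bridge (path_mon p ` S) m \<longleftrightarrow>
      (\<exists>a\<in>S. m = path_mon p a \<and> mon_lcm (path_mon p ` (S - {a})) = mon_lcm (path_mon p ` S))"
    unfolding bridge_def using image_path_mon_remove[OF assms(1), of S] by auto
  also have "\<dots> \<longleftrightarrow> (\<exists>a\<in>S. m = path_mon p a \<and> (\<exists>x\<in>S. \<exists>y\<in>S. x < a \<and> a < y \<and> y \<le> x + p))"
    using assms by (simp add: mon_lcm_path_eq_iff cover_remove)
  finally show ?thesis .
qed

section \<open>The Barile--Macchia matching of a path ideal\<close>


context morse_matching
begin

text \<open>Nothing is assumed about bridges of targets. The loop invariant keeps the source of
  every target that is still in \<open>\<Omega>\<close>, so a cell of maximal cardinality in
  \<open>\<Omega>\<close> is never a target; the edges collected are those whose source has been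
  removed.\<close>

lemma bm_edges_eq:
  assumes src: "\<And>\<sigma> \<tau>. (\<sigma>, \<tau>) \<in> M \<Longrightarrow> 3 \<le> card \<sigma> \<and> (\<exists>m. bridge \<sigma> m) \<and> \<sigma> - sb r \<sigma> = \<tau>"
    and crit: "\<And>\<sigma> m. crit \<sigma> \<Longrightarrow> \<not> bridge \<sigma> m"
  shows "bm_edges H r = M"
proof -
  let ?A = "\<lambda>\<Omega>. {(\<sigma>, \<tau>) \<in> M. \<sigma> \<notin> \<Omega>}"
  let ?P = "\<lambda>(\<Omega>, A). \<Omega> \<subseteq> Pow H \<and> (\<forall>(\<sigma>, \<tau>)\<in>M. \<tau> \<in> \<Omega> \<longrightarrow> \<sigma> \<in> \<Omega>) \<and> A = ?A \<Omega>"
  have "snd (while (\<lambda>(\<Omega>, A). \<Omega> \<noteq> {}) (bm_round r) ({\<sigma>. \<sigma> \<subseteq> H \<and> 3 \<le> card \<sigma>}, {})) = M"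
  proof (rule while_rule2[where P = ?P and Q = "\<lambda>s. snd s = M" and r = "measure (card \<circ> fst)"])
    have "\<sigma> \<subseteq> H \<and> 3 \<le> card \<sigma>" if "(\<sigma>, \<tau>) \<in> M" for \<sigma> \<tau>
      using M_sub[OF that] src[OF that] by simp
    then show "?P ({\<sigma>. \<sigma> \<subseteq> H \<and> 3 \<le> card \<sigma>}, {})" by auto
  next
    fix s assume P: "?P s" and ne: "case s of (\<Omega>, A) \<Rightarrow> \<Omega> \<noteq> {}"
    obtain \<Omega> A where s: "s = (\<Omega>, A)" by fastforce
    have \<Omega>: "\<Omega> \<noteq> {}" "\<Omega> \<subseteq> Pow H" and closed: "\<And>\<sigma> \<tau>. (\<sigma>, \<tau>) \<in> M \<Longrightarrow> \<tau> \<in> \<Omega> \<Longrightarrow> \<sigma> \<in> \<Omega>"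
      and A: "A = ?A \<Omega>" using P ne by (auto simp: s)
    have f\<Omega>: "finite \<Omega>" using \<Omega>(2) fin finite_subset by blast
    define \<sigma> where "\<sigma> = (SOME \<sigma>. \<sigma> \<in> \<Omega> \<and> (\<forall>\<tau>\<in>\<Omega>. card \<tau> \<le> card \<sigma>))"
    define \<Omega>' where "\<Omega>' = \<Omega> - {\<sigma>, \<sigma> - sb r \<sigma>}"
    have "Max (card ` \<Omega>) \<in> card ` \<Omega>" using f\<Omega> \<Omega>(1) by simp
    then obtain \<rho> where "\<rho> \<in> \<Omega>" "card \<rho> = Max (card ` \<Omega>)" by auto
    then have "\<rho> \<in> \<Omega> \<and> (\<forall>\<tau>\<in>\<Omega>. card \<tau> \<le> card \<rho>)" using f\<Omega> by simp
    then have "\<sigma> \<in> \<Omega> \<and> (\<forall>\<tau>\<in>\<Omega>. card \<tau> \<le> card \<sigma>)" unfolding \<sigma>_def by (rule someI)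
    then have \<sigma>: "\<sigma> \<in> \<Omega>" "\<And>\<tau>. \<tau> \<in> \<Omega> \<Longrightarrow> card \<tau> \<le> card \<sigma>" by blast+
    have round: "bm_round r s = (\<Omega>', if \<exists>m. bridge \<sigma> m then insert (\<sigma>, \<sigma> - sb r \<sigma>) A else A)"
      by (simp only: bm_round_def s prod.case Let_def \<sigma>_def[symmetric] \<Omega>'_def)
    have not_target: "(\<rho>, \<sigma>) \<notin> M" for \<rho>
    proof
      assume M: "(\<rho>, \<sigma>) \<in> M"
      then have "card \<rho> \<le> card \<sigma>" using closed \<sigma> by blast
      then show False using M_facet[OF M] by (simp add: facet_def)
    qed
    have "\<sigma> \<subseteq> H" using \<sigma>(1) \<Omega> by blast
    then have "(\<forall>(\<rho>, \<tau>)\<in>M. \<tau> \<in> \<Omega>' \<longrightarrow> \<rho> \<in> \<Omega>') \<and> snd (bm_round r s) = ?A \<Omega>'"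
    proof (cases rule: cell_cases)
      case 1
      then have nb: "\<not> (\<exists>m. bridge \<sigma> m)" using crit by blast
      then have "sb r \<sigma> = {}" by (auto simp: sb_def)
      then have \<Omega>': "\<Omega>' = \<Omega> - {\<sigma>}" by (auto simp: \<Omega>'_def)
      have "(\<sigma>, \<tau>) \<notin> M" for \<tau> using 1 by (simp add: critical_def)
      then show ?thesis unfolding round using nb closed by (auto simp: \<Omega>' A)
    next
      case (2 \<tau>)
      then have b: "\<exists>m. bridge \<sigma> m" "\<sigma> - sb r \<sigma> = \<tau>" using src by auto
      have \<Omega>': "\<Omega>' = \<Omega> - {\<sigma>, \<tau>}" using b by (simp add: \<Omega>'_def)
      have closed': "\<rho> \<in> \<Omega>'" if M: "(\<rho>, \<tau>') \<in> M" "\<tau>' \<in> \<Omega>'" for \<rho> \<tau>'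
      proof -
        have "\<rho> \<noteq> \<sigma>" using M M_fun[OF 2] by (auto simp: \<Omega>')
        moreover have "\<rho> \<noteq> \<tau>" using M M_alt[OF 2] by blast
        ultimately show ?thesis using M closed by (auto simp: \<Omega>')
      qed
      have "insert (\<sigma>, \<tau>) A = ?A \<Omega>'"
        using 2 M_fun[OF 2] M_alt[OF 2] unfolding A \<Omega>' by blast
      then show ?thesis unfolding round using b closed' by auto
    qed (use not_target in blast)
    then have inv: "\<forall>(\<rho>, \<tau>)\<in>M. \<tau> \<in> \<Omega>' \<longrightarrow> \<rho> \<in> \<Omega>'"
      and s': "bm_round r s = (\<Omega>', ?A \<Omega>')" using round by (simp_all add: prod_eq_iff)
    have "card \<Omega>' < card \<Omega>" "\<Omega>' \<subseteq> Pow H"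
      using f\<Omega> \<sigma>(1) \<Omega>(2) by (auto simp: \<Omega>'_def intro!: psubset_card_mono)
    then show "?P (bm_round r s) \<and> (bm_round r s, s) \<in> measure (card \<circ> fst)"
      unfolding s' using inv by (simp add: s)
  next
    fix s assume "?P s" "\<not> (case s of (\<Omega>, A) \<Rightarrow> \<Omega> \<noteq> {})"
    then show "snd s = M" by (cases s) auto
  qed simp
  then show ?thesis by (simp add: bm_edges_def)
qed

lemma bm_matching_eq:
  assumes "bm_edges H r = M"
  shows "bm_matching H r = M"
  unfolding bm_matching_def assms using M_inj by blast

end

section \<open>The closed form of the matching\<close>

definition path_gens :: "nat \<Rightarrow> nat \<Rightarrow> mon set" where
  "path_gens p n = path_mon p ` {1..n}"

definition path_matching :: "nat \<Rightarrow> nat \<Rightarrow> cell rel" where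
  "path_matching p n = {(path_mon p ` S, path_mon p ` (S - {q})) | S q.
    S \<subseteq> {1..n} \<and> q \<in> S \<and> pivot p S = Some q}"

text \<open>Lexicographic in the size of the lcm (decreasing along gradient paths) and the sum of the
  indices: within one lcm, the pivot exceeds every other bridge that can be removed.\<close>

definition path_rank :: "nat \<Rightarrow> nat \<Rightarrow> cell \<Rightarrow> nat" where
  "path_rank p n \<sigma> = (let S = path_mon p -` \<sigma> in
    card (cover p S) * Suc (\<Sum>{1..n}) + (\<Sum>{1..n} - \<Sum>S))"

lemma path_matchingE:
  assumes "(\<sigma>, \<tau>) \<in> path_matching p n"
  obtains S q where "\<sigma> = path_mon p ` S" "\<tau> = path_mon p ` (S - {q})" "S \<subseteq> {1..n}" "finite S"
    "q \<in> S" "pivot p S = Some q"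
  using assms finite_subset[of _ "{1..n}"] by (auto simp: path_matching_def)

lemma inj_path_mon: "1 \<le> p \<Longrightarrow> inj (path_mon p)"
  using path_mon_inj by (auto simp: inj_def)

lemma path_rank_image:
  "1 \<le> p \<Longrightarrow> path_rank p n (path_mon p ` S) =
    card (cover p S) * Suc (\<Sum>{1..n}) + (\<Sum>{1..n} - \<Sum>S)"
  by (simp add: path_rank_def inj_vimage_image_eq[OF inj_path_mon])

lemma cover_pivot:
  assumes "1 \<le> p" "finite S" "pivot p S = Some q" "q \<in> S"
  shows "cover p (S - {q}) = cover p S"
proof -
  obtain x where "x \<in> S" "x < q" "Suc q \<in> S" "Suc q \<le> x + p"
    using pivot_neighbours[OF assms(2,3)] .
  then have "\<exists>x\<in>S. \<exists>y\<in>S. x < q \<and> q < y \<and> y \<le> x + p" by (metis lessI)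
  then show ?thesis using cover_remove assms by blast
qed

lemma path_rank_less:
  assumes p: "1 \<le> p" and S: "S \<subseteq> {1..n}" "q \<in> S" "pivot p S = Some q" and v: "v \<in> S" "v \<noteq> q"
  shows "path_rank p n (path_mon p ` (S - {v})) < path_rank p n (path_mon p ` (S - {q}))"
proof -
  have fin: "finite S" using S finite_subset by blast
  have cq: "cover p (S - {q}) = cover p S" using cover_pivot p fin S by blast
  have sum: "\<Sum>(S - {x}) = \<Sum>S - x" "x \<le> \<Sum>S" "\<Sum>S \<le> \<Sum>{1..n}" if "x \<in> S" for x
    using fin that S(1) member_le_sum[of x S "\<lambda>x. x"]
    by (auto simp: sum_diff1_nat intro: sum_mono2)
  show ?thesis
  proof (cases "cover p (S - {v}) = cover p S")
    case True
    then obtain x y where "x \<in> S" "y \<in> S" "x < v" "v < y" "y \<le> x + p"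
      using cover_remove[OF p fin v(1)] by blast
    then obtain q' where "pivot p S = Some q'" "v \<le> q'" using bridge_le_pivot[OF fin] v(1) by metis
    then have "v < q" using S v by simp
    then show ?thesis using True cq sum[OF S(2)] sum[OF v(1)] by (simp add: path_rank_image[OF p])
  next
    case False
    then have "cover p (S - {v}) \<subset> cover p S" by (auto simp: cover_def)
    then have "card (cover p (S - {v})) < card (cover p S)"
      using finite_cover[OF fin] by (intro psubset_card_mono)
    \<comment> \<open>Losing one covered position outweighs the index part, which is at most
      \<open>\<Sum>{1..n}\<close>; this is why the factor in the rank is its successor.\<close>
    then have "Suc (card (cover p (S - {v}))) * Suc (\<Sum>{1..n}) \<le> card (cover p S) * Suc (\<Sum>{1..n})"
      by (intro mult_le_mono1) simp
    then show ?thesis unfolding path_rank_image[OF p] cq by simp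
  qed
qed

lemma path_order_iff:
  assumes "1 \<le> p"
  shows "(path_mon p i, path_mon p j) \<in> path_order p n \<longleftrightarrow> 1 \<le> j \<and> j \<le> i \<and> i \<le> n"
  using path_mon_inj[OF assms] by (auto simp: path_order_def)

lemma linear_order_path:
  assumes "1 \<le> p"
  shows "linear_order_on (path_gens p n) (path_order p n)"
proof -
  have mem: "\<exists>i j. a = path_mon p i \<and> b = path_mon p j \<and> 1 \<le> j \<and> j \<le> i \<and> i \<le> n"
    if "(a, b) \<in> path_order p n" for a b using that by (auto simp: path_order_def)
  have "antisym (path_order p n)"
  proof (rule antisymI)
    fix a b assume ab: "(a, b) \<in> path_order p n" "(b, a) \<in> path_order p n"
    obtain i j where "a = path_mon p i" "b = path_mon p j" using mem[OF ab(1)] by blast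
    then show "a = b" using ab path_order_iff[OF assms] by simp
  qed
  moreover have "trans (path_order p n)"
  proof (rule transI)
    fix a b c assume ab: "(a, b) \<in> path_order p n" "(b, c) \<in> path_order p n"
    obtain i j where "a = path_mon p i" "b = path_mon p j" using mem[OF ab(1)] by blast
    moreover obtain k l where "b = path_mon p k" "c = path_mon p l" using mem[OF ab(2)] by blast
    ultimately show "(a, c) \<in> path_order p n" using ab path_order_iff[OF assms] by simp
  qed
  moreover have "refl_on (path_gens p n) (path_order p n)"
    by (auto simp: refl_on_def path_gens_def path_order_iff[OF assms])
  moreover have "total_on (path_gens p n) (path_order p n)"
    by (auto simp: total_on_def path_gens_def path_order_iff[OF assms])
  moreover have "path_order p n \<subseteq> path_gens p n \<times> path_gens p n"
    by (auto simp: path_order_def path_gens_def)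
  ultimately show ?thesis by (simp add: order_on_defs)
qed

lemma morse_matching_path:
  assumes p: "1 \<le> p"
  shows "morse_matching (path_gens p n) (path_order p n) (path_matching p n) (path_rank p n)"
proof
  note lin = linear_order_path[OF p, of n, unfolded order_on_defs]
  note eqs = inj_image_eq_iff[OF inj_path_mon[OF p]]
  show "finite (path_gens p n)" by (simp add: path_gens_def)
  show "antisym (path_order p n)" "total_on (path_gens p n) (path_order p n)"
    "trans (path_order p n)" "refl_on (path_gens p n) (path_order p n)" using lin by auto
  fix \<sigma> \<tau> assume "(\<sigma>, \<tau>) \<in> path_matching p n"
  then obtain S q where S: "\<sigma> = path_mon p ` S" "\<tau> = path_mon p ` (S - {q})" "S \<subseteq> {1..n}" "finite S"
    "q \<in> S" "pivot p S = Some q" by (rule path_matchingE)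
  show "\<sigma> \<subseteq> path_gens p n" using S by (auto simp: path_gens_def)
  have \<tau>: "\<tau> = \<sigma> - {path_mon p q}" using image_path_mon_remove[OF p] S by simp
  show "facet \<sigma> \<tau>" unfolding \<tau> using S by (intro facet_remove) auto
  \<comment> \<open>The target remembers \<open>q\<close>, so it determines its source; and since
    \<open>q\<close> is missing from it, it is not a source itself.\<close>
  have piv: "pivot p (S - {q}) = Some q" using pivot_toggle[OF S(4,6)] by simp
  show "\<tau> = \<tau>'" if "(\<sigma>, \<tau>') \<in> path_matching p n" for \<tau>'
    using that
  proof (rule path_matchingE)
    fix S' q' assume "\<sigma> = path_mon p ` S'" "\<tau>' = path_mon p ` (S' - {q'})" "pivot p S' = Some q'"
    then show ?thesis using S eqs by auto
  qed
  show "\<sigma> = \<sigma>'" if "(\<sigma>', \<tau>) \<in> path_matching p n" for \<sigma>'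
    using that
  proof (rule path_matchingE)
    fix S' q' assume S': "\<sigma>' = path_mon p ` S'" "\<tau> = path_mon p ` (S' - {q'})" "pivot p S' = Some q'"
      "finite S'" "q' \<in> S'"
    have "S - {q} = S' - {q'}" using S S' eqs by auto
    moreover from this have "q = q'" using piv pivot_toggle[OF S'(4,3), of "S' - {q'}"] by simp
    ultimately have "S = S'" using S S' by (metis insert_Diff)
    then show ?thesis using S S' by simp
  qed
  show "(\<tau>, \<tau>') \<notin> path_matching p n" for \<tau>'
  proof
    assume "(\<tau>, \<tau>') \<in> path_matching p n"
    then show False
    proof (rule path_matchingE)
      fix S' q' assume "\<tau> = path_mon p ` S'" "pivot p S' = Some q'" "q' \<in> S'"
      then show False using S eqs piv by auto
    qed
  qed
  show "path_rank p n \<tau>' < path_rank p n \<tau>" if "facet \<sigma> \<tau>'" "\<tau>' \<noteq> \<tau>" for \<tau>'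
  proof -
    have "finite \<sigma>" using S by simp
    then obtain m where "m \<in> \<sigma>" "\<tau>' = \<sigma> - {m}" using facetE[OF \<open>facet \<sigma> \<tau>'\<close>] by blast
    then obtain v where v: "v \<in> S" "\<tau>' = path_mon p ` (S - {v})"
      using S image_path_mon_remove[OF p] by auto
    then show ?thesis using path_rank_less[OF p S(3,5,6)] that S by auto
  qed
qed

lemma path_cellE:
  assumes "\<sigma> \<subseteq> path_gens p n"
  obtains S where "\<sigma> = path_mon p ` S" "S \<subseteq> {1..n}" "finite S"
  using assms finite_subset[of _ "{1..n}"] by (auto simp: path_gens_def elim!: subset_imageE)

lemma path_critical:
  assumes p: "1 \<le> p" and S: "S \<subseteq> {1..n}" and c: "critical (path_gens p n) (path_matching p n) (path_mon p ` S)"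
  shows "pivot p S = None"
proof (rule ccontr)
  assume "pivot p S \<noteq> None"
  then obtain q where q: "pivot p S = Some q" by blast
  have fin: "finite S" using S finite_subset by blast
  show False
  proof (cases "q \<in> S")
    case True
    then have "(path_mon p ` S, path_mon p ` (S - {q})) \<in> path_matching p n"
      using S q by (auto simp: path_matching_def)
    then show ?thesis using c by (auto simp: critical_def)
  next
    case False
    \<comment> \<open>The pivot lies strictly between two elements of \<open>S\<close>, so inserting
      it stays within the indices and \<open>S\<close> is the target of an edge.\<close>
    obtain x where "x \<in> S" "x < q" "Suc q \<in> S" using pivot_neighbours[OF fin q] .
    then have "insert q S \<subseteq> {1..n}" using S by auto
    moreover have "pivot p (insert q S) = Some q" using pivot_toggle[OF fin q] by auto
    ultimately have "(path_mon p ` insert q S, path_mon p ` (insert q S - {q})) \<in> path_matching p n"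
      unfolding path_matching_def by blast
    then show ?thesis using c False by (auto simp: critical_def)
  qed
qed

lemma mon_lcm_path_matching:
  assumes "1 \<le> p" "(\<sigma>, \<tau>) \<in> path_matching p n"
  shows "mon_lcm \<sigma> = mon_lcm \<tau>"
  using assms(2)
proof (rule path_matchingE)
  fix S q assume "\<sigma> = path_mon p ` S" "\<tau> = path_mon p ` (S - {q})" "finite S" "q \<in> S" "pivot p S = Some q"
  then show ?thesis using cover_pivot[OF assms(1)] by (simp add: mon_lcm_path_eq_iff)
qed

lemma mon_lcm_critical_inj:
  assumes p: "1 \<le> p" and c: "critical (path_gens p n) (path_matching p n) \<sigma>"
    "critical (path_gens p n) (path_matching p n) \<tau>" and eq: "mon_lcm \<sigma> = mon_lcm \<tau>"
  shows "\<sigma> = \<tau>"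
proof -
  have sub: "\<sigma> \<subseteq> path_gens p n" "\<tau> \<subseteq> path_gens p n" using c by (simp_all add: critical_def)
  obtain S where S: "\<sigma> = path_mon p ` S" "S \<subseteq> {1..n}" "finite S" using path_cellE[OF sub(1)] .
  obtain T where T: "\<tau> = path_mon p ` T" "T \<subseteq> {1..n}" "finite T" using path_cellE[OF sub(2)] .
  have "cover p S = cover p T"
    using eq unfolding S(1) T(1) mon_lcm_path_eq_iff[OF S(3) T(3)] .
  moreover have "pivot p S = None" using path_critical[OF p S(2)] c(1) S(1) by simp
  moreover have "pivot p T = None" using path_critical[OF p T(2)] c(2) T(1) by simp
  ultimately have "S = T" using cover_inj[OF p S(3) T(3)] by blast
  then show ?thesis using S T by simp
qed

text \<open>Small in the order means large index, so the upper bound that the pivot gives for all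
  bridges makes it the smallest bridge.\<close>

lemma bm_edges_path:
  assumes p: "1 \<le> p"
  shows "bm_edges (path_gens p n) (path_order p n) = path_matching p n"
proof -
  interpret morse_matching "path_gens p n" "path_order p n" "path_matching p n" "path_rank p n"
    by (rule morse_matching_path[OF p])
  show ?thesis
  proof (rule bm_edges_eq)
    fix \<sigma> \<tau> assume "(\<sigma>, \<tau>) \<in> path_matching p n"
    then obtain S q where S: "\<sigma> = path_mon p ` S" "\<tau> = path_mon p ` (S - {q})" "S \<subseteq> {1..n}" "finite S"
      "q \<in> S" "pivot p S = Some q" by (rule path_matchingE)
    obtain x where x: "x \<in> S" "x < q" "Suc q \<in> S" "Suc q \<le> x + p"
      using pivot_neighbours[OF S(4,6)] .
    \<comment> \<open>The pivot and its two neighbours put every source among the cells of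
      cardinality at least 3 with which the loop starts.\<close>
    have "card {x, q, Suc q} \<le> card S" using x S by (intro card_mono) auto
    moreover have "card {x, q, Suc q} = 3" using x by simp
    moreover have "card \<sigma> = card S"
      unfolding S(1) using inj_path_mon[OF p] by (intro card_image) (auto intro: inj_on_subset)
    moreover have bq: "bridge \<sigma> (path_mon p q)"
      unfolding S(1) bridge_path_iff[OF p S(4)] using x S(5) by (metis lessI)
    moreover have le: "(path_mon p q, m) \<in> path_order p n" if b: "bridge \<sigma> m" for m
    proof -
      obtain a x y where a: "a \<in> S" "m = path_mon p a" "x \<in> S" "y \<in> S" "x < a" "a < y" "y \<le> x + p"
        using b unfolding S(1) bridge_path_iff[OF p S(4)] by blast
      obtain q' where "pivot p S = Some q'" "a \<le> q'"
        using bridge_le_pivot[OF S(4) a(3,1,4-7)] .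
      then show ?thesis using a S by (auto simp: path_order_iff[OF p])
    qed
    moreover have "sb (path_order p n) \<sigma> = {path_mon p q}"
      using bq le antisym by (auto simp: sb_def dest: antisymD)
    ultimately show "3 \<le> card \<sigma> \<and> (\<exists>m. bridge \<sigma> m) \<and> \<sigma> - sb (path_order p n) \<sigma> = \<tau>"
      using image_path_mon_remove[OF p] S by auto
  next
    fix \<sigma> m assume c: "crit \<sigma>"
    obtain S where S: "\<sigma> = path_mon p ` S" "S \<subseteq> {1..n}" "finite S"
      using path_cellE[OF crit_sub[OF c]] .
    have "pivot p S = None" using path_critical[OF p S(2)] c S by simp
    then show "\<not> bridge \<sigma> m"
      unfolding S(1) bridge_path_iff[OF p S(3)] by (metis bridge_le_pivot[OF S(3)] option.distinct(1))
  qed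
qed

lemma bm_matching_path:
  "1 \<le> p \<Longrightarrow> bm_matching (path_gens p n) (path_order p n) = path_matching p n"
  using morse_matching.bm_matching_eq[OF morse_matching_path bm_edges_path] .

section \<open>Monomial ideals\<close>


definition mdvd :: "mon \<Rightarrow> mon \<Rightarrow> bool" where
  "mdvd a b \<longleftrightarrow> (\<forall>i. Poly_Mapping.lookup a i \<le> Poly_Mapping.lookup b i)"

lemma mdvd_trans: "mdvd a b \<Longrightarrow> mdvd b c \<Longrightarrow> mdvd a c"
  unfolding mdvd_def using order_trans by blast

lemma mdvd_antisym: "mdvd a b \<Longrightarrow> mdvd b a \<Longrightarrow> a = b"
  unfolding mdvd_def by (intro poly_mapping_eqI) (simp add: order_antisym)

lemma mdvd_refl [simp]: "mdvd a a"
  by (simp add: mdvd_def)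

lemma mdvd_0 [simp]: "mdvd 0 a"
  by (simp add: mdvd_def)

lemma mdvd_diff_add: "mdvd a b \<Longrightarrow> b - a + a = b"
  by (intro poly_mapping_eqI) (simp add: lookup_add lookup_minus mdvd_def)

lemma mdvd_add: "mdvd a (b + a)"
  by (simp add: mdvd_def lookup_add)

lemma mdvd_keys: "mdvd a b \<Longrightarrow> Poly_Mapping.keys a \<subseteq> Poly_Mapping.keys b"
  by (auto simp: mdvd_def in_keys_iff) (metis le_zero_eq neq0_conv)

lemma keys_diff_mon: "Poly_Mapping.keys (b - a) \<subseteq> Poly_Mapping.keys (b :: mon)"
  by (auto simp: in_keys_iff lookup_minus)

lemma poly_eq_sum_single:
  "f = (\<Sum>u\<in>Poly_Mapping.keys f. Poly_Mapping.single u (Poly_Mapping.lookup f u))"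
proof (rule poly_mapping_eqI)
  fix w
  have "Poly_Mapping.lookup (\<Sum>u\<in>Poly_Mapping.keys f. Poly_Mapping.single u (Poly_Mapping.lookup f u)) w
    = (\<Sum>u\<in>Poly_Mapping.keys f. if u = w then Poly_Mapping.lookup f u else 0)"
    by (simp add: lookup_sum lookup_single when_def)
  also have "\<dots> = Poly_Mapping.lookup f w"
    by (simp add: in_keys_iff)
  finally show "Poly_Mapping.lookup f w = Poly_Mapping.lookup
      (\<Sum>u\<in>Poly_Mapping.keys f. Poly_Mapping.single u (Poly_Mapping.lookup f u)) w" by simp
qed

lemma lookup_mult_single:
  fixes f :: "'k::comm_semiring_1 mpoly"
  shows "Poly_Mapping.lookup (f * Poly_Mapping.single m c) w =
    (if mdvd m w then Poly_Mapping.lookup f (w - m) * c else 0)"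
proof -
  have "f * Poly_Mapping.single m c
      = (\<Sum>u\<in>Poly_Mapping.keys f. Poly_Mapping.single (u + m) (Poly_Mapping.lookup f u * c))"
    by (subst poly_eq_sum_single[of f]) (simp add: sum_distrib_right mult_single)
  then have "Poly_Mapping.lookup (f * Poly_Mapping.single m c) w
      = (\<Sum>u\<in>Poly_Mapping.keys f. if u + m = w then Poly_Mapping.lookup f u * c else 0)"
    by (simp add: lookup_sum lookup_single when_def)
  also have "\<dots> = (if mdvd m w then Poly_Mapping.lookup f (w - m) * c else 0)"
  proof (cases "mdvd m w")
    case True
    then have "u + m = w \<longleftrightarrow> u = w - m" for u
      using mdvd_diff_add by auto
    then show ?thesis using True by (simp add: in_keys_iff)
  next
    case False
    then have "u + m \<noteq> w" for u using mdvd_add by blast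
    then show ?thesis using False by simp
  qed
  finally show ?thesis .
qed

section \<open>Polynomial rings and membership in monomial ideals\<close>

lemma in_poly_ring_iff:
  "f \<in> carrier (poly_ring N) \<longleftrightarrow> (\<forall>m\<in>Poly_Mapping.keys f. Poly_Mapping.keys m \<subseteq> {1..N})"
  by (simp add: poly_ring_def)

lemma poly_ring_simps [simp]:
  "0 \<in> carrier (poly_ring N)" "1 \<in> carrier (poly_ring N)"
  "mult (poly_ring N) = (*)" "one (poly_ring N) = 1" "zero (poly_ring N) = 0" "add (poly_ring N) = (+)"
  by (simp_all add: poly_ring_def)

lemma poly_ring_add:
  "f \<in> carrier (poly_ring N) \<Longrightarrow> g \<in> carrier (poly_ring N) \<Longrightarrow> f + g \<in> carrier (poly_ring N)"
  using keys_add[of f g] unfolding in_poly_ring_iff by blast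

lemma poly_ring_sum:
  "(\<And>i. i \<in> A \<Longrightarrow> f i \<in> carrier (poly_ring N)) \<Longrightarrow> (\<Sum>i\<in>A. f i) \<in> carrier (poly_ring N)"
proof (induction A rule: infinite_finite_induct)
  case (insert x F)
  then show ?case using poly_ring_add[of "f x" N "sum f F"] by simp
qed auto

lemma poly_ring_mult:
  assumes "f \<in> carrier (poly_ring N)" "g \<in> carrier (poly_ring N)"
  shows "f * g \<in> carrier (poly_ring N)"
  unfolding in_poly_ring_iff
proof
  fix m assume "m \<in> Poly_Mapping.keys (f * g)"
  then obtain a b where "m = a + b" "a \<in> Poly_Mapping.keys f" "b \<in> Poly_Mapping.keys g"
    using keys_mult[of f g] by blast
  then show "Poly_Mapping.keys m \<subseteq> {1..N}"
    using assms keys_add[of a b] unfolding in_poly_ring_iff by blast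
qed

lemma keys_uminus_mpoly: "Poly_Mapping.keys (- f) = Poly_Mapping.keys (f :: 'k::field mpoly)"
  by (auto simp: in_keys_iff)

lemma single_in_poly_ring:
  "Poly_Mapping.keys m \<subseteq> {1..N} \<Longrightarrow> Poly_Mapping.single m c \<in> carrier (poly_ring N)"
  by (simp add: in_poly_ring_iff)

lemma cring_poly_ring: "cring (poly_ring N :: 'k::field mpoly ring)"
proof (rule cringI)
  show "abelian_group (poly_ring N :: 'k mpoly ring)"
  proof (rule abelian_groupI)
    fix x :: "'k mpoly" assume "x \<in> carrier (poly_ring N)"
    then have "- x \<in> carrier (poly_ring N)" by (simp add: in_poly_ring_iff keys_uminus_mpoly)
    then show "\<exists>y\<in>carrier (poly_ring N). y \<oplus>\<^bsub>poly_ring N\<^esub> x = \<zero>\<^bsub>poly_ring N\<^esub>"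
      by (intro bexI[of _ "- x"]) auto
  qed (use poly_ring_add in \<open>auto simp: add_ac\<close>)
  show "Group.comm_monoid (poly_ring N :: 'k mpoly ring)"
    by (rule comm_monoidI) (use poly_ring_mult in \<open>auto simp: mult_ac\<close>)
qed (auto simp: distrib_right)

text \<open>The right-hand side is an ideal, since each monomial of a product is a multiple of a
  monomial of either factor. Conversely, each single term of such a polynomial is a multiple of a
  generator.\<close>

lemma genideal_mono:
  assumes G: "\<And>g. g \<in> G \<Longrightarrow> Poly_Mapping.keys g \<subseteq> {1..N}"
  shows "genideal (poly_ring N) (mono_poly ` G :: 'k::field mpoly set) =
    {f \<in> carrier (poly_ring N). \<forall>w\<in>Poly_Mapping.keys f. \<exists>g\<in>G. mdvd g w}" (is "_ = ?I")
proof
  interpret R: cring "poly_ring N :: 'k mpoly ring" by (rule cring_poly_ring)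
  have sub: "mono_poly ` G \<subseteq> carrier (poly_ring N :: 'k mpoly ring)"
    using G single_in_poly_ring by blast
  interpret J: ideal "genideal (poly_ring N) (mono_poly ` G :: 'k mpoly set)" "poly_ring N"
    by (rule R.genideal_ideal[OF sub])
  have mult: "f * h \<in> ?I" if "f \<in> ?I" "h \<in> carrier (poly_ring N)" for f h :: "'k mpoly"
  proof -
    have "\<exists>g\<in>G. mdvd g w" if w: "w \<in> Poly_Mapping.keys (f * h)" for w
    proof -
      obtain a b where ab: "w = a + b" "a \<in> Poly_Mapping.keys f" using keys_mult[of f h] w by blast
      then obtain g where "g \<in> G" "mdvd g a" using \<open>f \<in> ?I\<close> by blast
      then show ?thesis using mdvd_trans mdvd_add[of a b] ab(1) by (metis add.commute)
    qed
    then show ?thesis using that poly_ring_mult[of f N h] by blast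
  qed
  have "ideal ?I (poly_ring N :: 'k mpoly ring)"
  proof (rule idealI[OF R.ring_axioms])
    show "subgroup ?I (add_monoid (poly_ring N :: 'k mpoly ring))"
    proof (rule R.add.subgroupI)
      fix f assume f: "f \<in> ?I"
      then have "- f \<in> carrier (poly_ring N :: 'k mpoly ring)"
        by (simp add: in_poly_ring_iff keys_uminus_mpoly)
      then have "\<ominus>\<^bsub>poly_ring N\<^esub> f = - f"
        using f R.minus_equality[of "- f" f] by simp
      then show "\<ominus>\<^bsub>poly_ring N\<^esub> f \<in> ?I"
        using f by (simp add: in_poly_ring_iff keys_uminus_mpoly)
    next
      fix f h assume "f \<in> ?I" "h \<in> ?I"
      then show "f \<oplus>\<^bsub>poly_ring N\<^esub> h \<in> ?I"
        using poly_ring_add[of f N h] keys_add[of f h] by auto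
    qed (auto intro: exI[of _ 0])
  qed (use mult in \<open>auto simp: mult.commute\<close>)
  moreover have "mono_poly ` G \<subseteq> ?I" using sub mdvd_refl by (force simp del: mdvd_refl)
  ultimately show "genideal (poly_ring N) (mono_poly ` G) \<subseteq> ?I" by (rule R.genideal_minimal)
  show "?I \<subseteq> genideal (poly_ring N) (mono_poly ` G)"
  proof
    fix f assume f: "f \<in> ?I"
    let ?s = "\<lambda>u. Poly_Mapping.single u (Poly_Mapping.lookup f u)"
    have s: "?s u \<in> genideal (poly_ring N) (mono_poly ` G)" if u: "u \<in> Poly_Mapping.keys f" for u
    proof -
      obtain g where g: "g \<in> G" "mdvd g u" using f u by blast
      have "mono_poly g \<in> genideal (poly_ring N) (mono_poly ` G :: 'k mpoly set)"
        using g(1) R.genideal_self[OF sub] by blast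
      moreover have "Poly_Mapping.single (u - g) (Poly_Mapping.lookup f u) \<in> carrier (poly_ring N)"
        using f u keys_diff_mon[of u g] by (intro single_in_poly_ring) (auto simp: in_poly_ring_iff)
      ultimately have "Poly_Mapping.single (u - g) (Poly_Mapping.lookup f u) * mono_poly g
          \<in> genideal (poly_ring N) (mono_poly ` G)"
        using J.I_l_closed by fastforce
      then show ?thesis by (simp add: mult_single mdvd_diff_add[OF g(2)])
    qed
    have "(\<Sum>u\<in>U. ?s u) \<in> genideal (poly_ring N) (mono_poly ` G)" if "U \<subseteq> Poly_Mapping.keys f" for U
      using finite_subset[OF that finite_keys] that
    proof (induction U rule: finite_induct)
      case empty
      show ?case using J.zero_closed by simp
    next
      case (insert u U)
      then show ?case using s J.a_closed by fastforce
    qed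
    from this[OF order_refl] show "f \<in> genideal (poly_ring N) (mono_poly ` G)"
      using poly_eq_sum_single[of f] by simp
  qed
qed

lemma in_irrelevant_ideal:
  fixes f :: "'k::field mpoly"
  assumes "f \<in> carrier (poly_ring N)" "0 \<notin> Poly_Mapping.keys f"
  shows "f \<in> irrelevant_ideal N"
proof -
  let ?G = "(\<lambda>i. Poly_Mapping.single i 1) ` {1..N} :: mon set"
  have "irrelevant_ideal N = genideal (poly_ring N) (mono_poly ` ?G :: 'k mpoly set)"
    by (simp add: irrelevant_ideal_def image_image)
  also have "\<dots> = {f \<in> carrier (poly_ring N). \<forall>w\<in>Poly_Mapping.keys f. \<exists>g\<in>?G. mdvd g w}"
    by (rule genideal_mono) auto
  finally have eq: "irrelevant_ideal N =
    {f \<in> carrier (poly_ring N :: 'k mpoly ring). \<forall>w\<in>Poly_Mapping.keys f. \<exists>g\<in>?G. mdvd g w}" .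
  have "\<exists>g\<in>?G. mdvd g w" if w: "w \<in> Poly_Mapping.keys f" for w
  proof -
    have "w \<noteq> 0" using w assms(2) by blast
    then obtain i where i: "i \<in> Poly_Mapping.keys w" by (metis all_not_in_conv keys_eq_empty)
    then have "i \<in> {1..N}" using assms(1) w unfolding in_poly_ring_iff by blast
    moreover have "mdvd (Poly_Mapping.single i 1) w"
      using i by (auto simp: mdvd_def lookup_single when_def in_keys_iff)
    ultimately show ?thesis by blast
  qed
  then show ?thesis using assms(1) unfolding eq by blast
qed

text \<open>For a second minimal set \<open>B\<close>, each \<open>g\<close> in \<open>G\<close> is
  a multiple of some \<open>h\<close> in \<open>B\<close>, and \<open>h\<close> of some
  \<open>g'\<close> in \<open>G\<close>. The antichain condition forces \<open>g' = g\<close>, hence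
  \<open>h = g\<close>; so \<open>B\<close> contains \<open>G\<close>, and its minimality gives
  equality.\<close>

lemma min_gens_antichain:
  fixes I :: "'k::field mpoly set"
  assumes G: "\<And>g. g \<in> G \<Longrightarrow> Poly_Mapping.keys g \<subseteq> {1..N}"
    and anti: "\<And>g h. g \<in> G \<Longrightarrow> h \<in> G \<Longrightarrow> mdvd g h \<Longrightarrow> g = h"
    and I: "I = genideal (poly_ring N) (mono_poly ` G)"
  shows "min_gens N I = G"
proof -
  have mem: "mono_poly m \<in> genideal (poly_ring N) (mono_poly ` B :: 'k mpoly set)
      \<longleftrightarrow> Poly_Mapping.keys m \<subseteq> {1..N} \<and> (\<exists>g\<in>B. mdvd g m)"
    if "\<And>g. g \<in> B \<Longrightarrow> Poly_Mapping.keys g \<subseteq> {1..N}" for B m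
    by (simp add: genideal_mono[OF that] in_poly_ring_iff)
  have "min_gen_set N I G"
    unfolding min_gen_set_def
  proof (intro conjI allI impI)
    show "mono_poly ` G \<subseteq> carrier (poly_ring N :: 'k mpoly ring)"
      using G single_in_poly_ring by blast
    show "genideal (poly_ring N) (mono_poly ` G) = I" using I by simp
    fix B assume B: "B \<subset> G"
    then obtain g where g: "g \<in> G" "g \<notin> B" by blast
    then have "\<not> (\<exists>h\<in>B. mdvd h g)" using anti B by blast
    moreover have "Poly_Mapping.keys h \<subseteq> {1..N}" if "h \<in> B" for h using that B G by blast
    ultimately have "mono_poly g \<notin> genideal (poly_ring N) (mono_poly ` B :: 'k mpoly set)"
      using mem by blast
    moreover have "mono_poly g \<in> I" unfolding I using mem[OF G] g G mdvd_refl by blast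
    ultimately show "genideal (poly_ring N) (mono_poly ` B) \<noteq> I" by blast
  qed
  moreover have "B = G" if B: "min_gen_set N I B" for B
  proof -
    have kB: "Poly_Mapping.keys h \<subseteq> {1..N}" if "h \<in> B" for h
    proof -
      have "mono_poly h \<in> carrier (poly_ring N :: 'k mpoly ring)"
        using B that unfolding min_gen_set_def by blast
      then show ?thesis by (simp add: in_poly_ring_iff)
    qed
    have IB: "I = genideal (poly_ring N) (mono_poly ` B)" using B by (simp add: min_gen_set_def)
    have "g \<in> B" if g: "g \<in> G" for g
    proof -
      have "mono_poly g \<in> I" unfolding I using mem[OF G] g G mdvd_refl by blast
      then obtain h where h: "h \<in> B" "mdvd h g" using mem[OF kB] unfolding IB by blast
      then have "mono_poly h \<in> I" unfolding IB using mem[OF kB] kB mdvd_refl by blast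
      then obtain g' where g': "g' \<in> G" "mdvd g' h" using mem[OF G] unfolding I by blast
      then have "g' = g" using anti g h mdvd_trans by blast
      then have "h = g" using g' h mdvd_antisym by blast
      then show ?thesis using h by simp
    qed
    moreover have "\<not> G \<subset> B" using B I by (auto simp: min_gen_set_def)
    ultimately show "B = G" by blast
  qed
  ultimately show ?thesis unfolding min_gens_def by (rule the_equality)
qed

section \<open>The resolution\<close>


context morse_matching
begin

lemma mdiff_sub:
  assumes K: "K \<subseteq> H" and cl: "\<And>\<sigma> \<tau>. (\<sigma>, \<tau>) \<in> M \<Longrightarrow> \<tau> \<subseteq> K \<Longrightarrow> \<sigma> \<subseteq> K"
    and s: "crit s" and \<sigma>: "\<sigma> \<subseteq> K" "morse_flow.mdiff r pflow \<sigma> s \<noteq> 0"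
  shows "s \<subseteq> K"
proof -
  interpret F: morse_flow H r M \<mu> pflow by (rule morse_flow_pflow)
  obtain c where c: "c \<in> {c. facet \<sigma> c}" "incidence r \<sigma> c * pflow c s \<noteq> 0"
    using \<sigma>(2) unfolding F.mdiff_def by (rule sum.not_neutral_contains_not_neutral)
  then have "c \<subseteq> K" using \<sigma>(1) by (auto simp: facet_def)
  then show ?thesis using pflow_sub[OF K cl s] c by auto
qed

text \<open>\<open>K\<close> and the whole simplex share the flow and hence the integers
  \<open>mdiff\<close>; for chains supported in \<open>K\<close> only the range of summation
  differs. So exactness on \<open>K\<close> can be stated with the differential of the
  whole.\<close>

lemma morse_exact_restrict:
  fixes \<phi> :: "cell \<Rightarrow> 'k::comm_ring_1"
  assumes K: "K \<subseteq> H" "K \<noteq> {}" and cl: "\<And>\<sigma> \<tau>. (\<sigma>, \<tau>) \<in> M \<Longrightarrow> \<tau> \<subseteq> K \<Longrightarrow> \<sigma> \<subseteq> K"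
    and supp: "\<And>c. \<phi> c \<noteq> 0 \<Longrightarrow> crit c \<and> c \<subseteq> K \<and> card c = k"
    and ker: "\<And>s. crit s \<Longrightarrow> s \<subseteq> K \<Longrightarrow> morse_flow.cdiff H r M pflow \<phi> s = 0"
  obtains \<psi> where "\<And>c. \<psi> c \<noteq> 0 \<Longrightarrow> crit c \<and> c \<subseteq> K \<and> card c = Suc k"
    "\<And>s. crit s \<Longrightarrow> s \<subseteq> K \<Longrightarrow> morse_flow.cdiff H r M pflow \<psi> s = \<phi> s"
proof -
  interpret F: morse_flow H r M \<mu> pflow by (rule morse_flow_pflow)
  interpret W: morse_flow K r "M \<inter> Pow K \<times> Pow K" \<mu> pflow
    by (rule morse_flow_restrict[OF K(1) cl])
  have crit_iff: "critical K (M \<inter> Pow K \<times> Pow K) s \<longleftrightarrow> crit s \<and> s \<subseteq> K" for s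
    by (rule critical_restrict[OF K(1)]) (rule cl)
  have eq: "W.cdiff f s = F.cdiff f s" if "\<And>c. f c \<noteq> 0 \<Longrightarrow> c \<subseteq> K" for f :: "cell \<Rightarrow> 'k" and s
    unfolding W.cdiff_def F.cdiff_def using that finite_crit
    by (intro sum.mono_neutral_left) (auto simp: crit_iff dest!: mult_not_zero that)
  have "critical K (M \<inter> Pow K \<times> Pow K) c \<and> card c = k" if "\<phi> c \<noteq> 0" for c
    using supp[OF that] crit_iff by blast
  moreover have "W.cdiff \<phi> s = 0" if "critical K (M \<inter> Pow K \<times> Pow K) s" for s
    using ker[of s] that eq[of \<phi> s] supp crit_iff by simp
  ultimately obtain \<psi> where \<psi>: "\<And>c. \<psi> c \<noteq> 0 \<Longrightarrow> critical K (M \<inter> Pow K \<times> Pow K) c \<and> card c = Suc k"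
    "\<And>s. critical K (M \<inter> Pow K \<times> Pow K) s \<Longrightarrow> W.cdiff \<psi> s = \<phi> s"
    using W.morse_exact[OF K(2), of \<phi> k] by blast
  have sub: "crit c \<and> c \<subseteq> K \<and> card c = Suc k" if "\<psi> c \<noteq> 0" for c
    using \<psi>(1)[OF that] crit_iff by blast
  show ?thesis
  proof (rule that[OF sub])
    fix s assume "crit s" "s \<subseteq> K"
    then show "F.cdiff \<psi> s = \<phi> s" using \<psi>(2)[of s] eq[of \<psi> s] sub crit_iff by simp
  qed
qed

end

lemma mdvd_mon_lcm_iff:
  "finite \<sigma> \<Longrightarrow> mdvd (mon_lcm \<sigma>) w \<longleftrightarrow> (\<forall>m\<in>\<sigma>. mdvd m w)"
  unfolding mdvd_def by (auto simp: mon_lcm_le_iff)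

lemma mon_lcm_empty [simp]: "mon_lcm {} = 0"
  by (simp add: mon_lcm_def)

lemma lookup_of_int_mult:
  fixes f :: "'k::comm_ring_1 mpoly"
  shows "Poly_Mapping.lookup (f * of_int z) w = Poly_Mapping.lookup f w * of_int z"
proof -
  have "of_int z = (Poly_Mapping.single 0 (of_int z) :: 'k mpoly)" by simp
  then have "Poly_Mapping.lookup (f * of_int z) w
      = Poly_Mapping.lookup (f * Poly_Mapping.single 0 (of_int z)) w" by simp
  also have "\<dots> = Poly_Mapping.lookup f w * of_int z" by (subst lookup_mult_single) simp
  finally show ?thesis .
qed

lemma mult_mono_poly_inject:
  fixes f :: "'k::field mpoly"
  assumes "\<And>w. Poly_Mapping.lookup (f * mono_poly m) w = Poly_Mapping.lookup (g * mono_poly m) w"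
  shows "f = g"
proof (rule poly_mapping_eqI)
  fix u
  show "Poly_Mapping.lookup f u = Poly_Mapping.lookup g u"
    using assms[of "u + m"] by (simp add: lookup_mult_single mdvd_add)
qed

lemma carrier_free_module:
  "finite B \<Longrightarrow> f \<in> carrier (free_module (poly_ring N) B) \<longleftrightarrow>
    (\<forall>b\<in>B. f b \<in> carrier (poly_ring N)) \<and> (\<forall>b. b \<notin> B \<longrightarrow> f b = 0)"
proof -
  assume fin: "finite B"
  have "finite {b. f b \<noteq> 0}" if "\<forall>b. b \<notin> B \<longrightarrow> f b = 0"
    by (rule finite_subset[OF _ fin]) (use that in auto)
  then show ?thesis by (auto simp: free_module_def)
qed

lemma free_module_simps [simp]:
  "add (free_module (poly_ring N) B) = (\<lambda>f g b. f b + g b)"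
  "smult (free_module (poly_ring N) B) = (\<lambda>a f b. a * f b)"
  "zero (free_module (poly_ring N) B) = (\<lambda>b. 0)"
  by (simp_all add: free_module_def)

text \<open>The monomial hypotheses behind the resolution: \<open>lcm_matching\<close> keeps matched
  pairs together in every multidegree and yields exactness, \<open>lcm_critical\<close> yields
  minimality, and \<open>empty_critical\<close> makes the free module in degree 0 the ring
  itself.\<close>

locale monomial_morse = morse_matching G r A \<mu> for G r A \<mu> +
  fixes N :: nat
  assumes keys_G: "m \<in> G \<Longrightarrow> Poly_Mapping.keys m \<subseteq> {1..N}"
    and matching: "bm_matching G r = A"
    and lcm_matching: "(\<sigma>, \<tau>) \<in> A \<Longrightarrow> mon_lcm \<sigma> = mon_lcm \<tau>"
    and lcm_critical: "critical G A \<sigma> \<Longrightarrow> critical G A \<tau> \<Longrightarrow> mon_lcm \<sigma> = mon_lcm \<tau> \<Longrightarrow> \<sigma> = \<tau>"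
    and empty_critical: "critical G A {}"
begin

sublocale morse_flow G r A \<mu> pflow
  by (rule morse_flow_pflow)

abbreviation "B \<equiv> bm_basis G r"

abbreviation below :: "mon \<Rightarrow> mon set" where
  "below w \<equiv> {m \<in> G. mdvd m w}"

lemma B_iff: "\<sigma> \<in> B k \<longleftrightarrow> crit \<sigma> \<and> card \<sigma> = k"
  by (simp add: bm_basis_def matching)

lemma finite_B: "finite (B k)"
  by (rule finite_subset[OF _ finite_crit]) (auto simp: B_iff)

lemma B_0: "B 0 = {{}}"
  using empty_critical fin_sub crit_sub by (auto simp: B_iff)

lemma sub_below_iff: "\<sigma> \<subseteq> G \<Longrightarrow> \<sigma> \<subseteq> below w \<longleftrightarrow> mdvd (mon_lcm \<sigma>) w"
  using fin_sub[of \<sigma>] by (auto simp: mdvd_mon_lcm_iff)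

lemma below_closed:
  assumes "(\<sigma>, \<tau>) \<in> A" "\<tau> \<subseteq> below w"
  shows "\<sigma> \<subseteq> below w"
  using assms M_sub[OF assms(1)] M_sub2[OF assms(1)] lcm_matching[OF assms(1)]
  by (simp only: sub_below_iff)

lemma keys_lcm:
  assumes "\<sigma> \<subseteq> G"
  shows "Poly_Mapping.keys (mon_lcm \<sigma>) \<subseteq> {1..N}"
proof
  fix i assume "i \<in> Poly_Mapping.keys (mon_lcm \<sigma>)"
  then have "\<not> Poly_Mapping.lookup (mon_lcm \<sigma>) i \<le> 0" by (simp add: in_keys_iff)
  then obtain m where "m \<in> \<sigma>" "Poly_Mapping.lookup m i \<noteq> 0"
    using mon_lcm_le_iff[OF fin_sub[OF assms], of i 0] by auto
  then show "i \<in> {1..N}" using keys_G assms by (metis in_keys_iff subsetD)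
qed

text \<open>The flow from facets of \<open>\<sigma>\<close> stays among the generators dividing
  \<open>mon_lcm \<sigma>\<close>. Hence the difference of exponents in a nonzero coefficient is a
  true quotient, not a truncated one.\<close>

lemma mdiff_lcm:
  assumes "crit s" "\<sigma> \<subseteq> G" "mdiff \<sigma> s \<noteq> 0"
  shows "mdvd (mon_lcm s) (mon_lcm \<sigma>)"
proof -
  have "\<sigma> \<subseteq> below (mon_lcm \<sigma>)" using assms(2) by (simp add: sub_below_iff)
  then have "s \<subseteq> below (mon_lcm \<sigma>)"
    using mdiff_sub[of "below (mon_lcm \<sigma>)" s \<sigma>] below_closed assms by blast
  then show ?thesis using crit_sub[OF assms(1)] by (simp add: sub_below_iff)
qed

lemma bm_coeff_eq:
  assumes "card \<sigma> = Suc (card s)"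
  shows "(bm_coeff G r \<sigma> s :: 'k::field mpoly) = of_int (mdiff \<sigma> s) * mono_poly (mon_lcm \<sigma> - mon_lcm s)"
proof -
  let ?m = "mono_poly (mon_lcm \<sigma> - mon_lcm s) :: 'k mpoly"
  have "(\<Sum>P\<in>gradient_paths G A c s. of_int (path_weight r A P) * ?m) = of_int (pflow c s) * ?m"
    if "facet \<sigma> c" for c
    using that assms by (simp add: pflow_def facet_def sum_distrib_right)
  then show ?thesis
    by (simp add: bm_coeff_def matching mdiff_def sum_distrib_right mult.assoc)
qed

lemma bm_coeff_carrier:
  assumes "\<sigma> \<in> B k" "s \<in> B (k - 1)" "1 \<le> k"
  shows "(bm_coeff G r \<sigma> s :: 'k::field mpoly) \<in> carrier (poly_ring N)"
proof -
  have "of_int (mdiff \<sigma> s) = (Poly_Mapping.single 0 (of_int (mdiff \<sigma> s)) :: 'k mpoly)" by simp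
  moreover have "Poly_Mapping.keys (mon_lcm \<sigma> - mon_lcm s) \<subseteq> {1..N}"
    using keys_diff_mon keys_lcm[of \<sigma>] assms crit_sub by (meson B_iff order_trans)
  ultimately show ?thesis
    using assms by (subst bm_coeff_eq) (auto simp: B_iff intro!: poly_ring_mult single_in_poly_ring simp del: single_of_int)
qed

text \<open>The component in multidegree \<open>w\<close> of the free module whose basis element
  \<open>\<sigma>\<close> has degree \<open>mon_lcm \<sigma>\<close>.\<close>

definition hom_part :: "(cell \<Rightarrow> 'k::field mpoly) \<Rightarrow> mon \<Rightarrow> cell \<Rightarrow> 'k" where
  "hom_part f w \<sigma> = Poly_Mapping.lookup (f \<sigma> * mono_poly (mon_lcm \<sigma>)) w"

lemma hom_part_below:
  "\<sigma> \<subseteq> G \<Longrightarrow> hom_part f w \<sigma> \<noteq> 0 \<Longrightarrow> \<sigma> \<subseteq> below w"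
  by (auto simp: hom_part_def lookup_mult_single sub_below_iff split: if_splits)

lemma hom_part_zero: "f \<sigma> = 0 \<Longrightarrow> hom_part f w \<sigma> = 0"
  by (simp add: hom_part_def)

lemma hom_part_inject: "(\<And>w. hom_part f w \<sigma> = hom_part h w \<sigma>) \<Longrightarrow> f \<sigma> = h \<sigma>"
  unfolding hom_part_def by (rule mult_mono_poly_inject)

text \<open>The differential is homogeneous: the monomial of a coefficient is the quotient of the
  two lcms, so multiplying by the lcm of the target cell turns it into the lcm of the source cell,
  and only the integer remains.\<close>

lemma hom_part_bm_diff:
  fixes f :: "cell \<Rightarrow> 'k::field mpoly"
  assumes k: "1 \<le> k" and supp: "\<And>\<sigma>. \<sigma> \<notin> B k \<Longrightarrow> f \<sigma> = 0" and s: "crit s"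
  shows "hom_part (bm_diff G r k f) w s = cdiff (hom_part f w) s"
proof (cases "s \<in> B (k - 1)")
  case True
  have coeff: "Poly_Mapping.lookup (f \<sigma> * bm_coeff G r \<sigma> s * mono_poly (mon_lcm s)) w
      = hom_part f w \<sigma> * of_int (mdiff \<sigma> s)" if \<sigma>: "\<sigma> \<in> B k" for \<sigma>
  proof -
    have c: "(bm_coeff G r \<sigma> s :: 'k mpoly) = of_int (mdiff \<sigma> s) * mono_poly (mon_lcm \<sigma> - mon_lcm s)"
      using \<sigma> True k by (intro bm_coeff_eq) (auto simp: B_iff)
    show ?thesis
    proof (cases "mdiff \<sigma> s = 0")
      case False
      then have "mdvd (mon_lcm s) (mon_lcm \<sigma>)"
        using mdiff_lcm s \<sigma> crit_sub by (simp add: B_iff)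
      then have "mono_poly (mon_lcm \<sigma>) = (mono_poly (mon_lcm \<sigma> - mon_lcm s) * mono_poly (mon_lcm s) :: 'k mpoly)"
        by (simp add: mult_single mdvd_diff_add)
      then have "f \<sigma> * bm_coeff G r \<sigma> s * mono_poly (mon_lcm s)
          = f \<sigma> * mono_poly (mon_lcm \<sigma>) * of_int (mdiff \<sigma> s)"
        unfolding c by (simp only: mult_ac)
      then show ?thesis by (simp only: lookup_of_int_mult hom_part_def)
    qed (simp add: c)
  qed
  have "hom_part (bm_diff G r k f) w s
      = (\<Sum>\<sigma>\<in>B k. Poly_Mapping.lookup (f \<sigma> * bm_coeff G r \<sigma> s * mono_poly (mon_lcm s)) w)"
    using True by (simp add: hom_part_def bm_diff_def sum_distrib_right lookup_sum)
  also have "\<dots> = (\<Sum>\<sigma>\<in>B k. hom_part f w \<sigma> * of_int (mdiff \<sigma> s))"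
    by (rule sum.cong) (simp_all add: coeff)
  also have "\<dots> = cdiff (hom_part f w) s"
    unfolding cdiff_def using finite_crit
    by (intro sum.mono_neutral_left) (auto simp: B_iff hom_part_zero supp)
  finally show ?thesis .
next
  case False
  have "hom_part f w \<sigma> * of_int (mdiff \<sigma> s) = 0" if "crit \<sigma>" for \<sigma>
  proof (cases "\<sigma> \<in> B k")
    case True
    then have "mdiff \<sigma> s = 0" using mdiff_card[of \<sigma> s] False s by (metis B_iff diff_Suc_1)
    then show ?thesis by simp
  qed (simp add: hom_part_zero supp)
  then have "cdiff (hom_part f w) s = 0" unfolding cdiff_def by (intro sum.neutral) blast
  then show ?thesis using False by (simp add: hom_part_def bm_diff_def)
qed

lemma bm_diff_supp: "\<sigma> \<notin> B (k - 1) \<Longrightarrow> bm_diff G r k f \<sigma> = 0"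
  by (simp add: bm_diff_def)

lemma bm_diff_square:
  fixes f :: "cell \<Rightarrow> 'k::field mpoly"
  assumes k: "1 \<le> k" and supp: "\<And>\<sigma>. \<sigma> \<notin> B (Suc k) \<Longrightarrow> f \<sigma> = 0"
  shows "bm_diff G r k (bm_diff G r (Suc k) f) s = 0"
proof (cases "s \<in> B (k - 1)")
  case True
  then have s: "crit s" by (simp add: B_iff)
  have "hom_part (bm_diff G r k (bm_diff G r (Suc k) f)) w s = hom_part (\<lambda>_. 0) w s" for w
  proof -
    have "hom_part (bm_diff G r k (bm_diff G r (Suc k) f)) w s
        = cdiff (hom_part (bm_diff G r (Suc k) f) w) s"
      by (intro hom_part_bm_diff[OF k _ s]) (simp add: bm_diff_supp)
    also have "\<dots> = cdiff (cdiff (hom_part f w)) s"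
      unfolding cdiff_def[of "hom_part (bm_diff _ _ _ _) _"] cdiff_def[of "cdiff _"]
      using hom_part_bm_diff[of "Suc k" f] supp by (intro sum.cong) auto
    finally show ?thesis using cdiff_cdiff[OF s, of "hom_part f w"] by (simp add: hom_part_def)
  qed
  then show ?thesis using hom_part_inject by blast
qed (simp add: bm_diff_supp)

lemma bm_diff_hom:
  assumes k: "1 \<le> k"
  shows "bm_diff G r k \<in> module_homs (poly_ring N :: 'k::field mpoly ring)
    (free_module (poly_ring N) (B k)) (free_module (poly_ring N) (B (k - 1)))"
proof -
  have "bm_diff G r k f b \<in> carrier (poly_ring N)"
    if "f \<in> carrier (free_module (poly_ring N :: 'k mpoly ring) (B k))" "b \<in> B (k - 1)" for f b
    using that k bm_coeff_carrier[OF _ that(2)]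
    by (auto simp: bm_diff_def carrier_free_module finite_B intro!: poly_ring_sum poly_ring_mult)
  then show ?thesis
    by (auto simp: module_homs_def carrier_free_module finite_B bm_diff_supp)
      (auto simp: bm_diff_def fun_eq_iff distrib_right sum.distrib sum_distrib_left mult.assoc)
qed

text \<open>A preimage is found separately in each multidegree. Hypothesis \<open>ne\<close> handles
  the multidegrees without generators, where the simplex is not exact.\<close>

lemma bm_exact:
  fixes f :: "cell \<Rightarrow> 'k::field mpoly"
  assumes f: "f \<in> carrier (free_module (poly_ring N) (B k))"
    and ne: "\<And>w \<sigma>. below w = {} \<Longrightarrow> \<sigma> \<in> B k \<Longrightarrow> hom_part f w \<sigma> = 0"
    and ker: "1 \<le> k \<Longrightarrow> bm_diff G r k f = (\<lambda>_. 0)"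
  obtains h where "h \<in> carrier (free_module (poly_ring N) (B (Suc k)))" "bm_diff G r (Suc k) h = f"
proof -
  have supp: "f \<sigma> = 0" if "\<sigma> \<notin> B k" for \<sigma> using f that by (simp add: carrier_free_module finite_B)
  \<comment> \<open>Only finitely many multidegrees occur in \<open>f\<close>; the preimage is
    assembled from these alone, which makes its coordinates polynomials.\<close>
  define W where "W = (\<Union>\<sigma>\<in>B k. Poly_Mapping.keys (f \<sigma> * mono_poly (mon_lcm \<sigma>)))"
  have finW: "finite W" by (simp add: W_def finite_B)
  have keysW: "Poly_Mapping.keys w \<subseteq> {1..N}" if w: "w \<in> W" for w
  proof -
    obtain \<sigma> where \<sigma>: "\<sigma> \<in> B k" "w \<in> Poly_Mapping.keys (f \<sigma> * mono_poly (mon_lcm \<sigma>))"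
      using w by (auto simp: W_def)
    have "\<sigma> \<subseteq> G" using \<sigma>(1) crit_sub by (simp add: B_iff)
    then have "f \<sigma> * mono_poly (mon_lcm \<sigma>) \<in> carrier (poly_ring N)"
      using f \<sigma>(1) keys_lcm
      by (intro poly_ring_mult single_in_poly_ring) (simp_all add: carrier_free_module finite_B)
    then show ?thesis using \<sigma>(2) by (simp add: in_poly_ring_iff)
  qed
  have ex: "\<exists>\<psi>. (\<forall>c. \<psi> c \<noteq> 0 \<longrightarrow> crit c \<and> c \<subseteq> below w \<and> card c = Suc k) \<and>
      (\<forall>s. crit s \<longrightarrow> s \<subseteq> below w \<longrightarrow> cdiff \<psi> s = hom_part f w s)" for w
  proof (cases "below w = {}")
    case True
    have "hom_part f w s = 0" for s using ne[OF True, of s] hom_part_zero[of f s w] supp[of s] by blast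
    then show ?thesis by (intro exI[of _ "\<lambda>_. 0"]) (simp add: cdiff_def)
  next
    case False
    have supp_w: "crit c \<and> c \<subseteq> below w \<and> card c = k" if "hom_part f w c \<noteq> 0" for c
    proof -
      have "c \<in> B k" using that hom_part_zero supp by blast
      then show ?thesis using hom_part_below[of c f w] that crit_sub by (simp add: B_iff)
    qed
    have "cdiff (hom_part f w) s = 0" if s: "crit s" for s
    proof (cases "1 \<le> k")
      case True
      then show ?thesis
        using hom_part_bm_diff[of k f s w] supp ker[OF True] s True by (simp add: hom_part_def)
    next
      case False
      \<comment> \<open>In degree 0 there is no outgoing differential, and none is missed: the
        support consists of the empty cell, which has no facets.\<close>
      have "hom_part f w c * of_int (mdiff c s) = 0" for c
        using supp_w[of c] mdiff_card[of c s] False by fastforce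
      then show ?thesis unfolding cdiff_def by (intro sum.neutral ballI)
    qed
    note ker_w = this
    show ?thesis
    proof (rule morse_exact_restrict[of "below w" "hom_part f w" k])
      show "below w \<subseteq> G" by blast
      show "below w \<noteq> {}" by (rule False)
      show "\<sigma> \<subseteq> below w" if "(\<sigma>, \<tau>) \<in> A" "\<tau> \<subseteq> below w" for \<sigma> \<tau>
        using below_closed that .
      show "crit c \<and> c \<subseteq> below w \<and> card c = k" if "hom_part f w c \<noteq> 0" for c
        using supp_w that .
      show "cdiff (hom_part f w) s = 0" if "crit s" for s using ker_w that .
    next
      fix \<psi> :: "cell \<Rightarrow> 'k"
      assume "\<And>c. \<psi> c \<noteq> 0 \<Longrightarrow> crit c \<and> c \<subseteq> below w \<and> card c = Suc k"
        "\<And>s. crit s \<Longrightarrow> s \<subseteq> below w \<Longrightarrow> cdiff \<psi> s = hom_part f w s"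
      then show ?thesis by blast
    qed
  qed
  obtain \<psi> where "\<forall>w. (\<forall>c. \<psi> w c \<noteq> 0 \<longrightarrow> crit c \<and> c \<subseteq> below w \<and> card c = Suc k) \<and>
      (\<forall>s. crit s \<longrightarrow> s \<subseteq> below w \<longrightarrow> cdiff (\<psi> w) s = hom_part f w s)"
    using choice[OF allI[OF ex]] ..
  then have \<psi>: "\<And>w c. \<psi> w c \<noteq> 0 \<Longrightarrow> crit c \<and> c \<subseteq> below w \<and> card c = Suc k"
    "\<And>w s. crit s \<Longrightarrow> s \<subseteq> below w \<Longrightarrow> cdiff (\<psi> w) s = hom_part f w s" by simp_all
  \<comment> \<open>If \<open>\<psi> w \<sigma>\<close> is nonzero, the lcm of
    \<open>\<sigma>\<close> divides \<open>w\<close> and the difference is a true quotient;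
    otherwise the term is zero anyway.\<close>
  define h where "h \<sigma> = (\<Sum>w\<in>W. Poly_Mapping.single (w - mon_lcm \<sigma>) (\<psi> w \<sigma>))" for \<sigma>
  have h_supp: "h \<sigma> = 0" if "\<sigma> \<notin> B (Suc k)" for \<sigma>
  proof -
    have "\<psi> w \<sigma> = 0" for w using that \<psi>(1)[of w \<sigma>] by (auto simp: B_iff)
    then show ?thesis by (simp add: h_def)
  qed
  have "h \<sigma> \<in> carrier (poly_ring N)" for \<sigma>
    unfolding h_def using keysW keys_diff_mon
    by (intro poly_ring_sum single_in_poly_ring) blast
  then have h: "h \<in> carrier (free_module (poly_ring N) (B (Suc k)))"
    using h_supp by (simp add: carrier_free_module finite_B)
  have h_part: "hom_part h w \<sigma> = (if w \<in> W then \<psi> w \<sigma> else 0)" for w \<sigma>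
  proof -
    have "Poly_Mapping.single (v - mon_lcm \<sigma>) (\<psi> v \<sigma>) * mono_poly (mon_lcm \<sigma>)
        = Poly_Mapping.single v (\<psi> v \<sigma>)" for v
    proof (cases "\<psi> v \<sigma> = 0")
      case False
      then have "mdvd (mon_lcm \<sigma>) v" using \<psi>(1) crit_sub sub_below_iff by blast
      then show ?thesis by (simp add: mult_single mdvd_diff_add)
    qed simp
    then have "hom_part h w \<sigma> = (\<Sum>v\<in>W. if v = w then \<psi> v \<sigma> else 0)"
      by (simp add: hom_part_def h_def sum_distrib_right lookup_sum lookup_single when_def)
    then show ?thesis using finW by simp
  qed
  have "bm_diff G r (Suc k) h s = f s" for s
  proof (cases "s \<in> B k")
    case True
    then have s: "crit s" by (simp add: B_iff)
    have "hom_part (bm_diff G r (Suc k) h) w s = hom_part f w s" for w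
    proof (cases "w \<in> W")
      case w: True
      show ?thesis
      proof (cases "s \<subseteq> below w")
        case True
        have "hom_part (bm_diff G r (Suc k) h) w s = cdiff (hom_part h w) s"
          using hom_part_bm_diff[of "Suc k" h s w] h_supp s by simp
        also have "hom_part h w = \<psi> w" using h_part w by auto
        finally show ?thesis using \<psi>(2)[OF s True] by simp
      next
        case False
        then show ?thesis using hom_part_below[OF crit_sub[OF s]] by metis
      qed
    next
      case False
      have "hom_part (bm_diff G r (Suc k) h) w s = cdiff (hom_part h w) s"
        using hom_part_bm_diff[of "Suc k" h s w] h_supp s by simp
      also have "\<dots> = 0" using h_part False by (simp add: cdiff_def)
      also have "\<dots> = hom_part f w s"
        using False \<open>s \<in> B k\<close> by (auto simp: W_def hom_part_def in_keys_iff)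
      finally show ?thesis .
    qed
    then show ?thesis by (rule hom_part_inject)
  qed (simp add: bm_diff_supp supp)
  then show ?thesis using that[OF h] by blast
qed

text \<open>A nonzero coefficient joins critical cells of different cardinality, hence of different
  lcm, so its monomial is not constant. It suffices that no summand has a constant term.\<close>

lemma bm_diff_minimal:
  fixes f :: "cell \<Rightarrow> 'k::field mpoly"
  assumes k: "1 \<le> k" and f: "f \<in> carrier (free_module (poly_ring N) (B k))" and b: "b \<in> B (k - 1)"
  shows "bm_diff G r k f b \<in> irrelevant_ideal N"
proof (rule in_irrelevant_ideal)
  have "bm_diff G r k f \<in> carrier (free_module (poly_ring N) (B (k - 1)))"
    using bm_diff_hom[OF k] f by (auto simp: module_homs_def)
  then show "bm_diff G r k f b \<in> carrier (poly_ring N)"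
    using b by (simp add: carrier_free_module finite_B)
  have "Poly_Mapping.lookup (f \<sigma> * bm_coeff G r \<sigma> b) 0 = 0" if \<sigma>: "\<sigma> \<in> B k" for \<sigma>
  proof (cases "mdiff \<sigma> b = 0")
    case False
    let ?m = "mon_lcm \<sigma> - mon_lcm b"
    have cr: "crit \<sigma>" "crit b" "card \<sigma> = Suc (card b)" using \<sigma> b k by (auto simp: B_iff)
    have "mdvd (mon_lcm b) (mon_lcm \<sigma>)" using mdiff_lcm[OF cr(2) crit_sub[OF cr(1)] False] .
    then have "?m + mon_lcm b = mon_lcm \<sigma>" by (rule mdvd_diff_add)
    moreover have "mon_lcm \<sigma> \<noteq> mon_lcm b" using lcm_critical[OF cr(1,2)] cr(3) by auto
    ultimately have "?m \<noteq> 0" by auto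
    then have "\<not> mdvd ?m 0" using mdvd_antisym mdvd_0 by blast
    then show ?thesis
      unfolding bm_coeff_eq[OF cr(3)] mult.assoc[symmetric] by (simp add: lookup_mult_single)
  qed (use \<sigma> b k in \<open>simp add: bm_coeff_eq B_iff\<close>)
  then have "Poly_Mapping.lookup (bm_diff G r k f b) 0 = 0"
    using b by (simp add: bm_diff_def lookup_sum)
  then show "0 \<notin> Poly_Mapping.keys (bm_diff G r k f b)" by (simp add: in_keys_iff)
qed

text \<open>The augmentation takes the coordinate at the empty cell modulo \<open>I\<close>. In
  positive degrees the multidegrees without generators are harmless, since only the empty cell lives
  there.\<close>

theorem bm_resolution_minimal:
  defines "I \<equiv> genideal (poly_ring N) (mono_poly ` G :: 'k::field mpoly set)"
  shows "minimal_free_resolution N (bm_basis G r) (bm_diff G r) (quotient_module (poly_ring N) I)"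
  unfolding minimal_free_resolution_def free_resolution_def
proof (intro conjI allI impI ballI)
  let ?R = "poly_ring N :: 'k mpoly ring"
  let ?F = "\<lambda>k. free_module ?R (B k)"
  fix k :: nat assume k: "1 \<le> k"
  show "bm_diff G r k \<in> module_homs ?R (?F k) (?F (k - 1))" by (rule bm_diff_hom[OF k])
  show "bm_diff G r (k + 1) ` carrier (?F (k + 1)) = module_ker (?F k) (?F (k - 1)) (bm_diff G r k)"
  proof (intro subset_antisym subsetI)
    fix f assume "f \<in> bm_diff G r (k + 1) ` carrier (?F (k + 1))"
    then obtain h where h: "h \<in> carrier (?F (Suc k))" "f = bm_diff G r (Suc k) h" by auto
    have "f \<in> carrier (?F k)" using bm_diff_hom[of "Suc k"] h by (auto simp: module_homs_def)
    moreover have "bm_diff G r k f = (\<lambda>_. 0)"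
      using bm_diff_square[OF k, of h] h by (auto simp: carrier_free_module finite_B)
    ultimately show "f \<in> module_ker (?F k) (?F (k - 1)) (bm_diff G r k)" by (simp add: module_ker_def)
  next
    fix f assume "f \<in> module_ker (?F k) (?F (k - 1)) (bm_diff G r k)"
    then have f: "f \<in> carrier (?F k)" "bm_diff G r k f = (\<lambda>_. 0)" by (auto simp: module_ker_def)
    have "hom_part f w \<sigma> = 0" if "below w = {}" "\<sigma> \<in> B k" for w \<sigma>
    proof (rule ccontr)
      assume "hom_part f w \<sigma> \<noteq> 0"
      then have "\<sigma> \<subseteq> below w" using hom_part_below[of \<sigma> f w] that(2) crit_sub by (simp add: B_iff)
      then have "\<sigma> = {}" using that(1) by simp
      then show False using that(2) k by (simp add: B_iff)
    qed
    then obtain h where "h \<in> carrier (?F (Suc k))" "bm_diff G r (Suc k) h = f"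
      using bm_exact[OF f(1)] f(2) by blast
    then show "f \<in> bm_diff G r (k + 1) ` carrier (?F (k + 1))" by auto
  qed
next
  let ?R = "poly_ring N :: 'k mpoly ring"
  let ?F = "\<lambda>k. free_module ?R (B k)"
  interpret R: cring ?R by (rule cring_poly_ring)
  have I: "I = {f \<in> carrier ?R. \<forall>w\<in>Poly_Mapping.keys f. below w \<noteq> {}}"
    unfolding I_def using genideal_mono[of G N, where 'k = 'k] keys_G by auto
  have "mono_poly ` G \<subseteq> carrier ?R" using keys_G single_in_poly_ring by blast
  then interpret I: ideal I ?R unfolding I_def by (rule R.genideal_ideal)
  define \<epsilon> :: "(cell \<Rightarrow> 'k mpoly) \<Rightarrow> 'k mpoly set" where "\<epsilon> f = I +>\<^bsub>?R\<^esub> f {}" for f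
  have F0: "f \<in> carrier (?F 0) \<longleftrightarrow> f {} \<in> carrier ?R \<and> (\<forall>b. b \<noteq> {} \<longrightarrow> f b = 0)" for f
    by (simp add: carrier_free_module finite_B B_0)
  have car: "carrier (?R Quot I) = (\<lambda>a. I +>\<^bsub>?R\<^esub> a) ` carrier ?R"
    by (auto simp: FactRing_def A_RCOSETS_def')
  note hom = I.rcos_ring_hom
  show "\<exists>\<epsilon>\<in>module_homs ?R (?F 0) (quotient_module ?R I).
      \<epsilon> ` carrier (?F 0) = carrier (quotient_module ?R I) \<and>
      bm_diff G r 1 ` carrier (?F 1) = module_ker (?F 0) (quotient_module ?R I) \<epsilon>"
  proof (intro bexI[of _ \<epsilon>] conjI)
    show "\<epsilon> \<in> module_homs ?R (?F 0) (quotient_module ?R I)"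
      using ring_hom_add[OF hom] ring_hom_mult[OF hom]
      by (auto simp: module_homs_def quotient_module_def F0 car \<epsilon>_def)
    show "\<epsilon> ` carrier (?F 0) = carrier (quotient_module ?R I)"
    proof (intro subset_antisym subsetI)
      fix X assume "X \<in> carrier (quotient_module ?R I)"
      then obtain a where a: "a \<in> carrier ?R" "X = I +>\<^bsub>?R\<^esub> a" by (auto simp: quotient_module_def car)
      then show "X \<in> \<epsilon> ` carrier (?F 0)"
        by (intro image_eqI[of _ _ "\<lambda>b. if b = {} then a else 0"]) (auto simp: F0 \<epsilon>_def)
    qed (auto simp: F0 \<epsilon>_def quotient_module_def car)
    have ker: "f \<in> module_ker (?F 0) (quotient_module ?R I) \<epsilon> \<longleftrightarrow> f \<in> carrier (?F 0) \<and> f {} \<in> I" for f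
    proof -
      have "I +>\<^bsub>?R\<^esub> a = I \<longleftrightarrow> a \<in> I" if "a \<in> carrier ?R" for a
        using I.a_rcos_const I.a_rcos_self[OF that] by blast
      then show ?thesis by (auto simp: module_ker_def quotient_module_def \<epsilon>_def FactRing_def F0)
    qed
    show "bm_diff G r 1 ` carrier (?F 1) = module_ker (?F 0) (quotient_module ?R I) \<epsilon>"
    proof (intro subset_antisym subsetI)
      fix f assume "f \<in> bm_diff G r 1 ` carrier (?F 1)"
      then obtain h where h: "h \<in> carrier (?F 1)" "f = bm_diff G r 1 h" by blast
      have f: "f \<in> carrier (?F 0)" using bm_diff_hom[of 1] h by (auto simp: module_homs_def)
      have hs: "h \<sigma> = 0" if "\<sigma> \<notin> B 1" for \<sigma> using h that by (simp add: carrier_free_module finite_B)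
      \<comment> \<open>In a multidegree that no generator divides, \<open>h\<close> has no
        component because its basis cells are nonempty; by homogeneity its image has none
        either.\<close>
      have ne: "below w \<noteq> {}" if w: "w \<in> Poly_Mapping.keys (f {})" for w
      proof
        assume e: "below w = {}"
        have "hom_part h w \<sigma> = 0" for \<sigma>
        proof (rule ccontr)
          assume "hom_part h w \<sigma> \<noteq> 0"
          moreover from this have "\<sigma> \<in> B 1" using hs hom_part_zero by blast
          ultimately have "\<sigma> \<subseteq> below w" "card \<sigma> = 1"
            using hom_part_below[of \<sigma> h w] crit_sub by (auto simp: B_iff)
          then show False using e by simp
        qed
        then have "hom_part f w {} = 0"
          using hom_part_bm_diff[of 1 h "{}" w] hs empty_critical h(2) by (simp add: cdiff_def)
        then show False using w by (simp add: hom_part_def lookup_mult_single in_keys_iff)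
      qed
      have "f {} \<in> carrier ?R" using f F0 by blast
      then have "f {} \<in> I" using ne unfolding I by blast
      with f show "f \<in> module_ker (?F 0) (quotient_module ?R I) \<epsilon>" by (simp only: ker simp_thms)
    next
      fix f assume "f \<in> module_ker (?F 0) (quotient_module ?R I) \<epsilon>"
      then have f: "f \<in> carrier (?F 0)" and fI: "f {} \<in> I" unfolding ker by blast+
      have ne: "below w \<noteq> {}" if "w \<in> Poly_Mapping.keys (f {})" for w
        using fI that unfolding I by blast
      have part: "hom_part f w \<sigma> = 0" if "below w = {}" "\<sigma> \<in> B 0" for w \<sigma>
      proof -
        have "w \<notin> Poly_Mapping.keys (f {})" using ne that(1) by blast
        moreover have "\<sigma> = {}" using that(2) by (simp add: B_0)
        ultimately show ?thesis by (simp add: hom_part_def lookup_mult_single in_keys_iff)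
      qed
      obtain h where "h \<in> carrier (?F (Suc 0))" "bm_diff G r (Suc 0) h = f"
      proof (rule bm_exact[OF f])
        \<comment> \<open>Vacuous in degree 0; the hypothesis on multidegrees, which is membership
          of \<open>f {}\<close> in \<open>I\<close>, takes over the part of the cycle
          condition.\<close>
        show "bm_diff G r 0 f = (\<lambda>_. 0)" if "1 \<le> (0 :: nat)" using that by simp
      qed (use part in blast)+
      then show "f \<in> bm_diff G r 1 ` carrier (?F 1)" by auto
    qed
  qed
next
  fix k :: nat and f :: "cell \<Rightarrow> 'k mpoly" and b
  assume "1 \<le> k" "f \<in> carrier (free_module (poly_ring N) (B k))" "b \<in> B (k - 1)"
  then show "bm_diff G r k f b \<in> irrelevant_ideal N" by (rule bm_diff_minimal)
qed

end

section \<open>Path ideals\<close>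

lemma min_gens_path:
  fixes I :: "'k::field mpoly set"
  assumes p: "1 \<le> p" and I: "I = path_ideal p (n + p - 1)"
  shows "min_gens (n + p - 1) I = path_gens p n"
    and "I = genideal (poly_ring (n + p - 1)) (mono_poly ` path_gens p n)"
proof -
  have "{1..n} = {i. 1 \<le> i \<and> i + p - 1 \<le> n + p - 1}" using p by auto
  then have "{mono_poly (path_mon p i) :: 'k mpoly | i. 1 \<le> i \<and> i + p - 1 \<le> n + p - 1}
      = mono_poly ` path_gens p n"
    unfolding path_gens_def by blast
  then show I': "I = genideal (poly_ring (n + p - 1)) (mono_poly ` path_gens p n)"
    by (simp add: I path_ideal_def)
  show "min_gens (n + p - 1) I = path_gens p n"
  proof (rule min_gens_antichain[OF _ _ I'])
    fix g assume "g \<in> path_gens p n"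
    then show "Poly_Mapping.keys g \<subseteq> {1..n + p - 1}" by (auto simp: path_gens_def keys_path_mon)
  next
    fix g h assume "g \<in> path_gens p n" "h \<in> path_gens p n" "mdvd g h"
    then obtain i j where ij: "g = path_mon p i" "h = path_mon p j" "{i..<i + p} \<subseteq> {j..<j + p}"
      using mdvd_keys[of g h] by (auto simp: path_gens_def keys_path_mon)
    \<comment> \<open>Windows of the same positive length contain one another only if they
      coincide.\<close>
    then have "i = j" using p by (auto simp: atLeastLessThan_subset_iff)
    then show "g = h" using ij by simp
  qed
qed

lemma monomial_morse_path:
  assumes p: "1 \<le> p"
  shows "monomial_morse (path_gens p n) (path_order p n) (path_matching p n) (path_rank p n) (n + p - 1)"
proof -
  interpret morse_matching "path_gens p n" "path_order p n" "path_matching p n" "path_rank p n"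
    by (rule morse_matching_path[OF p])
  show ?thesis
  proof
    fix m assume "m \<in> path_gens p n"
    then show "Poly_Mapping.keys m \<subseteq> {1..n + p - 1}" by (auto simp: path_gens_def keys_path_mon)
  next
    \<comment> \<open>A target still contains the lower neighbour of its pivot, so the empty cell is
      not a target.\<close>
    have "{} \<noteq> path_mon p ` (S - {q})" if S: "S \<subseteq> {1..n}" and q: "pivot p S = Some q" for S q
    proof -
      have "finite S" using S finite_subset by blast
      then obtain x where "x \<in> S" "x < q" using pivot_neighbours[OF _ q] by blast
      then show ?thesis by auto
    qed
    then show "critical (path_gens p n) (path_matching p n) {}"
      by (auto simp: critical_def path_matching_def)
  qed (use bm_matching_path[OF p] mon_lcm_path_matching[OF p] mon_lcm_critical_inj[OF p] in blast)+
qed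

theorem theorem3p9:
  fixes p n N :: nat and I :: "'k::field mpoly set"
    and G :: "mon set" and r :: "mon rel"
  assumes "p \<ge> 1" and "n \<ge> 1"
    and "N = n + p - 1"
    and "I = path_ideal p N"
    and "G = min_gens N I"
    and "r = path_order p n"
  shows "bridge_friendly N I \<and>
    minimal_free_resolution N (bm_basis G r) (bm_diff G r) (quotient_module (poly_ring N) I)"
proof
  have I: "I = path_ideal p (n + p - 1)" using assms by simp
  note gens = min_gens_path[OF assms(1) I]
  have G: "G = path_gens p n" using gens(1) assms by simp
  show "bridge_friendly N I"
    unfolding bridge_friendly_def potentially_type2_def type2_def
    using linear_order_path[OF assms(1), of n] bm_edges_path[OF assms(1), of n]
      bm_matching_path[OF assms(1), of n] G assms(5) by metis
  interpret monomial_morse "path_gens p n" "path_order p n" "path_matching p n" "path_rank p n" "n + p - 1"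
    by (rule monomial_morse_path[OF assms(1)])
  show "minimal_free_resolution N (bm_basis G r) (bm_diff G r) (quotient_module (poly_ring N) I)"
    using bm_resolution_minimal gens(2) by (simp add: G assms(3,6))
qed

end
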